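(* Let $(X_t)_{t\ge0}$ be a $d$-dimensional $G$-Lévy process on a sublinear expectation space $(\Omega,\mathcal{H},\hat{\mathbb{E}})$, and let $G_X[f(\cdot)]:=\lim_{\delta\downarrow0}\hat{\mathbb{E}}[f(X_\delta)]\delta^{-1}$ for $f\in C_b^3(\mathbb{R}^d)$ with $f(0)=0$. Then there exists a nonempty set $\mathcal{U}$ of triples $(v,q,Q)$, where $v$ is a measure on $(\mathbb{R}^d\setminus\{0\},\mathcal{B}(\mathbb{R}^d\setminus\{0\}))$ and $(q,Q)\in\mathbb{R}^d\times\mathbb{R}^{d\times d}$, satisfying $$\sup_{(v,q,Q)\in\mathcal{U}}\Big\{\int_{\mathbb{R}^d\setminus\{0\}}|z|\,v(dz)+|q|+\mathrm{tr}[QQ^T]\Big\}<\infty,$$ such that for every $f\in C_b^3(\mathbb{R}^d)$ with $f(0)=0$, $$G_X[f(\cdot)]=\sup_{(v,q,Q)\in\mathcal{U}}\Big\{\int_{\mathbb{R}^d\setminus\{0\}}f(z)\,v(dz)+\langle Df(0),q\rangle+\tfrac12\mathrm{tr}[D^2f(0)QQ^T]\Big\}.$$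
   Context: Sublinear expectation space. $\Omega$ is a set, $\mathcal{H}$ is a linear space of real functions on $\Omega$ such that $\varphi(X_1,\dots,X_n)\in\mathcal{H}$ whenever $X_1,\dots,X_n\in\mathcal{H}$ and $\varphi\in C_{Lip}(\mathbb{R}^n)$ (the Lipschitz functions); in particular $\mathcal{H}$ contains the constants. A sublinear expectation is a functional $\hat{\mathbb{E}}:\mathcal{H}\to\mathbb{R}$ with (a) $\hat{\mathbb{E}}[X]\ge\hat{\mathbb{E}}[Y]$ if $X\ge Y$; (b) $\hat{\mathbb{E}}[c]=c$ for $c\in\mathbb{R}$; (c) $\hat{\mathbb{E}}[X]-\hat{\mathbb{E}}[Y]\le\hat{\mathbb{E}}[X-Y]$; (d) $\hat{\mathbb{E}}[\lambda X]=\lambda\hat{\mathbb{E}}[X]$ for $\lambda\ge0$. Random vectors $X_1,X_2$ in $\mathbb{R}^n$ (with components in the respective $\mathcal{H}$'s, possibly on different spaces) are identically distributed if $\hat{\mathbb{E}}_1[\varphi(X_1)]=\hat{\mathbb{E}}_2[\varphi(X_2)]$ for all $\varphi\in C_{Lip}(\mathbb{R}^n)$. $Y\in\mathcal{H}^n$ is independent from $X\in\mathcal{H}^m$ if $\hat{\mathbb{E}}[\varphi(X,Y)]=\hat{\mathbb{E}}\big[\hat{\mathbb{E}}[\varphi(x,Y)]_{x=X}\big]$ for all $\varphi\in C_{Lip}(\mathbb{R}^m\times\mathbb{R}^n)$. Lévy process. A $d$-dimensional process is a family $(X_t)_{t\ge0}$ with $X_t\in\mathcal{H}^d$; it is càdlàg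 if all paths $t\mapsto X_t(\omega)$ are right-continuous with left limits. A $d$-dimensional càdlàg process is a Lévy process if (i) $X_0=0$; (ii) for all $t,s>0$, $X_{t+s}-X_t$ is independent from $(X_{t_1},\dots,X_{t_n})$ for every $n$ and $0\le t_1\le\dots\le t_n\le t$; (iii) the distribution of $X_{t+s}-X_t$ does not depend on $t$. $G$-Lévy process. A $d$-dimensional Lévy process $(X_t)$ is a $G$-Lévy process if there is a decomposition $X_t=X_t^c+X_t^d$, $t\ge0$, where $(X_t^c,X_t^d)_{t\ge0}$ is a $2d$-dimensional Lévy process with $$\lim_{t\downarrow0}\hat{\mathbb{E}}[|X_t^c|^3]t^{-1}=0,\qquad \hat{\mathbb{E}}[|X_t^d|]\le Ct\ \text{ for } t\ge0,$$ for some constant $C$. The decomposition is understood up to distribution: $(X^c,X^d)$ may live on another sublinear expectation space, provided $(X^c_t+X^d_t)_{t\ge0}$ has the same finite-dimensional distributions as $(X_t)_{t\ge 0}$. Integrability convention: $\mathcal{H}$ (of the space carrying $(X^c,X^d)$) contains $\psi(\xi^c,\xi^d)$ whenever $\xi^c$, $\xi^d$ are finite families of values of $X^c$, $X^d$ and $\psi$ is locally Lipschitz with $|\psi(x,y)|\le K(1+|x|^3+|y|)$ for some constant $K$. $C_b^k(\mathbb{R}^d)$: bounded $k$-times continuously differentiable functions with bounded derivatives of all orders $\le k$. For a $G$-Lévy process the limit defining $G_X[f(\cdot)]$ exists for every $f\in C_b^3(\mathbb{R}^d)$ with $f(0)=0$. *)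

theory Defs
  imports "HOL-Analysis.Analysis"
begin

section \<open>Sublinear expectation spaces\<close>

text \<open>A point of \<open>(\<real>\<^sup>d)\<^sup>n\<close> with \<open>n\<close> varying is encoded as a function \<open>nat \<Rightarrow> 'a\<close>, of which
  only the values below \<open>n\<close> matter. The function \<open>fam_norm n\<close> is the Euclidean norm of
  \<open>(x 0, \<dots>, x (n - 1))\<close>; a real function that is (locally) Lipschitz with respect to this seminorm
  cannot depend on the values \<open>x i\<close> with \<open>i \<ge> n\<close>.\<close>

definition fam_norm :: "nat \<Rightarrow> (nat \<Rightarrow> 'a::real_normed_vector) \<Rightarrow> real" where
  "fam_norm n x = L2_set (\<lambda>i. norm (x i)) {..<n}"

definition C_Lip :: "('a::real_normed_vector \<Rightarrow> real) \<Rightarrow> bool" where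
  "C_Lip \<phi> \<longleftrightarrow> (\<exists>L. L-lipschitz_on UNIV \<phi>)"

definition C_Lip_fam :: "nat \<Rightarrow> ((nat \<Rightarrow> 'a::real_normed_vector) \<Rightarrow> real) \<Rightarrow> bool" where
  "C_Lip_fam n \<phi> \<longleftrightarrow> (\<exists>L. \<forall>x y. \<bar>\<phi> x - \<phi> y\<bar> \<le> L * fam_norm n (\<lambda>i. x i - y i))"

text \<open>The norm of a pair of reals (or vectors) is the Euclidean one.\<close>

definition C_Lip_fam_vec ::
    "nat \<Rightarrow> ((nat \<Rightarrow> 'a::real_normed_vector) \<Rightarrow> 'b::real_normed_vector \<Rightarrow> real) \<Rightarrow> bool" where
  "C_Lip_fam_vec n \<phi> \<longleftrightarrow>
     (\<exists>L. \<forall>x x' y y'. \<bar>\<phi> x y - \<phi> x' y'\<bar> \<le> L * norm (fam_norm n (\<lambda>i. x i - x' i), y - y'))"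

definition locally_Lip_fam2 ::
    "nat \<Rightarrow> nat \<Rightarrow> ((nat \<Rightarrow> 'a::real_normed_vector) \<Rightarrow> (nat \<Rightarrow> 'b::real_normed_vector) \<Rightarrow> real) \<Rightarrow> bool"
  where
  "locally_Lip_fam2 m n \<psi> \<longleftrightarrow>
     (\<forall>x y. \<exists>r>0. \<exists>L. \<forall>x' x'' y' y''.
        fam_norm m (\<lambda>i. x' i - x i) < r \<longrightarrow> fam_norm m (\<lambda>i. x'' i - x i) < r \<longrightarrow>
        fam_norm n (\<lambda>j. y' j - y j) < r \<longrightarrow> fam_norm n (\<lambda>j. y'' j - y j) < r \<longrightarrow>
        \<bar>\<psi> x' y' - \<psi> x'' y''\<bar>
          \<le> L * norm (fam_norm m (\<lambda>i. x' i - x'' i), fam_norm n (\<lambda>j. y' j - y'' j)))"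

text \<open>The sample space is the type \<open>'w\<close>. The functional \<open>E\<close> is only meaningful on \<open>H\<close>.\<close>

locale sublinear_expectation_space =
  fixes H :: "('w \<Rightarrow> real) set"
    and E :: "('w \<Rightarrow> real) \<Rightarrow> real"
  assumes H_zero: "(\<lambda>\<omega>. 0) \<in> H"
    and H_add: "X \<in> H \<Longrightarrow> Y \<in> H \<Longrightarrow> (\<lambda>\<omega>. X \<omega> + Y \<omega>) \<in> H"
    and H_scale: "X \<in> H \<Longrightarrow> (\<lambda>\<omega>. c * X \<omega>) \<in> H"
    and H_Lip: "(\<And>i. i < n \<Longrightarrow> Z i \<in> H) \<Longrightarrow> C_Lip_fam n \<phi> \<Longrightarrow> (\<lambda>\<omega>. \<phi> (\<lambda>i. Z i \<omega>)) \<in> H"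
    and E_mono: "X \<in> H \<Longrightarrow> Y \<in> H \<Longrightarrow> (\<And>\<omega>. Y \<omega> \<le> X \<omega>) \<Longrightarrow> E Y \<le> E X"
    and E_const: "E (\<lambda>\<omega>. c) = c"
    and E_subadd: "X \<in> H \<Longrightarrow> Y \<in> H \<Longrightarrow> E X - E Y \<le> E (\<lambda>\<omega>. X \<omega> - Y \<omega>)"
    and E_pos_homogeneous: "X \<in> H \<Longrightarrow> 0 \<le> c \<Longrightarrow> E (\<lambda>\<omega>. c * X \<omega>) = c * E X"

definition random_vector :: "('w \<Rightarrow> real) set \<Rightarrow> ('w \<Rightarrow> 'a::euclidean_space) \<Rightarrow> bool" where
  "random_vector H Y \<longleftrightarrow> (\<forall>b\<in>Basis. (\<lambda>\<omega>. Y \<omega> \<bullet> b) \<in> H)"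

definition identically_distributed ::
    "(('w \<Rightarrow> real) \<Rightarrow> real) \<Rightarrow> ('w \<Rightarrow> 'a::euclidean_space) \<Rightarrow>
     (('v \<Rightarrow> real) \<Rightarrow> real) \<Rightarrow> ('v \<Rightarrow> 'a) \<Rightarrow> bool" where
  "identically_distributed E1 Y1 E2 Y2 \<longleftrightarrow>
     (\<forall>\<phi>. C_Lip \<phi> \<longrightarrow> E1 (\<lambda>\<omega>. \<phi> (Y1 \<omega>)) = E2 (\<lambda>\<omega>. \<phi> (Y2 \<omega>)))"

text \<open>\<open>Y\<close> is independent from the random vector \<open>(Z 0, \<dots>, Z (n - 1))\<close> (a non-symmetric relation).\<close>

definition independent_from ::
    "(('w \<Rightarrow> real) \<Rightarrow> real) \<Rightarrow> ('w \<Rightarrow> 'b::euclidean_space) \<Rightarrow>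
     nat \<Rightarrow> (nat \<Rightarrow> 'w \<Rightarrow> 'a::euclidean_space) \<Rightarrow> bool" where
  "independent_from E Y n Z \<longleftrightarrow>
     (\<forall>\<phi>. C_Lip_fam_vec n \<phi> \<longrightarrow>
        E (\<lambda>\<omega>. \<phi> (\<lambda>i. Z i \<omega>) (Y \<omega>)) = E (\<lambda>\<omega>. E (\<lambda>\<omega>'. \<phi> (\<lambda>i. Z i \<omega>) (Y \<omega>'))))"


section \<open>G-Levy processes\<close>

text \<open>A process is a function on all of \<open>\<real>\<close>, of which only the values at times \<open>t \<ge> 0\<close> matter.\<close>

definition cadlag_process ::
    "('w \<Rightarrow> real) set \<Rightarrow> (real \<Rightarrow> 'w \<Rightarrow> 'a::euclidean_space) \<Rightarrow> bool" where
  "cadlag_process H X \<longleftrightarrow>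
     (\<forall>t\<ge>0. random_vector H (X t)) \<and>
     (\<forall>\<omega>. (\<forall>t\<ge>0. continuous (at_right t) (\<lambda>s. X s \<omega>)) \<and>
          (\<forall>t>0. \<exists>l. ((\<lambda>s. X s \<omega>) \<longlongrightarrow> l) (at_left t)))"

definition levy_process ::
    "('w \<Rightarrow> real) set \<Rightarrow> (('w \<Rightarrow> real) \<Rightarrow> real) \<Rightarrow> (real \<Rightarrow> 'w \<Rightarrow> 'a::euclidean_space) \<Rightarrow> bool" where
  "levy_process H E X \<longleftrightarrow>
     cadlag_process H X \<and>
     (\<forall>\<omega>. X 0 \<omega> = 0) \<and>
     (\<forall>t>0. \<forall>s>0. \<forall>n \<tau>.
        (\<forall>i<n. 0 \<le> \<tau> i \<and> \<tau> i \<le> t) \<longrightarrow> (\<forall>i j. i \<le> j \<longrightarrow> j < n \<longrightarrow> \<tau> i \<le> \<tau> j) \<longrightarrow>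
        independent_from E (\<lambda>\<omega>. X (t + s) \<omega> - X t \<omega>) n (\<lambda>i. X (\<tau> i))) \<and>
     (\<forall>s>0. \<forall>t\<ge>0. \<forall>t'\<ge>0.
        identically_distributed E (\<lambda>\<omega>. X (t + s) \<omega> - X t \<omega>) E (\<lambda>\<omega>. X (t' + s) \<omega> - X t' \<omega>))"

definition same_fin_dim_distributions ::
    "(('w \<Rightarrow> real) \<Rightarrow> real) \<Rightarrow> (real \<Rightarrow> 'w \<Rightarrow> 'a::euclidean_space) \<Rightarrow>
     (('v \<Rightarrow> real) \<Rightarrow> real) \<Rightarrow> (real \<Rightarrow> 'v \<Rightarrow> 'a) \<Rightarrow> bool" where
  "same_fin_dim_distributions E1 X1 E2 X2 \<longleftrightarrow>
     (\<forall>n \<tau> \<phi>. (\<forall>i<n. 0 \<le> \<tau> i) \<longrightarrow> C_Lip_fam n \<phi> \<longrightarrow>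
        E1 (\<lambda>\<omega>. \<phi> (\<lambda>i. X1 (\<tau> i) \<omega>)) = E2 (\<lambda>\<omega>. \<phi> (\<lambda>i. X2 (\<tau> i) \<omega>)))"

definition integrability_convention ::
    "('v \<Rightarrow> real) set \<Rightarrow> (real \<Rightarrow> 'v \<Rightarrow> 'a::euclidean_space) \<Rightarrow> (real \<Rightarrow> 'v \<Rightarrow> 'a) \<Rightarrow> bool" where
  "integrability_convention H Xc Xd \<longleftrightarrow>
     (\<forall>m n \<sigma> \<tau> \<psi>. (\<forall>i<m. 0 \<le> \<sigma> i) \<longrightarrow> (\<forall>j<n. 0 \<le> \<tau> j) \<longrightarrow>
        locally_Lip_fam2 m n \<psi> \<longrightarrow>
        (\<exists>K. \<forall>x y. \<bar>\<psi> x y\<bar> \<le> K * (1 + fam_norm m x ^ 3 + fam_norm n y)) \<longrightarrow>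
        (\<lambda>\<omega>. \<psi> (\<lambda>i. Xc (\<sigma> i) \<omega>) (\<lambda>j. Xd (\<tau> j) \<omega>)) \<in> H)"

text \<open>The decomposition may live on another sublinear expectation space, whose sample space is the
  type \<open>'v\<close>. As one cannot quantify over types inside a formula, this type is a parameter; when the
  predicate occurs as a hypothesis with a free type variable \<open>'v\<close>, that sample space is arbitrary.\<close>

definition G_levy_process ::
    "'v itself \<Rightarrow> ('w \<Rightarrow> real) set \<Rightarrow> (('w \<Rightarrow> real) \<Rightarrow> real) \<Rightarrow>
     (real \<Rightarrow> 'w \<Rightarrow> 'a::euclidean_space) \<Rightarrow> bool" where
  "G_levy_process T H E X \<longleftrightarrow>
     levy_process H E X \<and>
     (\<exists>(H' :: ('v \<Rightarrow> real) set) E' Xc Xd.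
        sublinear_expectation_space H' E' \<and>
        levy_process H' E' (\<lambda>t \<omega>. (Xc t \<omega>, Xd t \<omega>)) \<and>
        integrability_convention H' Xc Xd \<and>
        same_fin_dim_distributions E X E' (\<lambda>t \<omega>. Xc t \<omega> + Xd t \<omega>) \<and>
        ((\<lambda>t. E' (\<lambda>\<omega>. norm (Xc t \<omega>) ^ 3) / t) \<longlongrightarrow> 0) (at_right 0) \<and>
        (\<exists>C. \<forall>t\<ge>0. E' (\<lambda>\<omega>. norm (Xd t \<omega>)) \<le> C * t))"

definition G_X ::
    "(('w \<Rightarrow> real) \<Rightarrow> real) \<Rightarrow> (real \<Rightarrow> 'w \<Rightarrow> 'a::euclidean_space) \<Rightarrow> ('a \<Rightarrow> real) \<Rightarrow> real" where
  "G_X E X f = Lim (at_right 0) (\<lambda>\<delta>. E (\<lambda>\<omega>. f (X \<delta> \<omega>)) / \<delta>)"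


section \<open>Test functions and their derivatives\<close>

definition partial_derivative :: "'d::finite \<Rightarrow> (real^'d \<Rightarrow> real) \<Rightarrow> real^'d \<Rightarrow> real" where
  "partial_derivative i f x = frechet_derivative f (at x) (axis i 1)"

definition grad :: "(real^'d::finite \<Rightarrow> real) \<Rightarrow> real^'d \<Rightarrow> real^'d" where
  "grad f x = (\<chi> i. partial_derivative i f x)"

definition hessian :: "(real^'d::finite \<Rightarrow> real) \<Rightarrow> real^'d \<Rightarrow> real^'d^'d" where
  "hessian f x = (\<chi> i j. partial_derivative i (partial_derivative j f) x)"

text \<open>Bounded \<open>k\<close> times continuously differentiable functions whose partial derivatives of order at
  most \<open>k\<close> are all bounded. Continuity of the derivatives of order less than \<open>k\<close> follows from
  differentiability.\<close>

fun C_b :: "nat \<Rightarrow> (real^'d::finite \<Rightarrow> real) \<Rightarrow> bool" where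
  "C_b 0 f \<longleftrightarrow> continuous_on UNIV f \<and> bounded (range f)"
| "C_b (Suc k) f \<longleftrightarrow>
     bounded (range f) \<and> (\<forall>x. f differentiable (at x)) \<and> (\<forall>i. C_b k (partial_derivative i f))"

end

theory Submission
  imports Defs
begin

text \<open>The limit and its representation both come from the nonlinear semigroup \<open>P t f = E (f (X t))\<close>, which acts
  on Lipschitz functions and satisfies \<open>P (t + s) f = P t (\<lambda>x. P s (\<lambda>y. f (x + y)))\<close> because the increments
  are independent and stationary.

  The decomposition into \<open>X\<^sup>c\<close> and \<open>X\<^sup>d\<close> yields two facts (\<open>G_levy_semigroup\<close>): the first moment of \<open>X t\<close> tends
  to \<open>0\<close> with \<open>t\<close>, and, uniformly in \<open>e\<close>, the function \<open>min (norm z) (norm z ^ 3 / e\<^sup>2)\<close> has expectation \<open>O(t)\<close>.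
  The rest of the argument is about semigroups with these two properties.

  Existence of the limit (\<open>generator_exists\<close>): linear functions have expectation \<open>O(t)\<close> by additivity, and a
  convexity argument with Huber's function shows that a function which is quadratic near \<open>0\<close> and of linear
  growth has expectation \<open>O(t)\<close> as well. Hence \<open>P t g = O(t)\<close> for smooth \<open>g\<close> with \<open>g 0 = 0\<close>, with a constant
  proportional to the derivatives of \<open>g\<close>. For \<open>f\<close> with bounded third derivatives this makes \<open>P s (f (x + _)) - f x\<close>
  Lipschitz in \<open>x\<close> with a constant of order \<open>s\<close>, so that \<open>t \<mapsto> P t f\<close> is additive up to small errors and has a
  derivative at \<open>0\<close>.

  Representation (\<open>generator_representation\<close>): the derivative at \<open>0\<close> is sublinear in \<open>f\<close>. By the Hahn-Banach
  theorem (\<open>hahn_banach_cone\<close>) it is at each \<open>f\<close> the largest value of a linear functional \<open>F\<close> below it, and it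
  remains to find the triple of such an \<open>F\<close> (\<open>levy_khintchine_representation\<close>). Monotonicity makes \<open>F\<close> positive.
  On functions that vanish to third order at \<open>0\<close> the bound for \<open>min (norm z) (norm z ^ 3 / e\<^sup>2)\<close> makes \<open>F\<close>
  tight, so it is integration against a measure \<open>v\<close> (\<open>tight_positive_functional_representation\<close>), and \<open>e \<rightarrow> 0\<close>
  in this bound gives the first moment of \<open>v\<close>. By Taylor's formula a general \<open>f\<close> differs from such a function
  by a combination of linear and quadratic terms, with coefficients \<open>Df(0)\<close> and \<open>D\<^sup>2f(0)\<close>. The values of \<open>F\<close>
  on these terms, less their integrals against \<open>v\<close>, are the vector \<open>q\<close> and a positive semidefinite matrix,
  which is \<open>Q Q\<^sup>T\<close> by \<open>psd_factorization\<close>.\<close>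

section \<open>A Hahn-Banach theorem for convex cones\<close>

text \<open>A pair \<open>(f, r)\<close> records that a sublinear functional takes a value of at most \<open>r\<close> at \<open>f\<close>; the
  last condition forbids a negative value at \<open>0\<close>. A cone of pairs encodes the functional without a
  domain having to be chosen on which it is finite.\<close>

definition convex_cone_pairs :: "(('a \<Rightarrow> real) \<times> real) set \<Rightarrow> bool" where
  "convex_cone_pairs C \<longleftrightarrow>
     (\<forall>f r g s. (f, r) \<in> C \<longrightarrow> (g, s) \<in> C \<longrightarrow> (\<lambda>x. f x + g x, r + s) \<in> C) \<and>
     (\<forall>f r a. (f, r) \<in> C \<longrightarrow> 0 \<le> a \<longrightarrow> (\<lambda>x. a * f x, a * r) \<in> C) \<and>
     (\<forall>r. (\<lambda>x. 0, r) \<in> C \<longrightarrow> 0 \<le> r)"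

lemma convex_cone_pairsI:
  assumes "\<And>f r g s. (f, r) \<in> C \<Longrightarrow> (g, s) \<in> C \<Longrightarrow> (\<lambda>x. f x + g x, r + s) \<in> C"
    and "\<And>f r a. (f, r) \<in> C \<Longrightarrow> 0 \<le> a \<Longrightarrow> (\<lambda>x. a * f x, a * r) \<in> C"
    and "\<And>r. (\<lambda>x. 0, r) \<in> C \<Longrightarrow> 0 \<le> r"
  shows "convex_cone_pairs C"
  using assms unfolding convex_cone_pairs_def by blast

lemma convex_cone_pairs_add:
  "convex_cone_pairs C \<Longrightarrow> (f, r) \<in> C \<Longrightarrow> (g, s) \<in> C \<Longrightarrow> (\<lambda>x. f x + g x, r + s) \<in> C"
  unfolding convex_cone_pairs_def by blast

lemma convex_cone_pairs_scale:
  "convex_cone_pairs C \<Longrightarrow> (f, r) \<in> C \<Longrightarrow> 0 \<le> a \<Longrightarrow> (\<lambda>x. a * f x, a * r) \<in> C"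
  unfolding convex_cone_pairs_def by blast

lemma convex_cone_pairs_zero:
  "convex_cone_pairs C \<Longrightarrow> (\<lambda>x. 0, r) \<in> C \<Longrightarrow> 0 \<le> r"
  unfolding convex_cone_pairs_def by blast

lemma convex_cone_pairs_origin:
  assumes "convex_cone_pairs C" "C \<noteq> {}"
  shows "(\<lambda>x. 0, 0) \<in> C"
proof -
  obtain f r where "(f, r) \<in> C" using assms(2) by auto
  from convex_cone_pairs_scale[OF assms(1) this, of 0] show ?thesis by simp
qed

text \<open>A violation of the last condition after adjoining \<open>(f, r)\<close> must use a positive multiple of it;
  after rescaling it is a pair \<open>(- f, s)\<close> with \<open>s < - r\<close>, which the hypothesis excludes.\<close>

lemma convex_cone_pairs_adjoin:
  assumes C: "convex_cone_pairs C" and C_ne: "C \<noteq> {}"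
    and no_opposite: "\<And>s. (\<lambda>x. - f x, s) \<in> C \<Longrightarrow> - r \<le> s"
  obtains D where "convex_cone_pairs D" "C \<subseteq> D" "(f, r) \<in> D"
proof
  define D where "D = {(\<lambda>x. g x + a * f x, s + a * r) | g s a. (g, s) \<in> C \<and> 0 \<le> a}"
  show "convex_cone_pairs D"
  proof (rule convex_cone_pairsI)
    fix g1 s1 g2 s2 assume "(g1, s1) \<in> D" "(g2, s2) \<in> D"
    then obtain h1 t1 a1 h2 t2 a2 where
      1: "g1 = (\<lambda>x. h1 x + a1 * f x)" "s1 = t1 + a1 * r" "(h1, t1) \<in> C" "0 \<le> a1" and
      2: "g2 = (\<lambda>x. h2 x + a2 * f x)" "s2 = t2 + a2 * r" "(h2, t2) \<in> C" "0 \<le> a2"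
      unfolding D_def by blast
    have "(\<lambda>x. g1 x + g2 x) = (\<lambda>x. (h1 x + h2 x) + (a1 + a2) * f x)"
      "s1 + s2 = (t1 + t2) + (a1 + a2) * r"
      using 1 2 by (auto simp: algebra_simps)
    with convex_cone_pairs_add[OF C 1(3) 2(3)] 1(4) 2(4)
    show "(\<lambda>x. g1 x + g2 x, s1 + s2) \<in> D"
      unfolding D_def mem_Collect_eq
      by (intro exI[of _ "\<lambda>x. h1 x + h2 x"] exI[of _ "t1 + t2"] exI[of _ "a1 + a2"]) simp
  next
    fix g s and b :: real assume "(g, s) \<in> D" and b: "0 \<le> b"
    then obtain h t a where
      1: "g = (\<lambda>x. h x + a * f x)" "s = t + a * r" "(h, t) \<in> C" "0 \<le> a"
      unfolding D_def by blast
    have "(\<lambda>x. b * g x) = (\<lambda>x. b * h x + (b * a) * f x)" "b * s = b * t + (b * a) * r"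
      using 1 by (auto simp: algebra_simps)
    with convex_cone_pairs_scale[OF C 1(3) b] 1(4) b
    show "(\<lambda>x. b * g x, b * s) \<in> D"
      unfolding D_def mem_Collect_eq
      by (intro exI[of _ "\<lambda>x. b * h x"] exI[of _ "b * t"] exI[of _ "b * a"]) simp
  next
    fix s' assume "(\<lambda>x. 0, s') \<in> D"
    then obtain g s a where
      1: "(\<lambda>x. 0) = (\<lambda>x. g x + a * f x)" "s' = s + a * r" "(g, s) \<in> C" "0 \<le> a"
      unfolding D_def by blast
    have g: "g x = - (a * f x)" for x
      using fun_cong[OF 1(1), of x] by linarith
    show "0 \<le> s'"
    proof (cases "a = 0")
      case True
      then have "g = (\<lambda>x. 0)" using g by auto
      then show ?thesis using convex_cone_pairs_zero[OF C] 1 True by simp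
    next
      case False
      then have a: "a > 0" using 1(4) by simp
      have "(\<lambda>x. inverse a * g x) = (\<lambda>x. - f x)"
        using g a by (auto simp: field_simps)
      then have "(\<lambda>x. - f x, inverse a * s) \<in> C"
        using convex_cone_pairs_scale[OF C 1(3), of "inverse a"] a by simp
      then have "- r \<le> inverse a * s" by (rule no_opposite)
      then have "- r * a \<le> s"
        using a by (simp add: field_simps)
      then show ?thesis using 1(2) by (simp add: algebra_simps)
    qed
  qed
  show "C \<subseteq> D"
  proof
    fix p assume "p \<in> C"
    then show "p \<in> D"
      unfolding D_def mem_Collect_eq
      by (intro exI[of _ "fst p"] exI[of _ "snd p"] exI[of _ 0]) simp
  qed
  show "(f, r) \<in> D"
    using convex_cone_pairs_origin[OF C C_ne] unfolding D_def mem_Collect_eq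
    by (intro exI[of _ "\<lambda>x. 0"] exI[of _ 0] exI[of _ 1]) simp
qed

lemma convex_cone_pairs_maximal:
  assumes "convex_cone_pairs C" "C \<noteq> {}"
  obtains M where "convex_cone_pairs M" "C \<subseteq> M"
    "\<And>D. convex_cone_pairs D \<Longrightarrow> M \<subseteq> D \<Longrightarrow> D = M"
proof -
  define \<A> where "\<A> = {D. convex_cone_pairs D \<and> C \<subseteq> D}"
  have "\<exists>M\<in>\<A>. \<forall>D\<in>\<A>. M \<subseteq> D \<longrightarrow> D = M"
  proof (rule subset_Zorn_nonempty)
    show "\<A> \<noteq> {}" using assms unfolding \<A>_def by auto
    fix \<C> assume ne: "\<C> \<noteq> {}" and chain: "subset.chain \<A> \<C>"
    have cone: "convex_cone_pairs D" "C \<subseteq> D" if "D \<in> \<C>" for D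
      using that chain unfolding subset.chain_def \<A>_def by auto
    have "convex_cone_pairs (\<Union>\<C>)"
    proof (rule convex_cone_pairsI)
      fix f g :: "'a \<Rightarrow> real" and r s
      assume "(f, r) \<in> \<Union>\<C>" "(g, s) \<in> \<Union>\<C>"
      then obtain D1 D2 where D: "D1 \<in> \<C>" "(f, r) \<in> D1" "D2 \<in> \<C>" "(g, s) \<in> D2" by blast
      then have "D1 \<subseteq> D2 \<or> D2 \<subseteq> D1" using chain unfolding subset.chain_def by blast
      then obtain D where "D \<in> \<C>" "(f, r) \<in> D" "(g, s) \<in> D" using D by blast
      then show "(\<lambda>x. f x + g x, r + s) \<in> \<Union>\<C>"
        using convex_cone_pairs_add[OF cone(1)] by blast
    next
      fix f :: "'a \<Rightarrow> real" and r a :: real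
      assume "(f, r) \<in> \<Union>\<C>" "0 \<le> a"
      then show "(\<lambda>x. a * f x, a * r) \<in> \<Union>\<C>"
        using convex_cone_pairs_scale[OF cone(1)] by blast
    next
      fix r assume "(\<lambda>x. 0, r) \<in> \<Union>\<C>"
      then show "0 \<le> r" using convex_cone_pairs_zero[OF cone(1)] by blast
    qed
    then show "\<Union>\<C> \<in> \<A>" using cone(2) ne unfolding \<A>_def by blast
  qed
  then obtain M where "M \<in> \<A>" "\<And>D. D \<in> \<A> \<Longrightarrow> M \<subseteq> D \<Longrightarrow> D = M" by blast
  then show thesis using that unfolding \<A>_def by blast
qed

text \<open>The encoded functional is finite at these functions: a bound for \<open>- f\<close> bounds the value at \<open>f\<close> from
  below.\<close>

definition two_sided_domain :: "(('a \<Rightarrow> real) \<times> real) set \<Rightarrow> ('a \<Rightarrow> real) set" where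
  "two_sided_domain C = {f. (\<exists>r. (f, r) \<in> C) \<and> (\<exists>r. (\<lambda>x. - f x, r) \<in> C)}"

lemma two_sided_domain_add:
  assumes C: "convex_cone_pairs C" and f: "f \<in> two_sided_domain C" and g: "g \<in> two_sided_domain C"
  shows "(\<lambda>x. f x + g x) \<in> two_sided_domain C"
proof -
  obtain r r' s s' where rs: "(f, r) \<in> C" "(\<lambda>x. - f x, r') \<in> C" "(g, s) \<in> C" "(\<lambda>x. - g x, s') \<in> C"
    using f g unfolding two_sided_domain_def by blast
  show ?thesis
    using convex_cone_pairs_add[OF C rs(1,3)] convex_cone_pairs_add[OF C rs(2,4)]
    unfolding two_sided_domain_def by auto
qed

lemma two_sided_domain_neg: "f \<in> two_sided_domain C \<Longrightarrow> (\<lambda>x. - f x) \<in> two_sided_domain C"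
  unfolding two_sided_domain_def by auto

lemma two_sided_domain_scale:
  assumes C: "convex_cone_pairs C" and f: "f \<in> two_sided_domain C"
  shows "(\<lambda>x. a * f x) \<in> two_sided_domain C"
proof -
  have pos: "(\<lambda>x. b * g x) \<in> two_sided_domain C" if g: "g \<in> two_sided_domain C" and b: "0 \<le> b" for b g
  proof -
    obtain r r' where rs: "(g, r) \<in> C" "(\<lambda>x. - g x, r') \<in> C"
      using g unfolding two_sided_domain_def by blast
    show ?thesis
      using convex_cone_pairs_scale[OF C rs(1) b] convex_cone_pairs_scale[OF C rs(2) b]
      unfolding two_sided_domain_def by auto
  qed
  show ?thesis
    using pos[OF f, of a] pos[OF two_sided_domain_neg[OF f], of "- a"] by (cases "0 \<le> a") auto
qed

text \<open>In a maximal cone \<open>M\<close> every pair \<open>(f, r)\<close> that is missing has been excluded by some \<open>(- f, s)\<close> with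
  \<open>s < - r\<close>. Hence \<open>F f\<close>, the infimum of the \<open>r\<close> with \<open>(f, r) \<in> M\<close>, is an odd function of \<open>f\<close>, and an odd
  sublinear functional is linear. Adjoining \<open>(- f0, - p0)\<close> before passing to \<open>M\<close> forces \<open>F f0 \<ge> p0\<close>.\<close>

theorem hahn_banach_cone:
  fixes f0 :: "'a \<Rightarrow> real"
  assumes C: "convex_cone_pairs C" and C_ne: "C \<noteq> {}"
    and f0: "\<And>r. (f0, r) \<in> C \<Longrightarrow> p0 \<le> r"
  obtains F :: "('a \<Rightarrow> real) \<Rightarrow> real" where
    "\<And>f g. f \<in> two_sided_domain C \<Longrightarrow> g \<in> two_sided_domain C \<Longrightarrow> F (\<lambda>x. f x + g x) = F f + F g"
    "\<And>f a. f \<in> two_sided_domain C \<Longrightarrow> F (\<lambda>x. a * f x) = a * F f"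
    "\<And>f r. f \<in> two_sided_domain C \<Longrightarrow> (f, r) \<in> C \<Longrightarrow> F f \<le> r"
    "f0 \<in> two_sided_domain C \<Longrightarrow> p0 \<le> F f0"
proof -
  obtain C' where C': "convex_cone_pairs C'" "C \<subseteq> C'" "(\<lambda>x. - f0 x, - p0) \<in> C'"
    using convex_cone_pairs_adjoin[OF C C_ne, of "\<lambda>x. - f0 x" "- p0"] f0 by auto
  obtain M where M: "convex_cone_pairs M" "C' \<subseteq> M"
    and maximal: "\<And>D. convex_cone_pairs D \<Longrightarrow> M \<subseteq> D \<Longrightarrow> D = M"
    using convex_cone_pairs_maximal[OF C'(1)] C'(3) by blast
  have CM: "p \<in> M" if "p \<in> C" for p using that C' M by blast
  have M_ne: "M \<noteq> {}" using M(2) C'(3) by blast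
  have dichotomy: "(f, r) \<in> M \<or> (\<exists>s. (\<lambda>x. - f x, s) \<in> M \<and> s < - r)" for f r
    using convex_cone_pairs_adjoin[OF M(1) M_ne, of f r] maximal by (metis not_le)
  define F where "F f = Inf {r. (f, r) \<in> M}" for f
  let ?S = "two_sided_domain C"
  have opposite: "- s \<le> r" if "(f, r) \<in> M" "(\<lambda>x. - f x, s) \<in> M" for f r s
    using convex_cone_pairs_zero[OF M(1), of "r + s"] convex_cone_pairs_add[OF M(1) that] by simp
  have ne: "{r. (f, r) \<in> M} \<noteq> {}" and bdd: "bdd_below {r. (f, r) \<in> M}" if f: "f \<in> ?S" for f
  proof -
    obtain r s where rs: "(f, r) \<in> M" "(\<lambda>x. - f x, s) \<in> M"
      using f CM unfolding two_sided_domain_def by blast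
    then show "{r. (f, r) \<in> M} \<noteq> {}" by blast
    show "bdd_below {r. (f, r) \<in> M}"
      using opposite rs(2) by (intro bdd_belowI[of _ "- s"]) blast
  qed
  have F_le: "F f \<le> r" if "f \<in> ?S" "(f, r) \<in> M" for f r
    unfolding F_def using that bdd by (intro cInf_lower) auto
  have F_ge: "z \<le> F f" if "f \<in> ?S" "\<And>r. (f, r) \<in> M \<Longrightarrow> z \<le> r" for f z
    unfolding F_def using that ne by (intro cInf_greatest) auto
  note S_neg = two_sided_domain_neg[of _ C]
  note S_add = two_sided_domain_add[OF C]
  note S_scale = two_sided_domain_scale[OF C]
  have F_subadd: "F (\<lambda>x. f x + g x) \<le> F f + F g" if f: "f \<in> ?S" and g: "g \<in> ?S" for f g
  proof -
    have "F (\<lambda>x. f x + g x) - s \<le> F f" if s: "(g, s) \<in> M" for s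
      using F_le[OF S_add[OF f g]] convex_cone_pairs_add[OF M(1) _ s]
      by (intro F_ge[OF f]) (fastforce simp: algebra_simps)
    then have "F (\<lambda>x. f x + g x) - F f \<le> F g"
      by (intro F_ge[OF g]) (fastforce simp: algebra_simps)
    then show ?thesis by simp
  qed
  have F_neg: "F (\<lambda>x. - f x) = - F f" if f: "f \<in> ?S" for f
  proof (rule antisym)
    have "- F (\<lambda>x. - f x) \<le> F f"
    proof (rule F_ge[OF f])
      fix r assume "(f, r) \<in> M"
      then have "- r \<le> F (\<lambda>x. - f x)"
        using opposite by (intro F_ge[OF S_neg[OF f]]) (simp add: minus_le_iff)
      then show "- F (\<lambda>x. - f x) \<le> r" by simp
    qed
    moreover have lower: "F (\<lambda>x. - f x) \<le> - z" if "z < F f" for z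
    proof -
      have "(f, z) \<notin> M" using F_le[OF f, of z] that by auto
      then obtain s where "(\<lambda>x. - f x, s) \<in> M" "s < - z" using dichotomy by blast
      then show ?thesis using F_le[OF S_neg[OF f]] by fastforce
    qed
    have "F f \<le> - F (\<lambda>x. - f x)"
    proof (rule dense_le)
      fix z assume "z < F f"
      from lower[OF this] show "z \<le> - F (\<lambda>x. - f x)" by linarith
    qed
    ultimately show "F (\<lambda>x. - f x) \<le> - F f" "- F f \<le> F (\<lambda>x. - f x)" by linarith+
  qed
  have F_add: "F (\<lambda>x. f x + g x) = F f + F g" if f: "f \<in> ?S" and g: "g \<in> ?S" for f g
    using F_subadd[OF f g] F_subadd[OF S_add[OF f g] S_neg[OF g]] F_neg[OF g] by simp
  have F_scale_pos: "F (\<lambda>x. a * f x) = a * F f" if f: "f \<in> ?S" and a: "0 < a" for f a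
  proof -
    have le: "F (\<lambda>x. b * g x) \<le> b * F g" if g: "g \<in> ?S" and b: "0 < b" for b g
    proof -
      have "F (\<lambda>x. b * g x) / b \<le> F g"
        using F_le[OF S_scale[OF g]] convex_cone_pairs_scale[OF M(1)] b
        by (intro F_ge[OF g]) (simp add: field_simps)
      then show ?thesis using b by (simp add: field_simps)
    qed
    have "F f \<le> inverse a * F (\<lambda>x. a * f x)"
      using le[of "\<lambda>x. a * f x" "inverse a"] S_scale[OF f, of a] a by (simp add: field_simps)
    then have "a * F f \<le> F (\<lambda>x. a * f x)" using a by (simp add: field_simps)
    with le[OF f a] show ?thesis by simp
  qed
  show thesis
  proof (rule that[of F])
    show "F (\<lambda>x. f x + g x) = F f + F g" if "f \<in> ?S" "g \<in> ?S" for f g using F_add that .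
    show "F (\<lambda>x. a * f x) = a * F f" if f: "f \<in> ?S" for f a
    proof (cases a "0 :: real" rule: linorder_cases)
      case less
      then show ?thesis
        using F_scale_pos[OF S_neg[OF f], of "- a"] F_neg[OF f] by simp
    next
      case equal
      show ?thesis using F_add[OF S_scale[OF f, of 0] S_scale[OF f, of 0]] equal by simp
    next
      case greater
      then show ?thesis using F_scale_pos[OF f] by simp
    qed
    show "F f \<le> r" if "f \<in> ?S" "(f, r) \<in> C" for f r using F_le that CM by blast
    assume f: "f0 \<in> ?S"
    have "F (\<lambda>x. - f0 x) \<le> - p0" using F_le[OF S_neg[OF f]] C' M by blast
    then show "p0 \<le> F f0" using F_neg[OF f] by simp
  qed
qed

section \<open>Representation of tight positive functionals\<close>

text \<open>The first \<open>n\<close> binary digits of \<open>code A n x\<close> tell in which of the sets \<open>A 0, \<dots>, A (n - 1)\<close> the point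
  \<open>x\<close> lies, so the level sets of \<open>code A n\<close> are the atoms of the partition generated by these sets, and
  each further digit refines the partition. If an interval is cut at the points
  \<open>D n 0 \<le> D n 1 \<le> \<dots>\<close>, then \<open>locate D n u\<close> is the number of the piece that contains \<open>u\<close>, computed by
  the same bisection.\<close>

primrec code :: "(nat \<Rightarrow> 'a set) \<Rightarrow> nat \<Rightarrow> 'a \<Rightarrow> nat" where
  "code A 0 x = 0"
| "code A (Suc n) x = 2 * code A n x + (if x \<in> A n then 1 else 0)"

primrec locate :: "(nat \<Rightarrow> nat \<Rightarrow> real) \<Rightarrow> nat \<Rightarrow> real \<Rightarrow> nat" where
  "locate D 0 u = 0"
| "locate D (Suc n) u = 2 * locate D n u + (if D (Suc n) (2 * locate D n u + 1) \<le> u then 1 else 0)"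

lemma code_less: "code A n x < 2 ^ n"
  by (induction n) auto

lemma code_Suc_div: "code A (Suc n) x div 2 = code A n x"
  by auto

lemma locate_Suc_div: "locate D (Suc n) u div 2 = locate D n u"
  by auto

lemma code_Suc_less_iff: "code A (Suc n) x < 2 * k \<longleftrightarrow> code A n x < k"
  by auto

lemma code_eq_locate_down:
  assumes "code A n x = locate D n u" "m \<le> n"
  shows "code A m x = locate D m u"
  using assms(2,1)
proof (induction rule: inc_induct)
  case (step k)
  then show ?case by (metis code_Suc_div locate_Suc_div)
qed

lemma code_eq_imp_mem_iff:
  assumes "code A n x = code A n y" "j < n"
  shows "x \<in> A j \<longleftrightarrow> y \<in> A j"
proof -
  have "code A (Suc j) x = code A (Suc j) y"
    using Suc_leI[OF assms(2)] assms(1)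
  proof (induction rule: inc_induct)
    case (step k)
    then show ?case by (metis code_Suc_div)
  qed
  then have "code A (Suc j) x mod 2 = code A (Suc j) y mod 2" by simp
  then show ?thesis by (auto split: if_splits)
qed

lemma locate_between:
  assumes "\<And>n k. D (Suc n) (2 * k) = D n k" "D 0 0 \<le> u" "u < D 0 1"
  shows "D n (locate D n u) \<le> u \<and> u < D n (Suc (locate D n u))"
proof (induction n)
  case 0
  then show ?case using assms by simp
next
  case (Suc n)
  have "D (Suc n) (Suc (Suc (2 * locate D n u))) = D n (Suc (locate D n u))"
    using assms(1)[of n "Suc (locate D n u)"] by simp
  then show ?case using Suc assms(1)[of n "locate D n u"] by simp
qed

lemma locate_measurable[measurable]: "locate D n \<in> measurable borel (count_space UNIV)"
proof (induction n)
  case 0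
  then show ?case by simp
next
  case (Suc n)
  have "(\<lambda>u. 2 * locate D n u + (if D (Suc n) (2 * locate D n u + 1) \<le> u then 1 else 0))
     \<in> measurable borel (count_space UNIV)"
    by (rule measurable_compose_countable[OF _ Suc,
         where f = "\<lambda>k u. 2 * k + (if D (Suc n) (2 * k + 1) \<le> u then 1 else 0)"]) measurable
  then show ?case by simp
qed

lemma bounded_rangeI: "(\<And>x. \<bar>f x\<bar> \<le> (B :: real)) \<Longrightarrow> bounded (range f)"
  by (auto simp: bounded_iff)

lemma bounded_indicator: "bounded (range (indicator A :: 'b \<Rightarrow> real))"
  by (rule bounded_rangeI[of _ 1]) (auto simp: indicator_def)

lemma bounded_range_add:
  "bounded (range f) \<Longrightarrow> bounded (range g) \<Longrightarrow> bounded (range (\<lambda>x. f x + g x :: real))"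
  by (rule bounded_plus_comp)

lemma bounded_range_scale: "bounded (range f) \<Longrightarrow> bounded (range (\<lambda>x. c * f x :: real))"
  using bounded_scaleR_comp[of f UNIV c] by simp

text \<open>The functional acts on all bounded functions, without measurability, so that it has a value on the
  indicator function of every set and defines a finitely additive set function.\<close>

locale positive_functional =
  fixes \<Phi> :: "('a \<Rightarrow> real) \<Rightarrow> real"
  assumes \<Phi>_add: "bounded (range f) \<Longrightarrow> bounded (range g) \<Longrightarrow> \<Phi> (\<lambda>x. f x + g x) = \<Phi> f + \<Phi> g"
    and \<Phi>_scale: "bounded (range f) \<Longrightarrow> \<Phi> (\<lambda>x. c * f x) = c * \<Phi> f"
    and \<Phi>_nonneg: "bounded (range f) \<Longrightarrow> (\<And>x. 0 \<le> f x) \<Longrightarrow> 0 \<le> \<Phi> f"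
begin

lemma \<Phi>_zero: "\<Phi> (\<lambda>x. 0) = 0"
  using \<Phi>_scale[of "\<lambda>x. 0" 0] bounded_rangeI[of "\<lambda>x. 0" 0] by simp

lemma \<Phi>_diff:
  assumes "bounded (range f)" "bounded (range g)"
  shows "\<Phi> (\<lambda>x. f x - g x) = \<Phi> f - \<Phi> g"
  using \<Phi>_add[OF assms(1) bounded_range_scale[OF assms(2), of "-1"]] \<Phi>_scale[OF assms(2), of "-1"]
  by simp

lemma \<Phi>_mono:
  assumes "bounded (range f)" "bounded (range g)" "\<And>x. f x \<le> g x"
  shows "\<Phi> f \<le> \<Phi> g"
proof -
  have "bounded (range (\<lambda>x. g x - f x))"
    using bounded_range_add[OF assms(2) bounded_range_scale[OF assms(1), of "-1"]] by simp
  from \<Phi>_nonneg[OF this] \<Phi>_diff[OF assms(2,1)] assms(3) show ?thesis by simp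
qed

lemma \<Phi>_abs_le:
  assumes f: "bounded (range f)" and g: "bounded (range g)" and le: "\<And>x. \<bar>f x\<bar> \<le> g x"
  shows "\<bar>\<Phi> f\<bar> \<le> \<Phi> g"
proof -
  have "\<Phi> (\<lambda>x. (-1) * f x) \<le> \<Phi> g"
    using le by (intro \<Phi>_mono bounded_range_scale f g) (metis abs_le_D2 mult_minus1)
  moreover have "\<Phi> f \<le> \<Phi> g"
    using le by (intro \<Phi>_mono f g) (metis abs_le_D1)
  ultimately show ?thesis using \<Phi>_scale[OF f, of "-1"] by simp
qed

lemma \<Phi>_sum:
  assumes "finite I" "\<And>i. i \<in> I \<Longrightarrow> bounded (range (f i))"
  shows "\<Phi> (\<lambda>x. \<Sum>i\<in>I. f i x) = (\<Sum>i\<in>I. \<Phi> (f i)) \<and> bounded (range (\<lambda>x. \<Sum>i\<in>I. f i x))"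
  using assms
proof (induction rule: finite_induct)
  case empty
  then show ?case using \<Phi>_zero bounded_rangeI[of "\<lambda>x. 0" 0] by simp
next
  case (insert i I)
  then show ?case using \<Phi>_add[of "f i"] bounded_range_add[of "f i"] by simp
qed

lemma \<Phi>_indicator_empty: "\<Phi> (indicator {}) = 0"
proof -
  have "(indicator {} :: 'a \<Rightarrow> real) = (\<lambda>x. 0)" by auto
  then show ?thesis using \<Phi>_zero by simp
qed

text \<open>The atoms of each partition, ordered by their codes, are laid side by side as intervals whose lengths
  are their masses; \<open>cumulative A n k\<close> is the left end point of the \<open>k\<close>-th interval of level \<open>n\<close>.\<close>

definition cumulative :: "(nat \<Rightarrow> 'a set) \<Rightarrow> nat \<Rightarrow> nat \<Rightarrow> real" where
  "cumulative A n k = \<Phi> (indicator {x. code A n x < k})"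

lemma cumulative_mono: "j \<le> k \<Longrightarrow> cumulative A n j \<le> cumulative A n k"
  unfolding cumulative_def by (intro \<Phi>_mono bounded_indicator) (auto simp: indicator_def)

lemma cumulative_0: "cumulative A n 0 = 0"
  unfolding cumulative_def by (simp add: \<Phi>_indicator_empty)

lemma cumulative_total: "2 ^ n \<le> k \<Longrightarrow> cumulative A n k = \<Phi> (\<lambda>x. 1)"
proof -
  assume "2 ^ n \<le> k"
  then have "{x. code A n x < k} = UNIV" using code_less[of A n] by (auto intro: less_le_trans)
  then show ?thesis unfolding cumulative_def by (simp add: indicator_def)
qed

lemma cumulative_refine: "cumulative A (Suc n) (2 * k) = cumulative A n k"
  unfolding cumulative_def code_Suc_less_iff ..

lemma cumulative_increment:
  "cumulative A n (Suc k) - cumulative A n k = \<Phi> (indicator {x. code A n x = k})"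
proof -
  have "(\<lambda>x. indicator {x. code A n x < Suc k} x - indicator {x. code A n x < k} x :: real)
      = indicator {x. code A n x = k}"
    by (auto simp: indicator_def)
  then show ?thesis
    unfolding cumulative_def using \<Phi>_diff[OF bounded_indicator bounded_indicator] by metis
qed

abbreviation total :: real where "total \<equiv> \<Phi> (\<lambda>x. 1)"

abbreviation loc :: "(nat \<Rightarrow> 'a set) \<Rightarrow> nat \<Rightarrow> real \<Rightarrow> nat" where
  "loc A \<equiv> locate (cumulative A)"

lemma total_nonneg: "0 \<le> total"
  by (intro \<Phi>_nonneg bounded_rangeI[of _ 1]) auto

lemma loc_between:
  assumes "u \<in> {0..<total}"
  shows "cumulative A n (loc A n u) \<le> u" "u < cumulative A n (Suc (loc A n u))"
  using locate_between[of "cumulative A" u n] assms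
  by (simp_all add: cumulative_refine cumulative_0 cumulative_total)

lemma loc_eq_iff:
  assumes "u \<in> {0..<total}"
  shows "loc A n u = k \<longleftrightarrow> u \<in> {cumulative A n k..<cumulative A n (Suc k)}"
proof
  assume u: "u \<in> {cumulative A n k..<cumulative A n (Suc k)}"
  show "loc A n u = k"
  proof (cases "loc A n u" k rule: linorder_cases)
    case less
    then have "cumulative A n (Suc (loc A n u)) \<le> cumulative A n k" by (intro cumulative_mono) simp
    then show ?thesis using loc_between(2)[OF assms, of A n] u by simp
  next
    case greater
    then have "cumulative A n (Suc k) \<le> cumulative A n (loc A n u)" by (intro cumulative_mono) simp
    then show ?thesis using loc_between(1)[OF assms, of A n] u by simp
  qed
qed (use loc_between[OF assms] in auto)

lemma loc_less:
  assumes "u \<in> {0..<total}"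
  shows "loc A n u < 2 ^ n"
proof (rule ccontr)
  assume "\<not> loc A n u < 2 ^ n"
  then have "cumulative A n (loc A n u) = total" by (intro cumulative_total) simp
  then show False using loc_between(1)[OF assms, of A n] assms by simp
qed

lemma ex_code_eq_loc:
  assumes "u \<in> {0..<total}"
  shows "\<exists>x. code A n x = loc A n u"
proof (rule ccontr)
  assume "\<not> ?thesis"
  then have "{x. code A n x = loc A n u} = {}" by auto
  then have "cumulative A n (Suc (loc A n u)) - cumulative A n (loc A n u) = 0"
    unfolding cumulative_increment by (simp add: \<Phi>_indicator_empty)
  then show False using loc_between[OF assms, of A n] by simp
qed

abbreviation unit_mass :: "real measure" where
  "unit_mass \<equiv> restrict_space lborel {0..<total}"

lemma space_unit_mass: "space unit_mass = {0..<total}"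
  by (simp add: space_restrict_space)

lemma finite_unit_mass: "finite_measure unit_mass"
  by (intro finite_measureI) (simp add: emeasure_restrict_space space_restrict_space total_nonneg)

lemma measurable_unit_mass: "f \<in> measurable borel N \<Longrightarrow> f \<in> measurable unit_mass N"
  by (intro measurable_restrict_space1) simp

text \<open>Lebesgue measure on the interval and the finitely additive mass agree on the atoms of each level,
  since the interval of an atom is as long as its mass.\<close>

lemma integral_loc:
  fixes g :: "nat \<Rightarrow> real"
  shows "integral\<^sup>L unit_mass (\<lambda>u. g (loc A n u)) = \<Phi> (\<lambda>x. g (code A n x))"
proof -
  interpret finite_measure unit_mass by (rule finite_unit_mass)
  let ?D = "cumulative A n"
  let ?I = "\<lambda>k. {?D k..<?D (Suc k)}"
  have I_sub: "?I k \<subseteq> {0..<total}" if "k < 2 ^ n" for k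
    using cumulative_mono[of 0 k A n] cumulative_mono[of "Suc k" "2 ^ n" A n] that
    by (auto simp: cumulative_0 cumulative_total)
  have "integral\<^sup>L unit_mass (\<lambda>u. g (loc A n u))
      = integral\<^sup>L unit_mass (\<lambda>u. \<Sum>k<2 ^ n. g k * indicator (?I k) u)"
  proof (rule Bochner_Integration.integral_cong[OF refl])
    fix u assume "u \<in> space unit_mass"
    then have u: "u \<in> {0..<total}" by (simp add: space_unit_mass)
    have "(\<Sum>k<2 ^ n. g k * indicator (?I k) u) = (\<Sum>k<2 ^ n. if k = loc A n u then g k else 0)"
      unfolding indicator_def loc_eq_iff[OF u, symmetric] by (intro sum.cong) auto
    also have "\<dots> = g (loc A n u)" using loc_less[OF u] by simp
    finally show "g (loc A n u) = (\<Sum>k<2 ^ n. g k * indicator (?I k) u)" by simp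
  qed
  also have "\<dots> = (\<Sum>k<2 ^ n. g k * measure unit_mass (?I k \<inter> space unit_mass))"
  proof (subst Bochner_Integration.integral_sum)
    show "integrable unit_mass (\<lambda>u. g k * indicator (?I k) u)" for k
      by (intro integrable_mult_right integrable_const_bound[where B = 1])
         (auto simp: indicator_def intro!: measurable_unit_mass borel_measurable_indicator)
  qed simp
  also have "\<dots> = (\<Sum>k<2 ^ n. g k * (?D (Suc k) - ?D k))"
  proof (intro sum.cong refl arg_cong2[of _ _ _ _ "(*)"])
    fix k :: nat assume "k \<in> {..<2 ^ n}"
    then have I: "?I k \<inter> space unit_mass = ?I k" using I_sub[of k] by (auto simp: space_unit_mass)
    show "measure unit_mass (?I k \<inter> space unit_mass) = ?D (Suc k) - ?D k"
      unfolding I using I_sub[of k] \<open>k \<in> _\<close> cumulative_mono[of k "Suc k" A n]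
      by (subst measure_restrict_space) auto
  qed
  also have "\<dots> = (\<Sum>k<2 ^ n. \<Phi> (\<lambda>x. g k * indicator {x. code A n x = k} x))"
    by (simp add: cumulative_increment \<Phi>_scale bounded_indicator)
  also have "\<dots> = \<Phi> (\<lambda>x. \<Sum>k<2 ^ n. g k * indicator {x. code A n x = k} x)"
    by (rule conjunct1[OF \<Phi>_sum[OF finite_lessThan bounded_range_scale[OF bounded_indicator]], symmetric])
  also have "(\<lambda>x. \<Sum>k<2 ^ n. g k * indicator {x. code A n x = k} x) = (\<lambda>x. g (code A n x))"
  proof
    fix x
    have "(\<Sum>k<2 ^ n. g k * indicator {x. code A n x = k} x)
        = (\<Sum>k<2 ^ n. if k = code A n x then g k else 0)"
      by (intro sum.cong) (auto simp: indicator_def)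
    then show "(\<Sum>k<2 ^ n. g k * indicator {x. code A n x = k} x) = g (code A n x)"
      using code_less[of A n x] by simp
  qed
  finally show ?thesis .
qed

end

text \<open>A Riesz representation theorem. The sets \<open>A n\<close> enumerate a countable base and the compact sets
  \<open>K m\<close>. A point \<open>u\<close> of the interval \<open>[0, \<Phi> 1)\<close> selects one atom at each level, and \<open>Z n u\<close> is a point of
  the selected atom. Within one \<open>K m\<close> the atoms shrink uniformly to points, so \<open>Z n u\<close> converges as soon
  as one of the selected atoms lies in some \<open>K m\<close>, which by tightness happens for almost every \<open>u\<close>. The
  law of the limit \<open>Y\<close> under Lebesgue measure represents \<open>\<Phi>\<close>: for a continuous \<open>g\<close>, the integral of
  \<open>g (Z n u)\<close> is the value of \<open>\<Phi>\<close> at a function that is constant on the atoms of level \<open>n\<close> and, by uniform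
  continuity on \<open>K m\<close>, close to \<open>g\<close> there.\<close>

theorem tight_positive_functional_representation:
  fixes \<Phi> :: "('a::{metric_space,second_countable_topology} \<Rightarrow> real) \<Rightarrow> real"
  assumes pos: "positive_functional \<Phi>" and ne: "\<Omega> \<noteq> {}"
    and tight: "\<And>e. 0 < e \<Longrightarrow> \<exists>K. compact K \<and> K \<subseteq> \<Omega> \<and> \<Phi> (indicator (- K)) \<le> e"
  obtains N where "finite_measure N" "sets N = sets (restrict_space borel \<Omega>)"
    "\<And>g. continuous_on \<Omega> g \<Longrightarrow> bounded (range g) \<Longrightarrow> integral\<^sup>L N g = \<Phi> g"
proof -
  interpret positive_functional \<Phi> by (rule pos)
  interpret M: finite_measure unit_mass by (rule finite_unit_mass)
  have "\<forall>m. \<exists>K. compact K \<and> K \<subseteq> \<Omega> \<and> \<Phi> (indicator (- K)) \<le> 1 / real (Suc m)"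
    using tight by simp
  then obtain K where K: "\<And>m. compact (K m)" "\<And>m. K m \<subseteq> \<Omega>"
      "\<And>m. \<Phi> (indicator (- K m)) \<le> 1 / real (Suc m)"
    by metis
  obtain \<B> :: "'a set set" where \<B>: "countable \<B>" "topological_basis \<B>"
    using ex_countable_basis by blast
  define A where "A = from_nat_into (\<B> \<union> range K)"
  have range_A: "range A = \<B> \<union> range K"
    unfolding A_def using \<B>(1) by (intro range_from_nat_into) auto
  have ex_index: "\<exists>j. A j = B" if "B \<in> \<B> \<union> range K" for B
    using that range_A by (metis imageE)
  have "\<exists>j. A j = K m" for m by (rule ex_index) blast
  then obtain \<kappa> where \<kappa>: "\<And>m. A (\<kappa> m) = K m" using choice[of "\<lambda>m j. A j = K m"] by blast
  have fine: "\<exists>n0. \<forall>n\<ge>n0. \<forall>x\<in>K m. \<forall>y. code A n x = code A n y \<longrightarrow> y \<in> K m \<and> dist x y < \<delta>"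
    if \<delta>: "0 < \<delta>" for m \<delta>
  proof -
    have "\<exists>j. x \<in> A j \<and> open (A j) \<and> A j \<subseteq> ball x (\<delta> / 2)" for x
    proof -
      have "x \<in> ball x (\<delta> / 2)" using \<delta> by simp
      then obtain B where "B \<in> \<B>" "x \<in> B" "B \<subseteq> ball x (\<delta> / 2)"
        by (rule topological_basisE[OF \<B>(2) open_ball])
      moreover have "\<exists>j. A j = B" by (rule ex_index) (simp add: \<open>B \<in> \<B>\<close>)
      ultimately show ?thesis using topological_basis_open[OF \<B>(2)] by blast
    qed
    then obtain j where j: "\<And>x. x \<in> A (j x)" "\<And>x. open (A (j x))" "\<And>x. A (j x) \<subseteq> ball x (\<delta> / 2)"
      by metis
    have "K m \<subseteq> (\<Union>x\<in>K m. A (j x))" using j(1) by blast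
    then obtain C where C: "C \<subseteq> K m" "finite C" "K m \<subseteq> (\<Union>x\<in>C. A (j x))"
      using compactE_image[OF K(1), of "K m" "\<lambda>x. A (j x)" m] j(2) by blast
    define n0 where "n0 = Suc (Max (insert (\<kappa> m) (j ` C)))"
    show ?thesis
    proof (intro exI[of _ n0] allI impI ballI)
      fix n x y assume n: "n0 \<le> n" and x: "x \<in> K m" and eq: "code A n x = code A n y"
      have less: "i < n" if "i \<in> insert (\<kappa> m) (j ` C)" for i
      proof -
        have "i \<le> Max (insert (\<kappa> m) (j ` C))" using that C(2) by (intro Max_ge) auto
        then show ?thesis using n by (simp add: n0_def)
      qed
      obtain c where c: "c \<in> C" "x \<in> A (j c)" using C(3) x by blast
      then have "y \<in> A (j c)" using code_eq_imp_mem_iff[OF eq] less by blast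
      then have "dist c x < \<delta> / 2" "dist c y < \<delta> / 2" using c j(3) by (auto simp: subset_iff)
      then have "dist x y < \<delta>" using dist_triangle3[of x y c] by linarith
      moreover have "y \<in> K m" using code_eq_imp_mem_iff[OF eq less, of "\<kappa> m"] \<kappa> x by simp
      ultimately show "y \<in> K m \<and> dist x y < \<delta>" by blast
    qed
  qed
  \<comment> \<open>Points chosen in the atoms; an interval of positive length belongs to a nonempty atom.\<close>
  define rep where "rep n k = (SOME x. code A n x = k)" for n k
  define Z where "Z n u = rep n (loc A n u)" for n u
  have code_rep: "code A n (rep n (code A n x)) = code A n x" for n x
    unfolding rep_def by (rule someI) simp
  have code_Z: "code A j (Z n u) = loc A j u" if "u \<in> {0..<total}" "j \<le> n" for j n u
  proof -
    have "code A n (Z n u) = loc A n u"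
      unfolding Z_def rep_def by (rule someI_ex) (rule ex_code_eq_loc[OF that(1)])
    from code_eq_locate_down[OF this that(2)] show ?thesis .
  qed
  have Z_measurable: "(\<lambda>u. h (Z n u)) \<in> measurable unit_mass L" if "\<And>x. h x \<in> space L"
    for h :: "'a \<Rightarrow> 'b" and n L
  proof -
    have "(\<lambda>k. h (rep n k)) \<in> measurable (count_space UNIV) L" using that by auto
    from measurable_unit_mass[OF measurable_compose[OF locate_measurable this]]
    show ?thesis unfolding Z_def .
  qed
  have integral_Z: "(LINT u|unit_mass. h (Z n u)) = \<Phi> (\<lambda>x. h (rep n (code A n x)))"
    for h :: "'a \<Rightarrow> real" and n
    using integral_loc[of "\<lambda>k. h (rep n k)" A n] unfolding Z_def .
  \<comment> \<open>As \<open>K m\<close> is the set \<open>A (\<kappa> m)\<close>, each atom of level \<open>Suc (\<kappa> m)\<close> is contained in it or disjoint from it.\<close>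
  define good where "good m = {u \<in> space unit_mass. Z (Suc (\<kappa> m)) u \<in> K m}" for m
  have good_sets: "good m \<in> sets unit_mass" for m
  proof -
    have "(\<lambda>u. Z (Suc (\<kappa> m)) u \<in> K m) \<in> measurable unit_mass (count_space UNIV)"
      by (rule Z_measurable) simp
    then show ?thesis unfolding good_def by (rule predE)
  qed
  define G where "G = (\<Union>m. good m)"
  have G_sets: "G \<in> sets unit_mass" unfolding G_def using good_sets by blast
  have bad_null: "measure unit_mass (space unit_mass - G) = 0"
  proof -
    have le: "measure unit_mass (space unit_mass - G) \<le> 1 / real (Suc m)" for m
    proof -
      have "measure unit_mass (space unit_mass - G) \<le> measure unit_mass (space unit_mass - good m)"
        by (rule M.finite_measure_mono[OF _ sets.compl_sets[OF good_sets]]) (auto simp: G_def)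
      also have "\<dots> = (LINT u|unit_mass. indicator (space unit_mass - good m) u)"
        unfolding Bochner_Integration.integral_indicator by (intro arg_cong[of _ _ "measure unit_mass"]) blast
      also have "\<dots> = (LINT u|unit_mass. indicator (- K m) (Z (Suc (\<kappa> m)) u))"
        by (intro Bochner_Integration.integral_cong) (auto simp: good_def indicator_def)
      also have "\<dots> = \<Phi> (\<lambda>x. indicator (- K m) (rep (Suc (\<kappa> m)) (code A (Suc (\<kappa> m)) x)))"
        by (rule integral_Z)
      also have "(\<lambda>x. indicator (- K m) (rep (Suc (\<kappa> m)) (code A (Suc (\<kappa> m)) x)))
          = (indicator (- K m) :: 'a \<Rightarrow> real)"
      proof
        fix x
        show "indicator (- K m) (rep (Suc (\<kappa> m)) (code A (Suc (\<kappa> m)) x)) = (indicator (- K m) x :: real)"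
          using code_eq_imp_mem_iff[OF code_rep[of "Suc (\<kappa> m)" x], of "\<kappa> m"] \<kappa>
          by (simp add: indicator_def del: code.simps)
      qed
      finally show ?thesis using K(3)[of m] by linarith
    qed
    then have "measure unit_mass (space unit_mass - G) \<le> 0"
      by (intro LIMSEQ_le_const[OF LIMSEQ_inverse_real_of_nat]) (auto simp: inverse_eq_divide)
    then show ?thesis by (simp add: measure_le_0_iff)
  qed
  have AE_good: "AE u in unit_mass. u \<in> G"
  proof (rule AE_I)
    show "{u \<in> space unit_mass. u \<notin> G} \<subseteq> space unit_mass - G" by blast
    show "emeasure unit_mass (space unit_mass - G) = 0"
      using bad_null by (simp add: M.emeasure_eq_measure)
    show "space unit_mass - G \<in> sets unit_mass" by (rule sets.compl_sets[OF G_sets])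
  qed
  have Z_converges: "\<exists>z\<in>K m. (\<lambda>n. Z n u) \<longlonglongrightarrow> z" and Z_in: "\<And>n. Suc (\<kappa> m) \<le> n \<Longrightarrow> Z n u \<in> K m"
    if "u \<in> good m" for m u
  proof -
    have u: "u \<in> {0..<total}" "Z (Suc (\<kappa> m)) u \<in> K m"
      using that by (auto simp: good_def space_unit_mass)
    show in_K: "Z n u \<in> K m" if n: "Suc (\<kappa> m) \<le> n" for n
    proof -
      have "code A (Suc (\<kappa> m)) (Z n u) = code A (Suc (\<kappa> m)) (Z (Suc (\<kappa> m)) u)"
        using code_Z[OF u(1)] n by (simp del: code.simps locate.simps)
      from code_eq_imp_mem_iff[OF this, of "\<kappa> m"] show ?thesis using u(2) \<kappa> by simp
    qed
    have "Cauchy (\<lambda>n. Z (n + Suc (\<kappa> m)) u)"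
    proof (rule metric_CauchyI)
      fix e :: real assume "0 < e"
      from fine[OF this, of m] obtain n0 where n0:
        "\<And>n x y. n0 \<le> n \<Longrightarrow> x \<in> K m \<Longrightarrow> code A n x = code A n y \<Longrightarrow> dist x y < e" by blast
      show "\<exists>L. \<forall>i\<ge>L. \<forall>j\<ge>L. dist (Z (i + Suc (\<kappa> m)) u) (Z (j + Suc (\<kappa> m)) u) < e"
      proof (intro exI[of _ n0] allI impI)
        fix i j assume "n0 \<le> i" "n0 \<le> j"
        then have "code A n0 (Z (i + Suc (\<kappa> m)) u) = code A n0 (Z (j + Suc (\<kappa> m)) u)"
          using code_Z[OF u(1)] by simp
        then show "dist (Z (i + Suc (\<kappa> m)) u) (Z (j + Suc (\<kappa> m)) u) < e"
          using in_K by (intro n0[of n0]) auto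
      qed
    qed
    moreover have "complete (K m)" by (rule compact_imp_complete[OF K(1)])
    ultimately obtain z where "z \<in> K m" "(\<lambda>n. Z (n + Suc (\<kappa> m)) u) \<longlonglongrightarrow> z"
      using in_K unfolding complete_def by (metis (no_types, lifting) le_add2)
    then show "\<exists>z\<in>K m. (\<lambda>n. Z n u) \<longlonglongrightarrow> z"
      using LIMSEQ_offset[of "\<lambda>n. Z n u" "Suc (\<kappa> m)"] by blast
  qed
  obtain z0 where z0: "z0 \<in> \<Omega>" using ne by blast
  define Y where "Y u = (if u \<in> G then lim (\<lambda>n. Z n u) else z0)" for u
  have Z_Y: "(\<lambda>n. Z n u) \<longlonglongrightarrow> Y u" "\<exists>m. Y u \<in> K m \<and> (\<forall>n\<ge>Suc (\<kappa> m). Z n u \<in> K m)" if u: "u \<in> G" for u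
  proof -
    obtain m where m: "u \<in> good m" using u unfolding G_def by blast
    obtain z where z: "z \<in> K m" "(\<lambda>n. Z n u) \<longlonglongrightarrow> z" using Z_converges[OF m] by blast
    then have "Y u = z" using u limI by (auto simp: Y_def)
    then show "(\<lambda>n. Z n u) \<longlonglongrightarrow> Y u" "\<exists>m. Y u \<in> K m \<and> (\<forall>n\<ge>Suc (\<kappa> m). Z n u \<in> K m)"
      using z Z_in[OF m] by blast+
  qed
  have "Y \<in> borel_measurable unit_mass"
  proof (rule borel_measurable_LIMSEQ_metric)
    show "(\<lambda>u. if u \<in> G then Z n u else z0) \<in> borel_measurable unit_mass" for n
      using Z_measurable[of "\<lambda>x. x" borel n] sets.Int[OF G_sets sets.top]
      by (intro measurable_If_set) simp_all
    show "(\<lambda>n. if u \<in> G then Z n u else z0) \<longlonglongrightarrow> Y u" for u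
      using Z_Y(1) by (cases "u \<in> G") (auto simp: Y_def)
  qed
  moreover have Y_in: "Y u \<in> \<Omega>" for u
    using Z_Y(2)[of u] K(2) z0 by (cases "u \<in> G") (auto simp: Y_def)
  ultimately have Y_meas: "Y \<in> measurable unit_mass (restrict_space borel \<Omega>)"
    by (intro measurable_restrict_space2) auto
  show thesis
  proof (rule that[of "distr unit_mass (restrict_space borel \<Omega>) Y"])
    show "finite_measure (distr unit_mass (restrict_space borel \<Omega>) Y)"
      by (rule M.finite_measure_distr[OF Y_meas])
    show "sets (distr unit_mass (restrict_space borel \<Omega>) Y) = sets (restrict_space borel \<Omega>)" by simp
    fix g :: "'a \<Rightarrow> real" assume g: "continuous_on \<Omega> g" and bdd: "bounded (range g)"
    then obtain B where B: "\<And>x. \<bar>g x\<bar> \<le> B" by (auto simp: bounded_iff)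
    have B0: "0 \<le> B" using B[of z0] by linarith
    have g_meas: "g \<in> borel_measurable (restrict_space borel \<Omega>)"
      by (rule borel_measurable_continuous_on_restrict[OF g])
    have "(\<lambda>n. LINT u|unit_mass. g (Z n u)) \<longlonglongrightarrow> (LINT u|unit_mass. g (Y u))"
    proof (rule integral_dominated_convergence[where w = "\<lambda>_. B"])
      show "(\<lambda>u. g (Y u)) \<in> borel_measurable unit_mass"
        by (rule measurable_compose[OF Y_meas g_meas])
      show "(\<lambda>u. g (Z n u)) \<in> borel_measurable unit_mass" for n
        by (rule Z_measurable) simp
      show "AE u in unit_mass. (\<lambda>n. g (Z n u)) \<longlonglongrightarrow> g (Y u)"
        using AE_good
      proof (rule AE_mp, intro AE_I2 impI)
        fix u assume u: "u \<in> G"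
        obtain m where m: "Y u \<in> K m" "\<And>n. Suc (\<kappa> m) \<le> n \<Longrightarrow> Z n u \<in> K m"
          using Z_Y(2)[OF u] by blast
        show "(\<lambda>n. g (Z n u)) \<longlonglongrightarrow> g (Y u)"
        proof (rule continuous_on_tendsto_compose[OF g Z_Y(1)[OF u] Y_in])
          show "\<forall>\<^sub>F n in sequentially. Z n u \<in> \<Omega>"
            using m(2) K(2) by (intro eventually_sequentiallyI[of "Suc (\<kappa> m)"]) blast
        qed
      qed
    qed (use B in auto)
    then have lim1: "(\<lambda>n. \<Phi> (\<lambda>x. g (rep n (code A n x)))) \<longlonglongrightarrow> (LINT u|unit_mass. g (Y u))"
      by (simp add: integral_Z)
    have lim2: "(\<lambda>n. \<Phi> (\<lambda>x. g (rep n (code A n x)))) \<longlonglongrightarrow> \<Phi> g"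
    proof (rule LIMSEQ_I)
      fix r :: real assume r: "0 < r"
      define e where "e = r / (total + 2 * B + 1)"
      have den: "0 < total + 2 * B + 1" using total_nonneg B0 by linarith
      have e: "0 < e" using r den by (simp add: e_def)
      obtain m where m: "1 / real (Suc m) < e"
        using e reals_Archimedean by (auto simp: inverse_eq_divide)
      have "uniformly_continuous_on (K m) g"
        using compact_uniformly_continuous[OF continuous_on_subset[OF g K(2)] K(1)] .
      then obtain \<delta> where \<delta>: "0 < \<delta>"
          "\<And>x y. x \<in> K m \<Longrightarrow> y \<in> K m \<Longrightarrow> dist y x < \<delta> \<Longrightarrow> dist (g y) (g x) < e"
        using e unfolding uniformly_continuous_on_def by metis
      obtain n0 where n0: "\<And>n x y. n0 \<le> n \<Longrightarrow> x \<in> K m \<Longrightarrow> code A n x = code A n y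
          \<Longrightarrow> y \<in> K m \<and> dist x y < \<delta>"
        using fine[OF \<delta>(1), of m] by blast
      show "\<exists>no. \<forall>n\<ge>no. norm (\<Phi> (\<lambda>x. g (rep n (code A n x))) - \<Phi> g) < r"
      proof (intro exI[of _ n0] allI impI)
        fix n assume n: "n0 \<le> n"
        let ?h = "\<lambda>x. g (rep n (code A n x))"
        have h: "bounded (range ?h)" using B by (intro bounded_rangeI) auto
        have ie: "bounded (range (\<lambda>x. e * 1))" by (rule bounded_rangeI[of _ e]) (use e in auto)
        have iB: "bounded (range (\<lambda>x. (2 * B) * indicator (- K m) x))"
          by (rule bounded_range_scale[OF bounded_indicator])
        have "\<bar>\<Phi> (\<lambda>x. ?h x - g x)\<bar> \<le> \<Phi> (\<lambda>x. e * 1 + (2 * B) * indicator (- K m) x)"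
        proof (rule \<Phi>_abs_le)
          show "bounded (range (\<lambda>x. ?h x - g x))"
            using bounded_range_add[OF h bounded_range_scale[OF bdd, of "-1"]] by simp
          show "bounded (range (\<lambda>x. e * 1 + (2 * B) * indicator (- K m) x))"
            by (rule bounded_range_add[OF ie iB])
          fix x
          show "\<bar>?h x - g x\<bar> \<le> e * 1 + (2 * B) * indicator (- K m) x"
          proof (cases "x \<in> K m")
            case True
            have "rep n (code A n x) \<in> K m \<and> dist x (rep n (code A n x)) < \<delta>"
              by (rule n0[OF n True]) (simp add: code_rep)
            then have "dist (?h x) (g x) < e" using \<delta>(2) True by (simp add: dist_commute)
            then show ?thesis using True by (simp add: dist_real_def)
          next
            case False
            then show ?thesis using B[of x] B[of "rep n (code A n x)"] e by (simp add: abs_le_iff)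
          qed
        qed
        also have "\<dots> = e * total + (2 * B) * \<Phi> (indicator (- K m))"
          using \<Phi>_add[OF ie iB] \<Phi>_scale[of "\<lambda>x. 1" e] \<Phi>_scale[OF bounded_indicator, of "2 * B"]
            bounded_rangeI[of "\<lambda>x. 1" 1] by simp
        also have "\<dots> \<le> e * total + (2 * B) * e"
          using K(3)[of m] m B0 by (intro add_left_mono mult_left_mono) auto
        also have "\<dots> < e * (total + 2 * B + 1)" using e by (simp add: algebra_simps)
        also have "\<dots> = r" using den by (simp add: e_def)
        finally show "norm (\<Phi> ?h - \<Phi> g) < r" using \<Phi>_diff[OF h bdd] by simp
      qed
    qed
    have "integral\<^sup>L (distr unit_mass (restrict_space borel \<Omega>) Y) g = (LINT u|unit_mass. g (Y u))"
      by (rule integral_distr[OF Y_meas g_meas])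
    also have "\<dots> = \<Phi> g" by (rule LIMSEQ_unique[OF lim1 lim2])
    finally show "integral\<^sup>L (distr unit_mass (restrict_space borel \<Omega>) Y) g = \<Phi> g" .
  qed
qed

section \<open>Factorization of positive semidefinite matrices\<close>

text \<open>One step of the Cholesky decomposition: subtracting the rank one matrix built from row \<open>s\<close> clears
  this row and column, and the remainder is positive semidefinite by completing the square. If the
  diagonal entry vanishes, then so does the whole row, and the matrix subtracted is \<open>0\<close> because
  \<open>x / 0 = 0\<close>.\<close>

lemma psd_factorization_on:
  fixes A :: "real^'n::finite^'n"
  assumes "finite S" and sym: "transpose A = A" and psd: "\<And>u. 0 \<le> u \<bullet> (A *v u)"
    and zero: "\<And>i j. i \<notin> S \<Longrightarrow> A $ i $ j = 0"
  shows "\<exists>Q :: real^'n^'n. Q ** transpose Q = A \<and> (\<forall>i k. k \<notin> S \<longrightarrow> Q $ i $ k = 0)"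
  using assms
proof (induction S arbitrary: A rule: finite_induct)
  case empty
  then have "A = 0" by (simp add: vec_eq_iff)
  then show ?case by (intro exI[of _ 0]) (simp add: vec_eq_iff matrix_matrix_mult_def)
next
  case (insert s S)
  have symm: "A $ i $ j = A $ j $ i" for i j
    using insert.prems(1) by (metis transpose_def vec_lambda_beta)
  have form: "u \<bullet> (A *v u) = (\<Sum>i\<in>UNIV. \<Sum>j\<in>UNIV. u $ i * A $ i $ j * u $ j)" for u :: "real^'n"
    by (simp add: inner_vec_def matrix_vector_mult_def sum_distrib_left mult.assoc)
  have form2: "(a *\<^sub>R axis s 1 + u) \<bullet> (A *v (a *\<^sub>R axis s 1 + u))
      = a\<^sup>2 * A $ s $ s + 2 * a * (A *v u) $ s + u \<bullet> (A *v u)" for a and u :: "real^'n"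
  proof -
    have 1: "u \<bullet> (A *v axis s 1) = (A *v u) $ s"
      by (simp add: inner_vec_def matrix_vector_mult_def axis_def if_distrib cong: if_cong)
         (simp add: symm mult.commute)
    have 2: "axis s 1 \<bullet> (A *v u) = (A *v u) $ s"
      by (metis cart_eq_inner_axis inner_commute)
    have 3: "(A *v axis s 1) $ s = A $ s $ s"
      by (simp add: matrix_vector_mult_def axis_def if_distrib cong: if_cong)
    have 4: "axis s 1 \<bullet> (A *v axis s 1) = A $ s $ s"
      using 3 by (metis cart_eq_inner_axis inner_commute)
    show ?thesis
      by (simp add: matrix_vector_right_distrib matrix_vector_mult_scaleR inner_add_left
          inner_add_right 1 2 4 power2_eq_square algebra_simps)
  qed
  define c where "c = A $ s $ s"
  have c0: "0 \<le> c" using insert.prems(2)[of "axis s 1"] form2[of 1 0] by (simp add: c_def)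
  define B where "B = (\<chi> i j. A $ i $ j - A $ s $ i * A $ s $ j / c)"
  have row0: "A $ s $ j = 0" if "c = 0" for j
  proof (rule ccontr)
    define b where "b = A $ s $ j"
    define t where "t = - (A $ j $ j + 1) / (2 * b)"
    assume "A $ s $ j \<noteq> 0"
    then have b: "b \<noteq> 0" by (simp add: b_def)
    have "(A *v axis j 1) $ s = b" "axis j 1 \<bullet> (A *v axis j 1) = A $ j $ j"
      unfolding b_def by (simp_all add: matrix_vector_mult_basis column_def inner_axis')
    then have "0 \<le> 2 * t * b + A $ j $ j"
      using insert.prems(2)[of "t *\<^sub>R axis s 1 + axis j 1"] form2[of t "axis j 1"] that
      by (simp add: c_def)
    also have "2 * t * b = - (A $ j $ j + 1)" using b by (simp add: t_def)
    finally show False by simp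
  qed
  have B_sym: "transpose B = B"
    by (simp add: B_def transpose_def vec_eq_iff symm mult.commute)
  have Bu: "u \<bullet> (B *v u) = u \<bullet> (A *v u) - ((A *v u) $ s)\<^sup>2 / c" for u :: "real^'n"
  proof -
    have "u \<bullet> (B *v u) = (\<Sum>i\<in>UNIV. \<Sum>j\<in>UNIV. u $ i * A $ i $ j * u $ j)
        - (\<Sum>i\<in>UNIV. \<Sum>j\<in>UNIV. (A $ s $ i * u $ i) * (A $ s $ j * u $ j) / c)"
      by (simp add: inner_vec_def matrix_vector_mult_def sum_distrib_left B_def algebra_simps
          sum_subtractf diff_divide_distrib)
    also have "(\<Sum>i\<in>UNIV. \<Sum>j\<in>UNIV. (A $ s $ i * u $ i) * (A $ s $ j * u $ j) / c)
        = ((A *v u) $ s)\<^sup>2 / c"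
      by (simp add: matrix_vector_mult_def power2_eq_square sum_product sum_divide_distrib)
    finally show ?thesis using form by simp
  qed
  have B_psd: "0 \<le> u \<bullet> (B *v u)" for u :: "real^'n"
  proof (cases "c = 0")
    case True
    then show ?thesis using Bu[of u] insert.prems(2)[of u] by simp
  next
    case False
    then have c: "c > 0" using c0 by simp
    define m where "m = (A *v u) $ s"
    \<comment> \<open>Minimising the quadratic form over the line \<open>u + \<real> e\<^sub>s\<close>.\<close>
    have "0 \<le> (- m / c)\<^sup>2 * c + 2 * (- m / c) * m + u \<bullet> (A *v u)"
      using insert.prems(2)[of "(- m / c) *\<^sub>R axis s 1 + u"] form2[of "- m / c" u]
      by (simp add: c_def m_def)
    also have "(- m / c)\<^sup>2 * c + 2 * (- m / c) * m = - (m\<^sup>2 / c)"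
      using c by (simp add: field_simps power2_eq_square)
    finally show ?thesis using Bu[of u] by (simp add: m_def)
  qed
  have B_zero: "B $ i $ j = 0" if "i \<notin> S" for i j
  proof (cases "i = s")
    case True
    then show ?thesis using row0[of j] by (cases "c = 0") (simp_all add: B_def c_def)
  next
    case False
    then have "A $ i $ j = 0" "A $ s $ i = 0"
      using insert.prems(3)[of i] that symm[of s i] by auto
    then show ?thesis by (simp add: B_def)
  qed
  obtain R :: "real^'n^'n" where R: "R ** transpose R = B" "\<And>i k. k \<notin> S \<Longrightarrow> R $ i $ k = 0"
    using insert.IH[OF B_sym B_psd B_zero] by blast
  define Q where "Q = (\<chi> i k. if k = s then A $ s $ i / sqrt c else R $ i $ k)"
  have "Q ** transpose Q = A"
  proof -
    have "(Q ** transpose Q) $ i $ j = A $ i $ j" for i j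
    proof -
      have "(Q ** transpose Q) $ i $ j = (\<Sum>k\<in>UNIV. Q $ i $ k * Q $ j $ k)"
        by (simp add: matrix_matrix_mult_def transpose_def)
      also have "\<dots> = A $ s $ i / sqrt c * (A $ s $ j / sqrt c)
          + (\<Sum>k\<in>UNIV - {s}. R $ i $ k * R $ j $ k)"
        by (subst sum.remove[of _ s]) (auto simp: Q_def intro!: sum.cong)
      also have "(\<Sum>k\<in>UNIV - {s}. R $ i $ k * R $ j $ k) = (\<Sum>k\<in>UNIV. R $ i $ k * R $ j $ k)"
        using insert.hyps(2) R(2) by (intro sum.mono_neutral_left) auto
      also have "\<dots> = B $ i $ j"
        using R(1) by (simp add: matrix_matrix_mult_def transpose_def vec_eq_iff)
      also have "A $ s $ i / sqrt c * (A $ s $ j / sqrt c) + B $ i $ j = A $ i $ j"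
        using c0 by (simp add: B_def)
      finally show ?thesis .
    qed
    then show ?thesis by (simp add: vec_eq_iff)
  qed
  moreover have "Q $ i $ k = 0" if "k \<notin> insert s S" for i k
    using that R(2) by (auto simp: Q_def)
  ultimately show ?case by blast
qed

lemma psd_factorization:
  fixes A :: "real^'n::finite^'n"
  assumes "transpose A = A" "\<And>u. 0 \<le> u \<bullet> (A *v u)"
  obtains Q :: "real^'n^'n" where "Q ** transpose Q = A"
  using psd_factorization_on[of UNIV A] assms by auto

section \<open>Taylor estimates\<close>

lemma C_b_bounded: "C_b k f \<Longrightarrow> bounded (range f)"
  by (cases k) auto

lemma C_b_bound:
  assumes "C_b k f"
  obtains B where "0 \<le> B" "\<And>x. \<bar>f x\<bar> \<le> B"
  using C_b_bounded[OF assms] unfolding bounded_iff real_norm_def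
  by (metis abs_ge_zero order_trans rangeI)

lemma C_b_differentiable: "C_b (Suc k) f \<Longrightarrow> f differentiable (at x)"
  by simp

lemma C_b_partial: "C_b (Suc k) f \<Longrightarrow> C_b k (partial_derivative i f)"
  by simp

lemma has_derivative_partials:
  fixes f :: "real^'d::finite \<Rightarrow> real"
  assumes "f differentiable (at x)"
  shows "(f has_derivative (\<lambda>h. \<Sum>i\<in>UNIV. h $ i * partial_derivative i f x)) (at x)"
proof -
  have D: "(f has_derivative frechet_derivative f (at x)) (at x)"
    using assms frechet_derivative_works by blast
  then have lin: "linear (frechet_derivative f (at x))"
    by (rule has_derivative_linear)
  have "frechet_derivative f (at x) h = (\<Sum>i\<in>UNIV. h $ i * partial_derivative i f x)" for h
  proof -
    have "h = (\<Sum>i\<in>UNIV. h $ i *\<^sub>R axis i 1)"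
      by (simp add: basis_expansion flip: scalar_mult_eq_scaleR)
    then have "frechet_derivative f (at x) h
        = frechet_derivative f (at x) (\<Sum>i\<in>UNIV. h $ i *\<^sub>R axis i 1)" by simp
    then show ?thesis
      by (simp add: linear_sum[OF lin] linear_cmul[OF lin] partial_derivative_def)
  qed
  then have "frechet_derivative f (at x) = (\<lambda>h. \<Sum>i\<in>UNIV. h $ i * partial_derivative i f x)" by blast
  with D show ?thesis by simp
qed

lemma has_real_derivative_along_line:
  fixes f :: "real^'d::finite \<Rightarrow> real"
  assumes "f differentiable (at (x + t *\<^sub>R z))"
  shows "((\<lambda>t. f (x + t *\<^sub>R z)) has_real_derivative
           (\<Sum>i\<in>UNIV. z $ i * partial_derivative i f (x + t *\<^sub>R z))) (at t)"
proof -
  have "((\<lambda>t. x + t *\<^sub>R z) has_derivative (\<lambda>h. h *\<^sub>R z)) (at t)"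
    by (auto intro!: derivative_eq_intros)
  from has_derivative_compose[OF this has_derivative_partials[OF assms]]
  show ?thesis
    unfolding has_field_derivative_def
    by (rule has_derivative_eq_rhs) (auto simp: sum_distrib_left mult_ac)
qed

lemma mean_value_along_line:
  fixes f :: "real^'d::finite \<Rightarrow> real"
  assumes "\<And>x. f differentiable (at x)"
  obtains \<theta> where "0 < \<theta>" "\<theta> < 1"
    "f (x + z) - f x = (\<Sum>i\<in>UNIV. z $ i * partial_derivative i f (x + \<theta> *\<^sub>R z))"
proof -
  have "\<exists>t::real. 0 < t \<and> t < 1 \<and> f (x + 1 *\<^sub>R z) - f (x + 0 *\<^sub>R z) =
      (1 - 0) * (\<Sum>i\<in>UNIV. z $ i * partial_derivative i f (x + t *\<^sub>R z))"
    by (rule MVT2) (auto intro: has_real_derivative_along_line assms)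
  then show thesis using that by auto
qed

lemma abs_sum_components_le:
  fixes z :: "real^'d::finite" and c :: "'d \<Rightarrow> real"
  assumes "\<And>i. \<bar>c i\<bar> \<le> B"
  shows "\<bar>\<Sum>i\<in>UNIV. z $ i * c i\<bar> \<le> real CARD('d) * B * norm z"
proof -
  have "\<bar>\<Sum>i\<in>UNIV. z $ i * c i\<bar> \<le> (\<Sum>i\<in>UNIV. \<bar>z $ i * c i\<bar>)" by (rule sum_abs)
  also have "\<dots> \<le> (\<Sum>i\<in>(UNIV :: 'd set). norm z * B)"
    unfolding abs_mult using assms component_le_norm_cart
    by (intro sum_mono mult_mono) auto
  finally show ?thesis by (simp add: mult_ac)
qed

lemma C_b_lipschitz_bound:
  fixes f :: "real^'d::finite \<Rightarrow> real"
  assumes "C_b (Suc k) f"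
  obtains L where "0 \<le> L" "\<And>x y. \<bar>f x - f y\<bar> \<le> L * norm (x - y)"
proof -
  have "\<forall>i. \<exists>B\<ge>0. \<forall>x. \<bar>partial_derivative i f x\<bar> \<le> B"
    using C_b_partial[OF assms] C_b_bound by metis
  then obtain B where B: "\<And>i. 0 \<le> B i" "\<And>i x. \<bar>partial_derivative i f x\<bar> \<le> B i" by metis
  define M where "M = (\<Sum>i\<in>UNIV. B i)"
  have M: "\<bar>partial_derivative i f x\<bar> \<le> M" for i x
    using B(2)[of i x] member_le_sum[of i UNIV B] B(1) by (simp add: M_def)
  have "0 \<le> M" using B(1) by (simp add: M_def sum_nonneg)
  show thesis
  proof (rule that[of "CARD('d) * M"])
    show "0 \<le> CARD('d) * M" using \<open>0 \<le> M\<close> by simp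
    fix x y
    obtain t where
      "f (y + (x - y)) - f y = (\<Sum>i\<in>UNIV. (x - y) $ i * partial_derivative i f (y + t *\<^sub>R (x - y)))"
      using mean_value_along_line[of f y "x - y"] C_b_differentiable[OF assms] by metis
    then show "\<bar>f x - f y\<bar> \<le> CARD('d) * M * norm (x - y)"
      using abs_sum_components_le[OF M, of "x - y"] by simp
  qed
qed

lemma C_b_imp_C_Lip:
  fixes f :: "real^'d::finite \<Rightarrow> real"
  assumes "C_b (Suc k) f"
  shows "C_Lip f"
proof -
  obtain L where "0 \<le> L" "\<And>x y. \<bar>f x - f y\<bar> \<le> L * norm (x - y)"
    using C_b_lipschitz_bound[OF assms] by blast
  then have "L-lipschitz_on UNIV f"
    by (intro lipschitz_onI) (auto simp: dist_norm)
  then show ?thesis unfolding C_Lip_def by blast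
qed

lemma C_b_uniform_lipschitz_partials:
  fixes f :: "real^'d::finite \<Rightarrow> real"
  assumes "C_b (Suc (Suc k)) f"
  obtains L where "0 \<le> L"
    "\<And>i x y. \<bar>partial_derivative i f x - partial_derivative i f y\<bar> \<le> L * norm (x - y)"
proof -
  have "\<forall>i. \<exists>L\<ge>0. \<forall>x y. \<bar>partial_derivative i f x - partial_derivative i f y\<bar> \<le> L * norm (x - y)"
    using C_b_lipschitz_bound[OF C_b_partial[OF assms]] by metis
  then obtain B where B: "\<And>i. 0 \<le> B i"
    "\<And>i x y. \<bar>partial_derivative i f x - partial_derivative i f y\<bar> \<le> B i * norm (x - y)" by metis
  show thesis
  proof (rule that[of "\<Sum>i\<in>UNIV. B i"])
    show "0 \<le> (\<Sum>i\<in>UNIV. B i)" using B(1) by (simp add: sum_nonneg)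
    fix i and x y :: "real^'d"
    have "B i * norm (x - y) \<le> (\<Sum>i\<in>UNIV. B i) * norm (x - y)"
      using member_le_sum[of i UNIV B] B(1) by (intro mult_right_mono) auto
    then show "\<bar>partial_derivative i f x - partial_derivative i f y\<bar>
        \<le> (\<Sum>i\<in>UNIV. B i) * norm (x - y)"
      using B(2)[of i x y] by linarith
  qed
qed

text \<open>The mean value theorem along the segment from \<open>y\<close> to \<open>x\<close> turns the outer difference into a factor
  \<open>norm (x - y)\<close>, and the Lipschitz bound for the partial derivatives turns the inner one into
  \<open>norm w\<close>.\<close>

lemma C_b_second_difference:
  fixes f :: "real^'d::finite \<Rightarrow> real"
  assumes f: "C_b (Suc (Suc k)) f"
  obtains L where "0 \<le> L"
    "\<And>x y w. \<bar>(f (x + w) - f x) - (f (y + w) - f y)\<bar> \<le> L * norm (x - y) * norm w"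
proof -
  obtain L where L: "0 \<le> L"
    "\<And>i x y. \<bar>partial_derivative i f x - partial_derivative i f y\<bar> \<le> L * norm (x - y)"
    using C_b_uniform_lipschitz_partials[OF f] by metis
  show thesis
  proof (rule that[of "CARD('d) * L"])
    show "0 \<le> CARD('d) * L" using L(1) by simp
    fix x y w
    let ?h = "\<lambda>x. f (x + w) - f x"
    let ?\<phi> = "\<lambda>t. f (y + w + t *\<^sub>R (x - y)) - f (y + t *\<^sub>R (x - y))"
    let ?\<phi>' = "\<lambda>t. (\<Sum>i\<in>UNIV. (x - y) $ i * (partial_derivative i f (y + w + t *\<^sub>R (x - y))
      - partial_derivative i f (y + t *\<^sub>R (x - y))))"
    have "(?\<phi> has_real_derivative ?\<phi>' t) (at t)" for t
      unfolding right_diff_distrib sum_subtractf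
      by (intro DERIV_diff has_real_derivative_along_line C_b_differentiable[OF f])
    then have "\<exists>t::real. 0 < t \<and> t < 1 \<and> ?\<phi> 1 - ?\<phi> 0 = (1 - 0) * ?\<phi>' t"
      by (intro MVT2) auto
    then obtain t where t: "?\<phi> 1 - ?\<phi> 0 = ?\<phi>' t" by auto
    have "\<bar>?\<phi>' t\<bar> \<le> CARD('d) * (L * norm w) * norm (x - y)"
    proof (rule abs_sum_components_le)
      fix i
      show "\<bar>partial_derivative i f (y + w + t *\<^sub>R (x - y)) - partial_derivative i f (y + t *\<^sub>R (x - y))\<bar>
        \<le> L * norm w"
        using L(2)[of i "y + w + t *\<^sub>R (x - y)" "y + t *\<^sub>R (x - y)"] by simp
    qed
    moreover have "?\<phi> 1 - ?\<phi> 0 = (f (x + w) - f x) - (f (y + w) - f y)"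
      by (simp add: algebra_simps)
    ultimately show "\<bar>(f (x + w) - f x) - (f (y + w) - f y)\<bar> \<le> CARD('d) * L * norm (x - y) * norm w"
      using t by (simp add: mult_ac)
  qed
qed

lemma grad_inner: "grad f x \<bullet> z = (\<Sum>i\<in>UNIV. z $ i * partial_derivative i f x)"
  by (simp add: grad_def inner_vec_def mult.commute)

lemma C_b_first_order_remainder:
  fixes f :: "real^'d::finite \<Rightarrow> real"
  assumes f: "C_b (Suc (Suc k)) f"
  obtains L where "0 \<le> L" "\<And>x z. \<bar>f (x + z) - f x - grad f x \<bullet> z\<bar> \<le> L * (norm z)\<^sup>2"
proof -
  obtain L where L: "0 \<le> L"
    "\<And>i x y. \<bar>partial_derivative i f x - partial_derivative i f y\<bar> \<le> L * norm (x - y)"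
    using C_b_uniform_lipschitz_partials[OF f] by metis
  show thesis
  proof (rule that[of "CARD('d) * L"])
    show "0 \<le> CARD('d) * L" using L(1) by simp
    fix x z
    obtain t where t: "0 < t" "t < 1"
      "f (x + z) - f x = (\<Sum>i\<in>UNIV. z $ i * partial_derivative i f (x + t *\<^sub>R z))"
      using mean_value_along_line[of f x z] C_b_differentiable[OF f] by metis
    have "\<bar>\<Sum>i\<in>UNIV. z $ i * (partial_derivative i f (x + t *\<^sub>R z) - partial_derivative i f x)\<bar>
        \<le> CARD('d) * (L * norm z) * norm z"
    proof (rule abs_sum_components_le)
      fix i
      have "L * norm (t *\<^sub>R z) \<le> L * norm z"
        using t L(1) by (intro mult_left_mono) (auto simp: mult_left_le_one_le)
      then show "\<bar>partial_derivative i f (x + t *\<^sub>R z) - partial_derivative i f x\<bar> \<le> L * norm z"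
        using L(2)[of i "x + t *\<^sub>R z" x] by simp
    qed
    then show "\<bar>f (x + z) - f x - grad f x \<bullet> z\<bar> \<le> CARD('d) * L * (norm z)\<^sup>2"
      using t(3) by (simp add: grad_inner right_diff_distrib sum_subtractf power2_eq_square mult_ac)
  qed
qed

text \<open>The first order Taylor remainder at \<open>x\<close> is Lipschitz in \<open>x\<close>. This uses the third derivatives and is
  what makes the difference quotients of the semigroup uniformly Lipschitz in the starting point.\<close>

lemma C_b_remainder_difference:
  fixes f :: "real^'d::finite \<Rightarrow> real"
  assumes f: "C_b (Suc (Suc (Suc k))) f"
  obtains L where "0 \<le> L"
    "\<And>x y z. \<bar>(f (x + z) - f x) - (f (y + z) - f y) - (grad f x - grad f y) \<bullet> z\<bar>
       \<le> L * norm (x - y) * (norm z)\<^sup>2"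
proof -
  have "\<forall>i. \<exists>B\<ge>0. \<forall>x y w. \<bar>(partial_derivative i f (x + w) - partial_derivative i f x)
      - (partial_derivative i f (y + w) - partial_derivative i f y)\<bar> \<le> B * norm (x - y) * norm w"
    using C_b_second_difference[OF C_b_partial[OF f]] by metis
  then obtain B where B: "\<And>i. 0 \<le> B i"
    "\<And>i x y w. \<bar>(partial_derivative i f (x + w) - partial_derivative i f x)
      - (partial_derivative i f (y + w) - partial_derivative i f y)\<bar> \<le> B i * norm (x - y) * norm w"
    by metis
  define L where "L = (\<Sum>i\<in>UNIV. B i)"
  have L0: "0 \<le> L" and BL: "B i \<le> L" for i
    using B(1) member_le_sum[of i UNIV B] by (auto simp: L_def sum_nonneg)
  show thesis
  proof (rule that[of "CARD('d) * L"])
    show "0 \<le> CARD('d) * L" using L0 by simp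
    fix x y z
    let ?\<phi> = "\<lambda>t. f (x + t *\<^sub>R z) - f (y + t *\<^sub>R z)"
    let ?\<phi>' = "\<lambda>t. (\<Sum>i\<in>UNIV. z $ i * (partial_derivative i f (x + t *\<^sub>R z)
      - partial_derivative i f (y + t *\<^sub>R z)))"
    have "(?\<phi> has_real_derivative ?\<phi>' t) (at t)" for t
      unfolding right_diff_distrib sum_subtractf
      by (intro DERIV_diff has_real_derivative_along_line C_b_differentiable[OF f])
    then have "\<exists>t::real. 0 < t \<and> t < 1 \<and> ?\<phi> 1 - ?\<phi> 0 = (1 - 0) * ?\<phi>' t"
      by (intro MVT2) auto
    then obtain t where t: "0 < t" "t < 1" "?\<phi> 1 - ?\<phi> 0 = ?\<phi>' t" by auto
    have "\<bar>\<Sum>i\<in>UNIV. z $ i * ((partial_derivative i f (x + t *\<^sub>R z) - partial_derivative i f x)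
        - (partial_derivative i f (y + t *\<^sub>R z) - partial_derivative i f y))\<bar>
        \<le> CARD('d) * (L * norm (x - y) * norm z) * norm z"
    proof (rule abs_sum_components_le)
      fix i
      have "B i * norm (x - y) * norm (t *\<^sub>R z) \<le> L * norm (x - y) * norm z"
        using t L0 BL by (intro mult_mono) (auto simp: mult_left_le_one_le)
      then show "\<bar>(partial_derivative i f (x + t *\<^sub>R z) - partial_derivative i f x)
        - (partial_derivative i f (y + t *\<^sub>R z) - partial_derivative i f y)\<bar>
        \<le> L * norm (x - y) * norm z"
        using B(2)[where i=i and x=x and y=y and w="t *\<^sub>R z"] by linarith
    qed
    moreover have "(\<Sum>i\<in>UNIV. z $ i * ((partial_derivative i f (x + t *\<^sub>R z) - partial_derivative i f x)
        - (partial_derivative i f (y + t *\<^sub>R z) - partial_derivative i f y)))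
        = ?\<phi>' t - (grad f x - grad f y) \<bullet> z"
      by (simp add: grad_inner inner_diff_left right_diff_distrib sum_subtractf)
    ultimately show "\<bar>(f (x + z) - f x) - (f (y + z) - f y) - (grad f x - grad f y) \<bullet> z\<bar>
        \<le> CARD('d) * L * norm (x - y) * (norm z)\<^sup>2"
      using t(3) by (simp add: power2_eq_square mult_ac)
  qed
qed

lemma C_b_grad_lipschitz:
  fixes f :: "real^'d::finite \<Rightarrow> real"
  assumes f: "C_b (Suc (Suc k)) f"
  obtains L where "0 \<le> L" "\<And>x y. norm (grad f x - grad f y) \<le> L * norm (x - y)"
proof -
  obtain L where L: "0 \<le> L"
    "\<And>i x y. \<bar>partial_derivative i f x - partial_derivative i f y\<bar> \<le> L * norm (x - y)"
    using C_b_uniform_lipschitz_partials[OF f] by metis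
  show thesis
  proof (rule that[of "CARD('d) * L"])
    show "0 \<le> CARD('d) * L" using L(1) by simp
    fix x y
    have "norm (grad f x - grad f y) \<le> (\<Sum>i\<in>UNIV. \<bar>(grad f x - grad f y) $ i\<bar>)"
      by (rule norm_le_l1_cart)
    also have "\<dots> \<le> (\<Sum>i\<in>(UNIV :: 'd set). L * norm (x - y))"
      using L(2) by (intro sum_mono) (simp add: grad_def)
    finally show "norm (grad f x - grad f y) \<le> CARD('d) * L * norm (x - y)" by (simp add: mult_ac)
  qed
qed

lemma C_b_taylor_third_order:
  fixes f :: "real^'d::finite \<Rightarrow> real"
  assumes f: "C_b 3 f"
  obtains L where "0 \<le> L"
    "\<And>z. \<bar>f z - f 0 - grad f 0 \<bullet> z - (1/2) * (\<Sum>i\<in>UNIV. \<Sum>j\<in>UNIV. hessian f 0 $ i $ j * (z $ i * z $ j))\<bar>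
       \<le> L * norm z ^ 3"
proof -
  let ?D = partial_derivative
  have f3: "C_b (Suc (Suc (Suc 0))) f" using f by (simp add: numeral_3_eq_3)
  have f2: "C_b (Suc (Suc 0)) (?D i f)" for i using C_b_partial[OF f3] .
  have f1: "C_b (Suc 0) (?D j (?D i f))" for i j using C_b_partial[OF f2] .
  have "\<forall>i j k. \<exists>B\<ge>0. \<forall>x. \<bar>?D k (?D j (?D i f)) x\<bar> \<le> B"
    using C_b_partial[OF f1] C_b_bound by metis
  then obtain B where B: "\<And>i j k. 0 \<le> B i j k" "\<And>i j k x. \<bar>?D k (?D j (?D i f)) x\<bar> \<le> B i j k"
    by metis
  define M where "M = (\<Sum>i\<in>UNIV. \<Sum>j\<in>UNIV. \<Sum>k\<in>UNIV. B i j k)"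
  have M0: "0 \<le> M" using B(1) by (simp add: M_def sum_nonneg)
  have M: "\<bar>?D k (?D j (?D i f)) x\<bar> \<le> M" for i j k x
  proof -
    have "B i j k \<le> (\<Sum>k\<in>UNIV. B i j k)" using B(1) by (intro member_le_sum) auto
    also have "\<dots> \<le> (\<Sum>j\<in>UNIV. \<Sum>k\<in>UNIV. B i j k)"
      using B(1) by (intro member_le_sum[of j UNIV "\<lambda>j. \<Sum>k\<in>UNIV. B i j k"]) (auto simp: sum_nonneg)
    also have "\<dots> \<le> M"
      unfolding M_def using B(1)
      by (intro member_le_sum[of i UNIV "\<lambda>i. \<Sum>j\<in>UNIV. \<Sum>k\<in>UNIV. B i j k"]) (auto simp: sum_nonneg)
    finally show ?thesis using B(2)[of k j i x] by linarith
  qed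
  let ?n = "real CARD('d)"
  show thesis
  proof (rule that[of "?n * (?n * (?n * M))"])
    show "0 \<le> ?n * (?n * (?n * M))" using M0 by simp
    fix z :: "real^'d"
    let ?\<phi> = "\<lambda>t. f (t *\<^sub>R z)"
    let ?\<phi>1 = "\<lambda>t. \<Sum>i\<in>UNIV. z $ i * ?D i f (t *\<^sub>R z)"
    let ?\<phi>2 = "\<lambda>t. \<Sum>i\<in>UNIV. z $ i * (\<Sum>j\<in>UNIV. z $ j * ?D j (?D i f) (t *\<^sub>R z))"
    let ?\<phi>3 = "\<lambda>t. \<Sum>i\<in>UNIV. z $ i * (\<Sum>j\<in>UNIV. z $ j * (\<Sum>k\<in>UNIV. z $ k * ?D k (?D j (?D i f)) (t *\<^sub>R z)))"
    have line: "((\<lambda>t. g (t *\<^sub>R z)) has_real_derivative (\<Sum>i\<in>UNIV. z $ i * ?D i g (t *\<^sub>R z))) (at t)"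
      if "C_b (Suc k) g" for g t k
      using has_real_derivative_along_line[of g 0 t z] C_b_differentiable[OF that] by simp
    have d1: "(?\<phi> has_real_derivative ?\<phi>1 t) (at t)" for t by (rule line[OF f3])
    have d2: "(?\<phi>1 has_real_derivative ?\<phi>2 t) (at t)" for t
      by (intro DERIV_sum DERIV_cmult line[OF f2])
    have d3: "(?\<phi>2 has_real_derivative ?\<phi>3 t) (at t)" for t
      by (intro DERIV_sum DERIV_cmult line[OF f1])
    define diff where "diff m = (if m = 0 then ?\<phi> else if m = 1 then ?\<phi>1 else if m = 2 then ?\<phi>2 else ?\<phi>3)"
      for m :: nat
    have "\<exists>t::real. 0 < t \<and> t < 1 \<and>
      ?\<phi> 1 = (\<Sum>m<3. (diff m 0 / fact m) * 1 ^ m) + (diff 3 t / fact 3) * 1 ^ 3"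
    proof (rule Maclaurin)
      show "\<forall>m t. m < 3 \<and> 0 \<le> t \<and> t \<le> 1 \<longrightarrow> (diff m has_real_derivative diff (Suc m) t) (at t)"
      proof (intro allI impI)
        fix m :: nat and t :: real assume "m < 3 \<and> 0 \<le> t \<and> t \<le> 1"
        then consider "m = 0" | "m = 1" | "m = 2" by linarith
        then show "(diff m has_real_derivative diff (Suc m) t) (at t)"
          by cases (use d1 d2 d3 in \<open>simp_all add: diff_def\<close>)
      qed
    qed (auto simp: diff_def)
    then obtain t where "?\<phi> 1 = (\<Sum>m<3. (diff m 0 / fact m) * 1 ^ m) + (diff 3 t / fact 3) * 1 ^ 3"
      by blast
    then have eq: "?\<phi> 1 = ?\<phi> 0 + ?\<phi>1 0 + ?\<phi>2 0 / 2 + ?\<phi>3 t / 6"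
      by (simp add: diff_def eval_nat_numeral)
    have hess: "?\<phi>2 0 = (\<Sum>i\<in>UNIV. \<Sum>j\<in>UNIV. hessian f 0 $ i $ j * (z $ i * z $ j))"
      by (subst sum.swap) (simp add: hessian_def sum_distrib_left mult_ac)
    have "\<bar>?\<phi>3 t\<bar> \<le> ?n * (?n * (?n * M * norm z) * norm z) * norm z"
      by (intro abs_sum_components_le M)
    then have "\<bar>?\<phi>3 t\<bar> / 6 \<le> ?n * (?n * (?n * M)) * norm z ^ 3"
      by (simp add: power3_eq_cube mult_ac)
    moreover have "f z - f 0 - grad f 0 \<bullet> z
        - (1/2) * (\<Sum>i\<in>UNIV. \<Sum>j\<in>UNIV. hessian f 0 $ i $ j * (z $ i * z $ j)) = ?\<phi>3 t / 6"
      unfolding hess[symmetric] grad_inner using eq by simp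
    ultimately show "\<bar>f z - f 0 - grad f 0 \<bullet> z
        - (1/2) * (\<Sum>i\<in>UNIV. \<Sum>j\<in>UNIV. hessian f 0 $ i $ j * (z $ i * z $ j))\<bar>
       \<le> ?n * (?n * (?n * M)) * norm z ^ 3" by simp
  qed
qed

section \<open>Lipschitz functions\<close>

lemma C_LipI:
  fixes f :: "'a::real_normed_vector \<Rightarrow> real"
  assumes "\<And>x y. \<bar>f x - f y\<bar> \<le> L * norm (x - y)"
  shows "C_Lip f"
proof -
  have "(max L 0)-lipschitz_on UNIV f"
  proof (rule lipschitz_onI)
    fix x y :: 'a
    have "L * norm (x - y) \<le> max L 0 * norm (x - y)" by (intro mult_right_mono) auto
    then show "dist (f x) (f y) \<le> max L 0 * dist x y"
      using assms[of x y] by (simp add: dist_norm)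
  qed simp
  then show ?thesis unfolding C_Lip_def by blast
qed

lemma C_LipD:
  fixes f :: "'a::real_normed_vector \<Rightarrow> real"
  assumes "C_Lip f"
  shows "\<exists>L\<ge>0. \<forall>x y. \<bar>f x - f y\<bar> \<le> L * norm (x - y)"
proof -
  obtain L where L: "L-lipschitz_on UNIV f" using assms unfolding C_Lip_def by blast
  have "\<bar>f x - f y\<bar> \<le> L * norm (x - y)" for x y
    using lipschitz_onD[OF L, of x y] by (simp add: dist_norm)
  with lipschitz_on_nonneg[OF L] show ?thesis by blast
qed

lemma C_Lip_const: "C_Lip (\<lambda>x. c)"
  by (rule C_LipI[of _ 0]) simp

lemma C_Lip_norm: "C_Lip norm"
  by (rule C_LipI[of _ 1]) (simp add: norm_triangle_ineq3)

lemma C_Lip_inner: "C_Lip (\<lambda>y. p \<bullet> y)"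
  by (rule C_LipI[of _ "norm p"]) (simp add: Cauchy_Schwarz_ineq2 flip: inner_diff_right)

lemma C_Lip_add:
  fixes f g :: "'a::real_normed_vector \<Rightarrow> real"
  assumes "C_Lip f" "C_Lip g"
  shows "C_Lip (\<lambda>x. f x + g x)"
proof -
  obtain L where "0 \<le> L" and L: "\<And>x y. \<bar>f x - f y\<bar> \<le> L * norm (x - y)" using C_LipD[OF assms(1)] by blast
  obtain M where "0 \<le> M" and M: "\<And>x y. \<bar>g x - g y\<bar> \<le> M * norm (x - y)" using C_LipD[OF assms(2)] by blast
  show ?thesis
  proof (rule C_LipI[of _ "L + M"])
    show "\<bar>(f x + g x) - (f y + g y)\<bar> \<le> (L + M) * norm (x - y)" for x y
      unfolding distrib_right using L[of x y] M[of x y] by linarith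
  qed
qed

lemma C_Lip_scale:
  fixes f :: "'a::real_normed_vector \<Rightarrow> real"
  assumes "C_Lip f"
  shows "C_Lip (\<lambda>x. c * f x)"
proof -
  obtain L where "0 \<le> L" and L: "\<And>x y. \<bar>f x - f y\<bar> \<le> L * norm (x - y)" using C_LipD[OF assms(1)] by blast
  show ?thesis
  proof (rule C_LipI[of _ "\<bar>c\<bar> * L"])
    fix x y :: 'a
    have "\<bar>c * f x - c * f y\<bar> = \<bar>c\<bar> * \<bar>f x - f y\<bar>" by (simp flip: abs_mult right_diff_distrib)
    also have "\<dots> \<le> \<bar>c\<bar> * (L * norm (x - y))" by (intro mult_left_mono L) simp
    finally show "\<bar>c * f x - c * f y\<bar> \<le> \<bar>c\<bar> * L * norm (x - y)" by (simp add: mult.assoc)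
  qed
qed

lemma C_Lip_neg: "C_Lip f \<Longrightarrow> C_Lip (\<lambda>x. - f x)"
  by (drule C_Lip_scale[of f "-1"]) simp

lemma C_Lip_diff:
  assumes "C_Lip f" "C_Lip g"
  shows "C_Lip (\<lambda>x. f x - g x)"
  using C_Lip_add[OF assms(1) C_Lip_neg[OF assms(2)]] by simp

lemma C_Lip_shift:
  fixes f :: "'a::real_normed_vector \<Rightarrow> real"
  assumes "C_Lip f"
  shows "C_Lip (\<lambda>y. f (x + y))"
proof -
  obtain L where "0 \<le> L" and L: "\<And>x y. \<bar>f x - f y\<bar> \<le> L * norm (x - y)" using C_LipD[OF assms(1)] by blast
  show ?thesis
  proof (rule C_LipI[of _ L])
    show "\<bar>f (x + y) - f (x + z)\<bar> \<le> L * norm (y - z)" for y z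
      using L[of "x + y" "x + z"] by simp
  qed
qed

lemmas C_Lip_intros = C_Lip_const C_Lip_norm C_Lip_inner C_Lip_add C_Lip_scale C_Lip_neg C_Lip_diff

section \<open>Huber's function\<close>

text \<open>The square of the norm is not Lipschitz, hence not admissible as a test function. Huber's function
  replaces it: it equals the square in the unit ball, continues linearly outside, and is convex.
  \<open>huber_excess\<close> bounds from below by how much \<open>huber\<close> exceeds its tangent at any point of the ball of
  radius \<open>1/2\<close>, see \<open>huber_convexity\<close>.\<close>

definition huber :: "'a::euclidean_space \<Rightarrow> real" where
  "huber x = 2 * min 1 (norm x) * norm x - (min 1 (norm x))\<^sup>2"

definition huber_excess :: "'a::euclidean_space \<Rightarrow> real" where
  "huber_excess y = huber (2 *\<^sub>R y) / 4"

lemma huber_small: "norm x \<le> 1 \<Longrightarrow> huber x = (norm x)\<^sup>2"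
  by (simp add: huber_def power2_eq_square min_def)

lemma huber_large: "1 \<le> norm x \<Longrightarrow> huber x = 2 * norm x - 1"
  by (simp add: huber_def min_def)

lemma huber_nonneg: "0 \<le> huber x"
  by (cases "norm x \<le> 1") (auto simp: huber_small huber_large)

lemma huber_le: "huber x \<le> 2 * norm x"
proof (cases "norm x \<le> 1")
  case True
  then have "norm x * norm x \<le> 1 * norm x" by (intro mult_right_mono) auto
  then show ?thesis using True norm_ge_zero[of x] unfolding huber_small[OF True] power2_eq_square by linarith
qed (simp add: huber_large)

lemma huber_lipschitz: "\<bar>huber x - huber y\<bar> \<le> 2 * norm (x - y)"
proof -
  have le: "huber x - huber y \<le> 2 * (norm x - norm y)" if "norm y \<le> norm x" for x y :: 'a
  proof (cases "norm x \<le> 1")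
    case True
    have "(norm x + norm y) * (norm x - norm y) \<le> 2 * (norm x - norm y)"
      using that True by (intro mult_right_mono) auto
    then show ?thesis using that True by (simp add: huber_small power2_eq_square algebra_simps)
  next
    case False
    show ?thesis
    proof (cases "norm y \<le> 1")
      case True
      have "0 \<le> (1 - norm y) * (1 - norm y)" by simp
      then show ?thesis using True False by (simp add: huber_small huber_large power2_eq_square algebra_simps)
    qed (use False in \<open>simp add: huber_large\<close>)
  qed
  have mono: "huber y \<le> huber x" if "norm y \<le> norm x" for x y :: 'a
  proof (cases "norm x \<le> 1")
    case True
    then show ?thesis using that by (simp add: huber_small power_mono)
  next
    case False
    then show ?thesis using that power_mono[of "norm y" 1 2]
      by (cases "norm y \<le> 1") (auto simp: huber_small huber_large)
  qed
  have "\<bar>huber x - huber y\<bar> \<le> 2 * \<bar>norm x - norm y\<bar>"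
    using le[of x y] le[of y x] mono[of x y] mono[of y x]
    by (cases "norm x \<le> norm y") (auto simp: abs_if)
  also have "\<dots> \<le> 2 * norm (x - y)" using norm_triangle_ineq3[of x y] by simp
  finally show ?thesis .
qed

lemma C_Lip_huber: "C_Lip huber"
  by (rule C_LipI[OF huber_lipschitz])

lemma C_Lip_huber_excess: "C_Lip huber_excess"
proof (rule C_LipI[of _ 1])
  show "\<bar>huber_excess x - huber_excess y\<bar> \<le> 1 * norm (x - y)" for x y :: 'a
    using huber_lipschitz[of "2 *\<^sub>R x" "2 *\<^sub>R y"]
    by (simp add: huber_excess_def abs_le_iff flip: scaleR_diff_right)
qed

lemma huber_excess_small: "norm y \<le> 1/2 \<Longrightarrow> huber_excess y = (norm y)\<^sup>2"
  by (simp add: huber_excess_def huber_small power_mult_distrib)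

lemma huber_excess_large: "1/2 \<le> norm y \<Longrightarrow> huber_excess y = norm y - 1/4"
  by (simp add: huber_excess_def huber_large)

lemma huber_excess_nonneg: "0 \<le> huber_excess y"
  by (simp add: huber_excess_def huber_nonneg)

lemma huber_excess_le_huber: "huber_excess y \<le> huber y"
proof (cases "norm y \<le> 1/2")
  case True
  then show ?thesis by (simp add: huber_excess_small huber_small)
next
  case False
  have "0 \<le> (norm y - 1/2)\<^sup>2" by simp
  then show ?thesis
    using False by (cases "norm y \<le> 1")
      (auto simp: huber_excess_large huber_small huber_large power2_eq_square algebra_simps)
qed

lemma le_huber_excess:
  assumes "v \<le> M * (norm y)\<^sup>2" "v \<le> 2 * M * norm y" "0 \<le> M"
  shows "v \<le> 4 * M * huber_excess y"
proof (cases "norm y \<le> 1/2")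
  case True
  have "0 \<le> M * (norm y)\<^sup>2" using assms(3) by simp
  then show ?thesis using assms(1) by (simp add: huber_excess_small[OF True])
next
  case False
  then have "M * (1/2) \<le> M * norm y" using assms(3) by (intro mult_left_mono) auto
  then show ?thesis using assms(2) False by (simp add: huber_excess_large algebra_simps)
qed

text \<open>Huber's function is the supremum of these affine functions.\<close>

lemma huber_ge_affine:
  assumes "norm a \<le> 1"
  shows "2 * (a \<bullet> z) - (norm a)\<^sup>2 \<le> huber z"
proof -
  have "a \<bullet> z \<le> norm a * norm z" by (rule norm_cauchy_schwarz)
  moreover have "2 * (norm a * norm z) - (norm a)\<^sup>2 \<le> huber z"
  proof (cases "norm z \<le> 1")
    case True
    have "0 \<le> (norm a - norm z)\<^sup>2" by simp
    then show ?thesis by (simp add: huber_small[OF True] power2_diff)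
  next
    case False
    have "0 \<le> (1 - norm a) * (2 * norm z - 1 - norm a)" using assms False by (intro mult_nonneg_nonneg) auto
    then show ?thesis using False by (simp add: huber_large power2_eq_square algebra_simps)
  qed
  ultimately show ?thesis by linarith
qed

text \<open>For \<open>norm x \<le> 1/2\<close> there is room to move the slope \<open>a = x\<close> by any vector \<open>b\<close> of norm at most \<open>1/2\<close>, and
  the best \<open>b\<close> gains \<open>huber_excess y\<close>. For larger \<open>x\<close> the factor \<open>1 - 2 * norm x\<close> is negative and the
  tangent inequality suffices.\<close>

lemma huber_convexity:
  fixes x :: "'a::euclidean_space"
  obtains a where "norm a \<le> 1"
    "\<And>y. huber x + 2 * (a \<bullet> y) + (1 - 2 * norm x) * huber_excess y \<le> huber (x + y)"
proof (cases "norm x \<le> 1/2")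
  case True
  show thesis
  proof (rule that[of x])
    show "norm x \<le> 1" using True by simp
    fix y :: 'a
    obtain b where b: "norm b \<le> 1/2" "2 * (b \<bullet> y) - (norm b)\<^sup>2 = huber_excess y"
    proof (cases "norm y \<le> 1/2")
      case True
      then show ?thesis using that[of y] by (simp add: huber_excess_small power2_norm_eq_inner)
    next
      case False
      define b where "b = (1 / (2 * norm y)) *\<^sub>R y"
      have "norm y > 0" using False by linarith
      then have b: "norm b = 1/2" "b \<bullet> y = norm y / 2"
        by (simp_all add: b_def power2_norm_eq_inner[symmetric] power2_eq_square)
      have "2 * (b \<bullet> y) - (norm b)\<^sup>2 = norm y - 1/4" unfolding b by (simp add: power2_eq_square)
      then show ?thesis using that[of b] b(1) False by (simp add: huber_excess_large)
    qed
    have "norm (x + b) \<le> 1" using True b(1) norm_triangle_ineq[of x b] by linarith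
    from huber_ge_affine[OF this, of "x + y"]
    have "(norm x)\<^sup>2 + 2 * (x \<bullet> y) + (2 * (b \<bullet> y) - (norm b)\<^sup>2) \<le> huber (x + y)"
      by (simp add: power2_norm_eq_inner algebra_simps inner_commute)
    moreover have "(1 - 2 * norm x) * huber_excess y \<le> 1 * huber_excess y"
      by (intro mult_right_mono huber_excess_nonneg) simp
    ultimately show "huber x + 2 * (x \<bullet> y) + (1 - 2 * norm x) * huber_excess y \<le> huber (x + y)"
      using b(2) True by (simp add: huber_small)
  qed
next
  case False
  define a where "a = (if norm x \<le> 1 then x else (1 / norm x) *\<^sub>R x)"
  have a: "norm a \<le> 1" by (simp add: a_def)
  have x: "2 * (a \<bullet> x) - (norm a)\<^sup>2 = huber x"
  proof (cases "norm x \<le> 1")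
    case True
    then show ?thesis by (simp add: a_def huber_small power2_norm_eq_inner)
  next
    case False
    then have "norm a = 1" "a \<bullet> x = norm x"
      by (auto simp: a_def power2_norm_eq_inner[symmetric] power2_eq_square)
    then show ?thesis using False by (simp add: huber_large)
  qed
  show thesis
  proof (rule that[OF a])
    fix y :: 'a
    have "(1 - 2 * norm x) * huber_excess y \<le> 0"
      using False by (intro mult_nonpos_nonneg huber_excess_nonneg) simp
    then show "huber x + 2 * (a \<bullet> y) + (1 - 2 * norm x) * huber_excess y \<le> huber (x + y)"
      using huber_ge_affine[OF a, of "x + y"] x by (simp add: inner_add_right algebra_simps)
  qed
qed

lemma fill_interval:
  assumes "0 < t" "t \<le> T"
  obtains n :: nat where "1 \<le> n" "real n * t \<le> T" "T < real n * t + t" "T \<le> 2 * (real n * t)"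
proof -
  define n where "n = nat \<lfloor>T / t\<rfloor>"
  have ge: "1 \<le> T / t" using assms by simp
  then have n: "real n = of_int \<lfloor>T / t\<rfloor>" by (simp add: n_def)
  have 1: "1 \<le> n" using ge by (simp add: n_def le_nat_iff)
  have "real n \<le> T / t" using n of_int_floor_le[of "T / t"] by simp
  then have 2: "real n * t \<le> T" using assms(1) by (simp add: pos_le_divide_eq)
  have 3: "T < real n * t + t"
  proof -
    have "T / t < real n + 1" using n real_of_int_floor_add_one_gt[of "T / t"] by simp
    then show ?thesis using assms(1) by (simp add: pos_divide_less_eq distrib_right)
  qed
  have "1 * t \<le> real n * t" using 1 assms(1) by (intro mult_right_mono) auto
  then show thesis using that[OF 1 2 3] 3 by linarith
qed

section \<open>Sublinear convolution semigroups and their generators\<close>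

text \<open>\<open>P t f\<close> stands for the sublinear expectation of \<open>f\<close> of the position at time \<open>t\<close> of a process with
  stationary independent increments that starts at \<open>0\<close>. Only Lipschitz functions are admissible.\<close>

locale sublinear_convolution_semigroup =
  fixes P :: "real \<Rightarrow> ('a::euclidean_space \<Rightarrow> real) \<Rightarrow> real"
  assumes P_mono: "0 < t \<Longrightarrow> C_Lip f \<Longrightarrow> C_Lip g \<Longrightarrow> (\<And>x. f x \<le> g x) \<Longrightarrow> P t f \<le> P t g"
    and P_const: "0 < t \<Longrightarrow> P t (\<lambda>x. c) = c"
    and P_add_le: "0 < t \<Longrightarrow> C_Lip f \<Longrightarrow> C_Lip g \<Longrightarrow> P t (\<lambda>x. f x + g x) \<le> P t f + P t g"
    and P_scale: "0 < t \<Longrightarrow> C_Lip f \<Longrightarrow> 0 \<le> c \<Longrightarrow> P t (\<lambda>x. c * f x) = c * P t f"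
    and P_semigroup: "0 < t \<Longrightarrow> 0 < s \<Longrightarrow> C_Lip f \<Longrightarrow>
          P (t + s) f = P t (\<lambda>x. P s (\<lambda>y. f (x + y)))"
    and P_norm_tendsto: "((\<lambda>t. P t norm) \<longlongrightarrow> 0) (at_right 0)"
begin

lemma P_diff_le:
  assumes "0 < t" "C_Lip f" "C_Lip g"
  shows "P t f - P t g \<le> P t (\<lambda>x. f x - g x)"
  using P_add_le[OF assms(1) C_Lip_diff[OF assms(2,3)] assms(3)] by simp

lemma P_neg_ge: "0 < t \<Longrightarrow> C_Lip f \<Longrightarrow> - P t f \<le> P t (\<lambda>x. - f x)"
  using P_add_le[of t f "\<lambda>x. - f x"] C_Lip_neg[of f] P_const[of t 0] by simp

lemma P_abs_le:
  assumes t: "0 < t" and f: "C_Lip f" and g: "C_Lip g" and le: "\<And>x. \<bar>f x\<bar> \<le> g x"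
  shows "\<bar>P t f\<bar> \<le> P t g"
proof -
  have "P t f \<le> P t g" using le by (intro P_mono t f g) (metis abs_le_D1)
  moreover have "P t (\<lambda>x. - f x) \<le> P t g" using le by (intro P_mono t g C_Lip_neg f) (metis abs_le_D2)
  ultimately show ?thesis using P_neg_ge[OF t f] by linarith
qed

lemma P_nonneg: "0 < t \<Longrightarrow> C_Lip f \<Longrightarrow> (\<And>x. 0 \<le> f x) \<Longrightarrow> 0 \<le> P t f"
  using P_mono[of t "\<lambda>x. 0" f] P_const[of t 0] C_Lip_const[of 0] by simp

lemma P_add_const:
  assumes t: "0 < t" and f: "C_Lip f"
  shows "P t (\<lambda>x. c + f x) = c + P t f"
proof (rule antisym)
  show "P t (\<lambda>x. c + f x) \<le> c + P t f"
    using P_add_le[OF t C_Lip_const f, of c] P_const[OF t, of c] by simp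
  show "c + P t f \<le> P t (\<lambda>x. c + f x)"
    using P_add_le[OF t C_Lip_const C_Lip_add[OF C_Lip_const f], of "- c" c] P_const[OF t, of "- c"] by simp
qed

lemma P_diff_abs_le:
  assumes t: "0 < t" and f: "C_Lip f" and g: "C_Lip g" and h: "C_Lip h" and le: "\<And>x. \<bar>f x - g x\<bar> \<le> h x"
  shows "\<bar>P t f - P t g\<bar> \<le> P t h"
proof -
  have "P t f - P t g \<le> P t h"
    using P_diff_le[OF t f g] P_abs_le[OF t C_Lip_diff[OF f g] h le] by linarith
  moreover have "P t g - P t f \<le> P t h"
    using P_diff_le[OF t g f] P_abs_le[OF t C_Lip_diff[OF g f] h] le
    by (force simp: abs_minus_commute)
  ultimately show ?thesis by linarith
qed

lemma C_Lip_P_shift: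
  assumes t: "0 < t" and f: "C_Lip f"
  shows "C_Lip (\<lambda>x. P t (\<lambda>y. f (x + y)))"
proof -
  obtain L where "0 \<le> L" and L: "\<And>x y. \<bar>f x - f y\<bar> \<le> L * norm (x - y)" using C_LipD[OF f] by blast
  show ?thesis
  proof (rule C_LipI[of _ L])
    fix x x'
    have "\<bar>P t (\<lambda>y. f (x + y)) - P t (\<lambda>y. f (x' + y))\<bar> \<le> P t (\<lambda>y. L * norm (x - x'))"
    proof (intro P_diff_abs_le t C_Lip_shift[OF f] C_Lip_const)
      show "\<bar>f (x + y) - f (x' + y)\<bar> \<le> L * norm (x - x')" for y
        using L[of "x + y" "x' + y"] unfolding add_diff_cancel_right .
    qed
    then show "\<bar>P t (\<lambda>y. f (x + y)) - P t (\<lambda>y. f (x' + y))\<bar> \<le> L * norm (x - x')"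
      unfolding P_const[OF t] .
  qed
qed

lemma P_norm_nonneg: "0 < t \<Longrightarrow> 0 \<le> P t norm"
  by (rule P_nonneg) (auto intro: C_Lip_norm)

lemma P_norm_small:
  assumes "0 < e"
  obtains T where "0 < T" "\<And>t. 0 < t \<Longrightarrow> t \<le> T \<Longrightarrow> P t norm \<le> e"
proof -
  have "\<forall>\<^sub>F t in at_right 0. P t norm < e"
    by (rule order_tendstoD(2)[OF P_norm_tendsto assms])
  then obtain b where b: "0 < b" "\<And>t. 0 < t \<Longrightarrow> t < b \<Longrightarrow> P t norm < e"
    unfolding eventually_at_right_field by blast
  show thesis
    by (rule that[of "b / 2"]) (use b in \<open>auto intro!: less_imp_le\<close>)
qed

text \<open>The mean of a linear function is additive in time, as the increment has the same mean wherever it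
  starts.\<close>

lemma P_inner_add:
  assumes "0 < t" "0 < s"
  shows "P (t + s) (\<lambda>y. p \<bullet> y) = P t (\<lambda>y. p \<bullet> y) + P s (\<lambda>y. p \<bullet> y)"
proof -
  have "P (t + s) (\<lambda>y. p \<bullet> y) = P t (\<lambda>x. P s (\<lambda>y. p \<bullet> x + p \<bullet> y))"
    unfolding P_semigroup[OF assms C_Lip_inner] inner_add_right ..
  also have "\<dots> = P t (\<lambda>x. P s (\<lambda>y. p \<bullet> y) + p \<bullet> x)"
    by (simp add: P_add_const[OF assms(2) C_Lip_inner] add.commute)
  finally show ?thesis by (simp add: P_add_const[OF assms(1) C_Lip_inner])
qed

lemma P_inner_mult:
  assumes t: "0 < t" and n: "1 \<le> n"
  shows "P (real n * t) (\<lambda>y. p \<bullet> y) = real n * P t (\<lambda>y. p \<bullet> y)"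
  using n
proof (induction n rule: dec_induct)
  case (step n)
  then have "P (real n * t + t) (\<lambda>y. p \<bullet> y) = real n * P t (\<lambda>y. p \<bullet> y) + P t (\<lambda>y. p \<bullet> y)"
    using P_inner_add[of "real n * t" t p] t by simp
  then show ?case by (simp add: distrib_right add.commute)
qed simp

text \<open>An additive function of time that is bounded near \<open>0\<close> grows at most linearly: up to the factor
  \<open>2\<close>, about \<open>T / t\<close> copies of the value at \<open>t\<close> add up to a value at a time close to \<open>T\<close>.\<close>

lemma P_inner_bound:
  obtains K T where "0 \<le> K" "0 < T" "\<And>p t. 0 < t \<Longrightarrow> t \<le> T \<Longrightarrow> \<bar>P t (\<lambda>y. p \<bullet> y)\<bar> \<le> K * norm p * t"
proof -
  obtain T where T: "0 < T" "\<And>t. 0 < t \<Longrightarrow> t \<le> T \<Longrightarrow> P t norm \<le> 1"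
    using P_norm_small[of 1] by auto
  have bound: "\<bar>P t (\<lambda>y. p \<bullet> y)\<bar> \<le> norm p" if "0 < t" "t \<le> T" for p t
  proof -
    have "\<bar>P t (\<lambda>y. p \<bullet> y)\<bar> \<le> P t (\<lambda>y. norm p * norm y)"
      by (intro P_abs_le that C_Lip_intros Cauchy_Schwarz_ineq2)
    also have "\<dots> = norm p * P t norm" by (intro P_scale that C_Lip_intros) simp
    also have "\<dots> \<le> norm p * 1" by (intro mult_left_mono T that) simp
    finally show ?thesis by simp
  qed
  show thesis
  proof (rule that[of "2 / T" T])
    fix p t assume t: "0 < t" "t \<le> T"
    obtain n where n: "1 \<le> n" "real n * t \<le> T" "T \<le> 2 * (real n * t)"
      using fill_interval[OF t] by blast
    have "real n * \<bar>P t (\<lambda>y. p \<bullet> y)\<bar> = \<bar>P (real n * t) (\<lambda>y. p \<bullet> y)\<bar>"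
      by (simp add: P_inner_mult[OF t(1) n(1)] abs_mult)
    also have "\<dots> \<le> norm p" using n t by (intro bound) auto
    finally have le: "real n * \<bar>P t (\<lambda>y. p \<bullet> y)\<bar> \<le> norm p" .
    have "T * \<bar>P t (\<lambda>y. p \<bullet> y)\<bar> \<le> 2 * (real n * t) * \<bar>P t (\<lambda>y. p \<bullet> y)\<bar>"
      by (intro mult_right_mono n) simp
    also have "\<dots> = 2 * t * (real n * \<bar>P t (\<lambda>y. p \<bullet> y)\<bar>)" by simp
    also have "\<dots> \<le> 2 * t * norm p" using t by (intro mult_left_mono le) auto
    finally show "\<bar>P t (\<lambda>y. p \<bullet> y)\<bar> \<le> 2 / T * norm p * t"
      using T(1) by (simp add: field_simps)
  qed (use T in auto)
qed

text \<open>A substitute for a bound on second moments. By convexity each step of length \<open>s\<close> raises the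
  expectation of \<open>huber\<close> by at least half of \<open>P s huber_excess\<close>, up to a drift term of order \<open>s\<close>, as long as the
  process stays close to \<open>0\<close>. Since the expectation of \<open>huber\<close> is bounded after \<open>T / s\<close> steps,
  \<open>P s huber_excess\<close> is of order \<open>s\<close>.\<close>

lemma P_huber_excess_bound:
  obtains K T where "0 \<le> K" "0 < T" "\<And>t. 0 < t \<Longrightarrow> t \<le> T \<Longrightarrow> P t huber_excess \<le> K * t"
proof -
  obtain K T0 where K: "0 \<le> K" "0 < T0" "\<And>p t. 0 < t \<Longrightarrow> t \<le> T0 \<Longrightarrow> \<bar>P t (\<lambda>y. p \<bullet> y)\<bar> \<le> K * norm p * t"
    using P_inner_bound by blast
  obtain T1 where T1: "0 < T1" "\<And>t. 0 < t \<Longrightarrow> t \<le> T1 \<Longrightarrow> P t norm \<le> 1/4"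
    using P_norm_small[of "1/4"] by auto
  define T where "T = min T0 T1"
  have T: "0 < T" "T \<le> T0" "T \<le> T1" using K T1 by (auto simp: T_def)
  let ?k = "huber_excess :: 'a \<Rightarrow> real"
  let ?h = "huber :: 'a \<Rightarrow> real"
  note lip = C_Lip_intros C_Lip_huber C_Lip_huber_excess
  have pointwise: "huber x + (1 - 2 * norm x) * P s ?k - 2 * K * s \<le> P s (\<lambda>y. huber (x + y))"
    if s: "0 < s" "s \<le> T" for s x
  proof -
    obtain a where a: "norm a \<le> 1"
      "\<And>y. huber x + 2 * (a \<bullet> y) + (1 - 2 * norm x) * huber_excess y \<le> huber (x + y)"
      using huber_convexity[of x] by blast
    have k0: "0 \<le> P s ?k" by (intro P_nonneg s lip huber_excess_nonneg)
    have "\<bar>P s (\<lambda>y. ((-2) *\<^sub>R a) \<bullet> y)\<bar> \<le> K * norm ((-2) *\<^sub>R a) * s"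
      using s T by (intro K) auto
    also have "\<dots> \<le> K * 2 * s" using a(1) K(1) s by (intro mult_right_mono mult_left_mono) auto
    finally have lin: "P s (\<lambda>y. ((-2) *\<^sub>R a) \<bullet> y) \<le> 2 * K * s" by simp
    have "P s (\<lambda>y. (1 - 2 * norm x) * ?k y) \<ge> (1 - 2 * norm x) * P s ?k"
    proof (cases "2 * norm x \<le> 1")
      case True
      then show ?thesis using P_scale[OF s(1) C_Lip_huber_excess, of "1 - 2 * norm x"] by simp
    next
      case False
      then show ?thesis
        using P_neg_ge[OF s(1) C_Lip_scale[OF C_Lip_huber_excess], of "2 * norm x - 1"]
          P_scale[OF s(1) C_Lip_huber_excess, of "2 * norm x - 1"]
        by (simp add: algebra_simps)
    qed
    moreover have "P s (\<lambda>y. (1 - 2 * norm x) * ?k y) - P s (\<lambda>y. ((-2) *\<^sub>R a) \<bullet> y)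
        \<le> P s (\<lambda>y. (1 - 2 * norm x) * ?k y - ((-2) *\<^sub>R a) \<bullet> y)"
      by (intro P_diff_le s lip)
    moreover have "huber x + P s (\<lambda>y. (1 - 2 * norm x) * ?k y - ((-2) *\<^sub>R a) \<bullet> y)
        = P s (\<lambda>y. huber x + ((1 - 2 * norm x) * ?k y - ((-2) *\<^sub>R a) \<bullet> y))"
      by (intro P_add_const[symmetric] s lip)
    moreover have "\<dots> \<le> P s (\<lambda>y. huber (x + y))"
    proof (intro P_mono s lip C_Lip_shift[OF C_Lip_huber])
      show "huber x + ((1 - 2 * norm x) * ?k y - ((-2) *\<^sub>R a) \<bullet> y) \<le> huber (x + y)" for y
        using a(2)[of y] by simp
    qed
    ultimately show ?thesis using lin by linarith
  qed
  have grow: "P t ?h + P s ?k / 2 - 2 * K * s \<le> P (t + s) ?h" if t: "0 < t" "t \<le> T" and s: "0 < s" "s \<le> T" for t s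
  proof -
    define c where "c = P s ?k"
    have c: "0 \<le> c" unfolding c_def by (intro P_nonneg s lip huber_excess_nonneg)
    have "P t ?h - P t (\<lambda>x. (2 * c) * norm x) \<le> P t (\<lambda>x. huber x - (2 * c) * norm x)"
      by (intro P_diff_le t lip)
    moreover have "P t (\<lambda>x. (2 * c) * norm x) \<le> (2 * c) * (1/4)"
    proof -
      have "P t (\<lambda>x. (2 * c) * norm x) = (2 * c) * P t norm" using c by (intro P_scale t lip) simp
      also have "\<dots> \<le> (2 * c) * (1/4)" using t T c by (intro mult_left_mono T1) auto
      finally show ?thesis .
    qed
    moreover have "(c - 2 * K * s) + P t (\<lambda>x. huber x - (2 * c) * norm x)
        = P t (\<lambda>x. (c - 2 * K * s) + (huber x - (2 * c) * norm x))"
      by (intro P_add_const[symmetric] t lip)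
    moreover have "\<dots> \<le> P t (\<lambda>x. P s (\<lambda>y. huber (x + y)))"
    proof (intro P_mono t s lip C_Lip_P_shift[OF s(1) C_Lip_huber])
      show "(c - 2 * K * s) + (huber x - (2 * c) * norm x) \<le> P s (\<lambda>y. huber (x + y))" for x
        using pointwise[OF s, of x] by (simp add: c_def algebra_simps)
    qed
    moreover have "P t (\<lambda>x. P s (\<lambda>y. huber (x + y))) = P (t + s) ?h"
      by (intro P_semigroup[symmetric] t s lip)
    ultimately show ?thesis by (simp add: c_def)
  qed
  have iterate: "real n * (P s ?k / 2 - 2 * K * s) \<le> P (real n * s) ?h"
    if s: "0 < s" and n: "1 \<le> n" and ns: "real n * s \<le> T" for n s
    using n ns
  proof (induction n rule: dec_induct)
    case base
    have "P s ?k \<le> P s ?h"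
    proof (intro P_mono s lip)
      show "huber_excess y \<le> huber y" for y :: 'a by (rule huber_excess_le_huber)
    qed
    moreover have "0 \<le> P s ?k" by (intro P_nonneg s lip huber_excess_nonneg)
    moreover have "0 \<le> 2 * K * s" using K s by simp
    ultimately show ?case unfolding of_nat_1 mult_1 by linarith
  next
    case (step n)
    have ns: "real n * s \<le> T" "s \<le> T"
    proof -
      have "real n * s + s \<le> T" using step.prems by (simp add: distrib_right add.commute)
      moreover have "0 \<le> real n * s" using s by simp
      ultimately show "real n * s \<le> T" "s \<le> T" using s by linarith+
    qed
    have "0 < real n * s" using step.hyps s by simp
    from grow[OF this ns(1) s ns(2)] step.IH[OF ns(1)]
    show ?case by (simp add: distrib_right add.commute)
  qed
  show thesis
  proof (rule that[of "4 * K + 2 / T" T])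
    fix t assume t: "0 < t" "t \<le> T"
    obtain n where n: "1 \<le> n" "real n * t \<le> T" "T \<le> 2 * (real n * t)"
      using fill_interval[OF t] by blast
    have nt: "0 < real n * t" using n t by simp
    have "P (real n * t) ?h \<le> P (real n * t) (\<lambda>x. 2 * norm x)"
      by (intro P_mono nt lip huber_le)
    also have "\<dots> = 2 * P (real n * t) norm" by (intro P_scale nt lip) simp
    also have "\<dots> \<le> 2 * (1/4)" using n T by (intro mult_left_mono T1(2) nt) auto
    finally have le: "real n * (P t ?k / 2 - 2 * K * t) \<le> 1/2" using iterate[OF t(1) n(1,2)] by simp
    define m where "m = P t ?k / 2 - 2 * K * t"
    have "T * m \<le> t"
    proof (cases "m \<le> 0")
      case True
      then have "T * m \<le> 0" using T(1) by (simp add: mult_nonneg_nonpos)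
      then show ?thesis using t by linarith
    next
      case False
      then have "T * m \<le> 2 * (real n * t) * m" using n by (intro mult_right_mono) auto
      also have "\<dots> = 2 * t * (real n * m)" by simp
      also have "\<dots> \<le> 2 * t * (1/2)" using le t unfolding m_def by (intro mult_left_mono) auto
      finally show ?thesis by simp
    qed
    then have "m \<le> t / T" using T(1) by (simp add: field_simps)
    then show "P t ?k \<le> (4 * K + 2 / T) * t" by (simp add: m_def algebra_simps)
  qed (use K T in auto)
qed

text \<open>First order smoothness at \<open>0\<close> with one constant \<open>M\<close>, in a form that is stable under scaling \<open>g\<close> and
  \<open>M\<close> by the same factor.\<close>

definition first_order_bound :: "real \<Rightarrow> 'a \<Rightarrow> ('a \<Rightarrow> real) \<Rightarrow> bool" where
  "first_order_bound M p g \<longleftrightarrow> C_Lip g \<and> norm p \<le> M \<and>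
     (\<forall>z. \<bar>g z\<bar> \<le> M * norm z \<and> \<bar>g z - p \<bullet> z\<bar> \<le> M * (norm z)\<^sup>2)"

lemma first_order_bound_neg:
  assumes "first_order_bound M p g"
  shows "first_order_bound M (- p) (\<lambda>z. - g z)"
proof -
  have "\<bar>- g z - - p \<bullet> z\<bar> = \<bar>g z - p \<bullet> z\<bar>" for z
    by (simp add: abs_minus_commute)
  then show ?thesis
    using assms C_Lip_neg[of g] unfolding first_order_bound_def norm_minus_cancel abs_minus_cancel
    by metis
qed

lemma P_first_order_bound:
  obtains K T where "0 \<le> K" "0 < T"
    "\<And>M p g t. first_order_bound M p g \<Longrightarrow> 0 < t \<Longrightarrow> t \<le> T \<Longrightarrow> \<bar>P t g\<bar> \<le> K * M * t"
proof -
  obtain K1 T1 where K1: "0 \<le> K1" "0 < T1"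
    "\<And>p t. 0 < t \<Longrightarrow> t \<le> T1 \<Longrightarrow> \<bar>P t (\<lambda>y. p \<bullet> y)\<bar> \<le> K1 * norm p * t"
    using P_inner_bound by blast
  obtain K2 T2 where K2: "0 \<le> K2" "0 < T2" "\<And>t. 0 < t \<Longrightarrow> t \<le> T2 \<Longrightarrow> P t huber_excess \<le> K2 * t"
    using P_huber_excess_bound by blast
  show thesis
  proof (rule that[of "K1 + 4 * K2" "min T1 T2"])
    fix M p g t assume g: "first_order_bound M p g" and "0 < t" "t \<le> min T1 T2"
    then have t: "0 < t" "t \<le> T1" "t \<le> T2" by auto
    have lip: "C_Lip g" and p: "norm p \<le> M"
      and g1: "\<And>z. \<bar>g z\<bar> \<le> M * norm z" and g2: "\<And>z. \<bar>g z - p \<bullet> z\<bar> \<le> M * (norm z)\<^sup>2"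
      using g by (auto simp: first_order_bound_def)
    have M: "0 \<le> M" by (rule order_trans[OF norm_ge_zero p])
    have "\<bar>P t g - P t (\<lambda>y. p \<bullet> y)\<bar> \<le> P t (\<lambda>y. (4 * M) * huber_excess y)"
    proof (intro P_diff_abs_le t lip C_Lip_intros C_Lip_huber_excess)
      fix z
      have "\<bar>p \<bullet> z\<bar> \<le> M * norm z"
        using Cauchy_Schwarz_ineq2[of p z] mult_right_mono[OF p norm_ge_zero[of z]] by linarith
      then have "\<bar>g z - p \<bullet> z\<bar> \<le> 2 * M * norm z" using g1[of z] by linarith
      from le_huber_excess[OF g2 this M] show "\<bar>g z - p \<bullet> z\<bar> \<le> (4 * M) * huber_excess z" .
    qed
    also have "\<dots> = (4 * M) * P t huber_excess" using M by (intro P_scale t C_Lip_huber_excess) simp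
    also have "\<dots> \<le> (4 * M) * (K2 * t)" using M t by (intro mult_left_mono K2) auto
    finally have "\<bar>P t g - P t (\<lambda>y. p \<bullet> y)\<bar> \<le> (4 * M) * (K2 * t)" .
    moreover have "\<bar>P t (\<lambda>y. p \<bullet> y)\<bar> \<le> K1 * M * t"
    proof -
      have "K1 * norm p * t \<le> K1 * M * t" using K1 p t by (intro mult_right_mono mult_left_mono) auto
      then show ?thesis using K1(3)[OF t(1,2), of p] by linarith
    qed
    ultimately show "\<bar>P t g\<bar> \<le> (K1 + 4 * K2) * M * t" by (simp add: algebra_simps)
  qed (use K1 K2 in auto)
qed

text \<open>Put \<open>u t = P t f\<close>. The second hypothesis makes \<open>P s (f (x + _)) - f x\<close> Lipschitz in \<open>x\<close> with a constant
  of order \<open>s\<close>, so by the semigroup property \<open>u (t + s)\<close> differs from \<open>u t + u s\<close> by at most a multiple of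
  \<open>s * P t norm\<close>. As \<open>P t norm\<close> tends to \<open>0\<close>, the function \<open>u\<close> is asymptotically additive, and its
  difference quotients at \<open>0\<close> are Cauchy.\<close>

theorem generator_exists:
  assumes f: "C_Lip f" and f0: "f 0 = 0" and M: "0 \<le> M"
    and first: "first_order_bound M p f"
    and second: "\<And>x y. \<exists>p. first_order_bound (M * norm (x - y)) p (\<lambda>z. (f (x + z) - f x) - (f (y + z) - f y))"
  shows "\<exists>l. ((\<lambda>t. P t f / t) \<longlongrightarrow> l) (at_right 0)"
proof -
  obtain K T0 where K: "0 \<le> K" "0 < T0"
    "\<And>M p g t. first_order_bound M p g \<Longrightarrow> 0 < t \<Longrightarrow> t \<le> T0 \<Longrightarrow> \<bar>P t g\<bar> \<le> K * M * t"
    using P_first_order_bound by blast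
  define u where "u t = P t f" for t
  define L where "L = K * M + 1"
  have L: "0 < L" using K M by (simp add: L_def add_nonneg_pos)
  have KL: "K * M * a \<le> L * a" if "0 \<le> a" for a using that by (simp add: L_def algebra_simps)
  have u_bound: "\<bar>u t\<bar> \<le> L * t" if "0 < t" "t \<le> T0" for t
    using K(3)[OF first that] KL[of t] that unfolding u_def by linarith
  have increments: "\<bar>P s (\<lambda>y. f (x + y)) - (f x + u s)\<bar> \<le> (L * s) * norm x"
    if s: "0 < s" "s \<le> T0" for s x
  proof -
    obtain q where q: "first_order_bound (M * norm x) q (\<lambda>z. (f (x + z) - f x) - f z)"
      using second[of x 0] f0 by auto
    have lip1: "C_Lip (\<lambda>z. f (x + z) - f x)" by (intro C_Lip_intros C_Lip_shift[OF f])
    have "\<bar>P s (\<lambda>z. (f (x + z) - f x) - f z)\<bar> \<le> (K * M * s) * norm x"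
      using K(3)[OF q s] by (simp add: mult_ac)
    moreover have "\<bar>P s (\<lambda>z. f z - (f (x + z) - f x))\<bar> \<le> (K * M * s) * norm x"
    proof -
      have "first_order_bound (M * norm x) (- q) (\<lambda>z. f z - (f (x + z) - f x))"
        using first_order_bound_neg[OF q] by simp
      from K(3)[OF this s] show ?thesis by (simp add: mult_ac)
    qed
    moreover have "P s (\<lambda>z. f (x + z) - f x) - u s \<le> P s (\<lambda>z. (f (x + z) - f x) - f z)"
      "u s - P s (\<lambda>z. f (x + z) - f x) \<le> P s (\<lambda>z. f z - (f (x + z) - f x))"
      unfolding u_def by (intro P_diff_le s lip1 f)+
    moreover have "P s (\<lambda>y. f (x + y)) = f x + P s (\<lambda>z. f (x + z) - f x)"
      using P_add_const[OF s(1) lip1, of "f x"] by simp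
    moreover have "(K * M * s) * norm x \<le> (L * s) * norm x"
      using KL[of s] s by (intro mult_right_mono) auto
    ultimately show ?thesis by linarith
  qed
  have almost_additive: "\<bar>u (t + s) - (u t + u s)\<bar> \<le> (L * s) * P t norm"
    if t: "0 < t" and s: "0 < s" "s \<le> T0" for t s
  proof -
    have "\<bar>P t (\<lambda>x. P s (\<lambda>y. f (x + y))) - P t (\<lambda>x. u s + f x)\<bar> \<le> P t (\<lambda>x. (L * s) * norm x)"
    proof (intro P_diff_abs_le t s f C_Lip_P_shift[OF s(1) f] C_Lip_intros)
      show "\<bar>P s (\<lambda>y. f (x + y)) - (u s + f x)\<bar> \<le> (L * s) * norm x" for x
        using increments[OF s, of x] by (simp add: add.commute)
    qed
    moreover have "P t (\<lambda>x. (L * s) * norm x) = (L * s) * P t norm"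
      using L s by (intro P_scale t C_Lip_intros) auto
    moreover have "P t (\<lambda>x. u s + f x) = u s + u t"
      unfolding u_def by (intro P_add_const t f)
    moreover have "P t (\<lambda>x. P s (\<lambda>y. f (x + y))) = u (t + s)"
      unfolding u_def by (intro P_semigroup[symmetric] t s f)
    ultimately show ?thesis by (simp add: add.commute)
  qed
  \<comment> \<open>An accumulation point of the difference quotients is their limit: the quotient at a small \<open>t\<close> is
    compared with that at a fixed \<open>T\<close> through the multiples of \<open>t\<close> up to \<open>T\<close>.\<close>
  have close: "\<exists>T>0. \<forall>t. 0 < t \<longrightarrow> t < T \<longrightarrow> \<bar>u t / t - c\<bar> \<le> e" if e: "0 < e"
    and c: "\<And>\<epsilon> T'. 0 < \<epsilon> \<Longrightarrow> 0 < T' \<Longrightarrow> \<exists>T. 0 < T \<and> T \<le> T' \<and> \<bar>u T / T - c\<bar> \<le> \<epsilon>" for e c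
  proof -
    define \<epsilon> where "\<epsilon> = e / (4 * L)"
    have \<epsilon>: "0 < \<epsilon>" "L * \<epsilon> = e / 4" using e L by (auto simp: \<epsilon>_def)
    obtain T1 where T1: "0 < T1" "\<And>t. 0 < t \<Longrightarrow> t \<le> T1 \<Longrightarrow> P t norm \<le> \<epsilon>"
      using P_norm_small[OF \<epsilon>(1)] by auto
    obtain T where T: "0 < T" "T \<le> min (min T0 T1) 1" "\<bar>u T / T - c\<bar> \<le> e / 4"
      using c[of "e / 4" "min (min T0 T1) 1"] e K(2) T1(1) by auto
    have multiples: "\<bar>u (real n * t) - real n * u t\<bar> \<le> real n * (L * t * \<epsilon>)"
      if t: "0 < t" and n: "1 \<le> n" and nt: "real n * t \<le> T" for n t
      using n nt
    proof (induction n rule: dec_induct)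
      case base
      then show ?case using L t \<epsilon> by simp
    next
      case (step n)
      have nt: "real n * t + t \<le> T" using step.prems by (simp add: distrib_right add.commute)
      have pos: "0 < real n * t" using step.hyps t by simp
      have "\<bar>u (real n * t + t) - (u (real n * t) + u t)\<bar> \<le> (L * t) * P (real n * t) norm"
        using nt pos t T by (intro almost_additive) auto
      also have "\<dots> \<le> (L * t) * \<epsilon>" using nt pos t T L by (intro mult_left_mono T1) auto
      finally have "\<bar>u (real n * t + t) - (u (real n * t) + u t)\<bar> \<le> L * t * \<epsilon>" .
      moreover have "\<bar>u (real n * t) - real n * u t\<bar> \<le> real n * (L * t * \<epsilon>)"
        using step.IH nt t by simp
      moreover have eqs: "real (Suc n) * t = real n * t + t" "real (Suc n) * u t = real n * u t + u t"
        "real (Suc n) * (L * t * \<epsilon>) = real n * (L * t * \<epsilon>) + L * t * \<epsilon>"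
        by (simp_all add: distrib_right add.commute)
      ultimately show ?case unfolding eqs by linarith
    qed
    have compare: "\<bar>u t / t - u T / T\<bar> \<le> e / 4 + (3 + \<epsilon>) * L * t / T" if t: "0 < t" "t \<le> T" for t
    proof -
      obtain n where n: "1 \<le> n" "real n * t \<le> T" "T < real n * t + t"
        using fill_interval[OF t] by blast
      define r where "r = T - real n * t"
      have r: "0 \<le> r" "r \<le> t" using n by (auto simp: r_def)
      have nt: "0 < real n * t" using n t by simp
      have A: "\<bar>u (real n * t) - real n * u t\<bar> \<le> T * (e / 4)"
      proof -
        have "real n * (L * t * \<epsilon>) = (real n * t) * (L * \<epsilon>)" by simp
        also have "\<dots> \<le> T * (L * \<epsilon>)" using n L \<epsilon>(1) by (intro mult_right_mono) auto
        finally show ?thesis using multiples[OF t(1) n(1,2)] \<epsilon>(2) by simp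
      qed
      have B: "\<bar>u T - u (real n * t)\<bar> \<le> (2 + \<epsilon>) * L * t"
      proof (cases "r = 0")
        case True
        then show ?thesis using L t \<epsilon> by (simp add: r_def)
      next
        case False
        then have r': "0 < r" "r \<le> T0" using r t T by auto
        have "\<bar>u (real n * t + r) - (u (real n * t) + u r)\<bar> \<le> (L * r) * P (real n * t) norm"
          by (intro almost_additive nt r')
        also have "\<dots> \<le> (L * t) * \<epsilon>"
          using n T L r t by (intro mult_mono T1(2) nt P_norm_nonneg) auto
        finally have "\<bar>u T - (u (real n * t) + u r)\<bar> \<le> (L * t) * \<epsilon>" by (simp add: r_def)
        moreover have "\<bar>u r\<bar> \<le> L * t"
          using u_bound[OF r'] mult_left_mono[OF r(2) less_imp_le[OF L]] by linarith
        moreover have "0 \<le> L * t" using L t by simp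
        moreover have "(2 + \<epsilon>) * L * t = 2 * (L * t) + (L * t) * \<epsilon>" by (simp add: algebra_simps)
        ultimately show ?thesis by linarith
      qed
      have C: "\<bar>r * (u t / t)\<bar> \<le> L * t"
      proof -
        have "\<bar>u t\<bar> \<le> L * t" using t T by (intro u_bound) auto
        then have "\<bar>u t / t\<bar> \<le> L" using t(1) by (simp add: abs_divide pos_divide_le_eq)
        then have "r * \<bar>u t / t\<bar> \<le> t * L" using r t by (intro mult_mono) auto
        then show ?thesis using r by (simp add: abs_mult mult.commute)
      qed
      have "T * (u t / t) = real n * u t + r * (u t / t)"
        using t by (simp add: r_def field_simps)
      then have "\<bar>T * (u t / t) - u T\<bar> \<le> T * (e / 4) + (3 + \<epsilon>) * L * t"
      proof -
        have "(3 + \<epsilon>) * L * t = (2 + \<epsilon>) * L * t + L * t" by (simp add: algebra_simps)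
        with A B C \<open>T * (u t / t) = real n * u t + r * (u t / t)\<close> show ?thesis by linarith
      qed
      moreover have "\<bar>T * (u t / t) - u T\<bar> = T * \<bar>u t / t - u T / T\<bar>"
      proof -
        have "T * (u t / t) - u T = T * (u t / t - u T / T)" using T by (simp add: right_diff_distrib)
        then show ?thesis using T(1) by (simp add: abs_mult)
      qed
      ultimately have "T * \<bar>u t / t - u T / T\<bar> \<le> T * (e / 4 + (3 + \<epsilon>) * L * t / T)"
        using T by (simp add: distrib_left)
      then show ?thesis using T(1) by (simp only: mult_le_cancel_left_pos)
    qed
    define \<tau> where "\<tau> = min T (e / 4 * T / ((3 + \<epsilon>) * L))"
    have den: "0 < (3 + \<epsilon>) * L" using \<epsilon> L by simp
    have "0 < \<tau>" using T e den by (simp add: \<tau>_def)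
    moreover have "\<bar>u t / t - c\<bar> \<le> e" if t: "0 < t" "t < \<tau>" for t
    proof -
      have "t * ((3 + \<epsilon>) * L) \<le> e / 4 * T" using t den by (simp add: \<tau>_def field_simps)
      then have small: "(3 + \<epsilon>) * L * t / T \<le> e / 4" using T(1) by (simp add: field_simps)
      have "t \<le> T" using t by (simp add: \<tau>_def)
      from compare[OF t(1) this] T(3) small e show ?thesis by linarith
    qed
    ultimately show ?thesis by blast
  qed
  \<comment> \<open>By \<open>close\<close>, an accumulation point of the bounded quotients \<open>u t / t\<close> along \<open>t = 1 / n\<close> is the limit.\<close>
  obtain n0 where n0: "1 / T0 < real n0" using reals_Archimedean2 by blast
  define a where "a n = u (1 / real (n + Suc n0)) * real (n + Suc n0)" for n
  have a_time: "0 < 1 / real (n + Suc n0)" "1 / real (n + Suc n0) \<le> T0" for n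
  proof -
    have "1 / T0 \<le> real (n + Suc n0)" using n0 by simp
    then show "1 / real (n + Suc n0) \<le> T0" using K(2) by (simp add: field_simps)
  qed simp
  have "a n \<in> {- L..L}" for n
  proof -
    have "\<bar>u (1 / real (n + Suc n0))\<bar> * real (n + Suc n0) \<le> L * (1 / real (n + Suc n0)) * real (n + Suc n0)"
      by (intro mult_right_mono u_bound a_time) simp
    then have "\<bar>a n\<bar> \<le> L" by (simp add: a_def abs_mult)
    then show ?thesis by auto
  qed
  then obtain c r where c: "strict_mono r" "(a \<circ> r) \<longlonglongrightarrow> c"
    using compact_Icc[of "- L" L] unfolding compact_def by metis
  have "\<exists>T>0. \<forall>t. 0 < t \<longrightarrow> t < T \<longrightarrow> \<bar>u t / t - c\<bar> \<le> e" if e: "0 < e" for e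
  proof (rule close[OF e])
    fix \<epsilon> T' :: real assume "0 < \<epsilon>" "0 < T'"
    have "\<forall>\<^sub>F n in sequentially. dist ((a \<circ> r) n) c < \<epsilon>"
      using c(2) \<open>0 < \<epsilon>\<close> by (rule tendstoD)
    moreover have "\<forall>\<^sub>F n in sequentially. 1 / T' < real n"
    proof -
      obtain N where "1 / T' < real N" using reals_Archimedean2 by blast
      then show ?thesis
        by (intro eventually_sequentiallyI[of N]) (meson less_le_trans of_nat_le_iff)
    qed
    ultimately have "\<forall>\<^sub>F n in sequentially. dist ((a \<circ> r) n) c < \<epsilon> \<and> 1 / T' < real n"
      by (rule eventually_conj)
    then obtain n where n: "dist ((a \<circ> r) n) c < \<epsilon>" "1 / T' < real n"
      unfolding eventually_sequentially by blast
    define T where "T = 1 / real (r n + Suc n0)"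
    have "1 / T' \<le> real (r n + Suc n0)" using n(2) seq_suble[OF c(1), of n] by simp
    then have "T \<le> T'" using \<open>0 < T'\<close> by (simp add: T_def field_simps)
    moreover have "a (r n) = u T / T" by (simp add: a_def T_def)
    then have "\<bar>u T / T - c\<bar> \<le> \<epsilon>" using n(1) by (simp add: dist_real_def)
    moreover have "0 < T" by (simp add: T_def)
    ultimately show "\<exists>T. 0 < T \<and> T \<le> T' \<and> \<bar>u T / T - c\<bar> \<le> \<epsilon>" by blast
  qed
  note limit = this
  have "((\<lambda>t. u t / t) \<longlongrightarrow> c) (at_right 0)"
  proof (rule tendstoI)
    fix e :: real assume "0 < e"
    then obtain T where "0 < T" "\<And>t. 0 < t \<Longrightarrow> t < T \<Longrightarrow> \<bar>u t / t - c\<bar> \<le> e / 2"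
      using limit[of "e / 2"] by auto
    then have "\<And>t. 0 < t \<Longrightarrow> t < T \<Longrightarrow> dist (u t / t) c < e"
      using \<open>0 < e\<close> by (fastforce simp: dist_real_def)
    then show "\<forall>\<^sub>F t in at_right 0. dist (u t / t) c < e"
      unfolding eventually_at_right_field using \<open>0 < T\<close> by blast
  qed
  then show ?thesis unfolding u_def by blast
qed

end

section \<open>Linear functionals below the generator\<close>

text \<open>The norm, made of third order near \<open>0\<close>. A process whose third moment is \<open>o(t)\<close> contributes nothing to the
  growth rate of this function, whatever \<open>e\<close> is, and a process with first moment \<open>O(t)\<close> contributes a
  rate that is independent of \<open>e\<close>, as the Lipschitz constant is \<open>3\<close> for all \<open>e\<close>.\<close>

definition jump_weight :: "real \<Rightarrow> 'a::euclidean_space \<Rightarrow> real" where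
  "jump_weight e z = min (norm z) (norm z ^ 3 / e\<^sup>2)"

definition unit_weight :: "'a::euclidean_space \<Rightarrow> real" where
  "unit_weight z = min 1 (norm z ^ 3)"

lemma unit_weight_nonneg: "0 \<le> unit_weight z"
  by (simp add: unit_weight_def)

lemma unit_weight_pos: "z \<noteq> 0 \<Longrightarrow> 0 < unit_weight z"
  by (simp add: unit_weight_def)

lemma unit_weight_0: "unit_weight 0 = 0"
  by (simp add: unit_weight_def)

lemma unit_weight_small: "norm z \<le> 1 \<Longrightarrow> unit_weight z = norm z ^ 3"
  by (simp add: unit_weight_def power_le_one)

lemma unit_weight_large: "1 \<le> norm z \<Longrightarrow> unit_weight z = 1"
  by (simp add: unit_weight_def one_le_power)

lemma cube_le_self: "0 \<le> r \<Longrightarrow> r \<le> 1 \<Longrightarrow> r ^ 3 \<le> (r :: real)"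
  using power_decreasing[of 1 3 r] by simp

lemma unit_weight_le_norm: "unit_weight z \<le> norm z"
  by (cases "norm z \<le> 1") (auto simp: unit_weight_small unit_weight_large cube_le_self)

lemma unit_weight_le_jump_weight: "unit_weight z \<le> jump_weight 1 z"
  using unit_weight_le_norm[of z] by (auto simp: jump_weight_def unit_weight_def)

lemma jump_weight_nonneg: "0 \<le> jump_weight e z"
  by (simp add: jump_weight_def)

definition punctured :: "(real^'d::finite) set" where
  "punctured = UNIV - {0}"

lemma continuous_on_unit_weight: "continuous_on A unit_weight"
  unfolding unit_weight_def by (intro continuous_intros)

text \<open>Bounded functions that agree with a linear function, or with a product of two coordinates, up to an error
  of third order at \<open>0\<close>.\<close>

definition drift_test :: "real^'d::finite \<Rightarrow> real^'d \<Rightarrow> real" where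
  "drift_test p z = (p \<bullet> z) / (1 + (norm z)\<^sup>2)"

definition diffusion_test :: "'d::finite \<Rightarrow> 'd \<Rightarrow> real^'d \<Rightarrow> real" where
  "diffusion_test i j z = (z $ i * z $ j) / (1 + (norm z)\<^sup>2)"

lemma one_plus_square_pos: "0 < 1 + (norm z)\<^sup>2"
  by (simp add: add_pos_nonneg)

lemma one_plus_square_neq: "1 + (norm z)\<^sup>2 \<noteq> 0"
  using one_plus_square_pos[of z] by simp

lemma abs_diffusion_test_le: "\<bar>diffusion_test i j z\<bar> \<le> (norm z)\<^sup>2 / (1 + (norm z)\<^sup>2)"
proof -
  have "\<bar>z $ i * z $ j\<bar> \<le> norm z * norm z"
    unfolding abs_mult by (intro mult_mono component_le_norm_cart) auto
  then have "\<bar>z $ i * z $ j\<bar> / (1 + (norm z)\<^sup>2) \<le> (norm z)\<^sup>2 / (1 + (norm z)\<^sup>2)"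
    using one_plus_square_pos[of z] by (intro divide_right_mono) (auto simp: power2_eq_square)
  moreover have "\<bar>diffusion_test i j z\<bar> = \<bar>z $ i * z $ j\<bar> / (1 + (norm z)\<^sup>2)"
    using one_plus_square_pos[of z] by (simp add: diffusion_test_def abs_divide)
  ultimately show ?thesis by simp
qed

lemma continuous_on_drift_test: "continuous_on A (drift_test p)"
  unfolding drift_test_def
  by (intro continuous_intros ballI one_plus_square_neq)

lemma continuous_on_diffusion_test: "continuous_on A (diffusion_test i j)"
  unfolding diffusion_test_def
  by (intro continuous_intros ballI one_plus_square_neq)

lemma abs_drift_test_le: "\<bar>drift_test p z\<bar> \<le> norm p * norm z" "\<bar>drift_test p z\<bar> \<le> norm p"
proof -
  have eq: "\<bar>drift_test p z\<bar> = \<bar>p \<bullet> z\<bar> / (1 + (norm z)\<^sup>2)"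
    using one_plus_square_pos[of z] by (simp add: drift_test_def abs_divide)
  have "\<bar>p \<bullet> z\<bar> / (1 + (norm z)\<^sup>2) \<le> \<bar>p \<bullet> z\<bar> / 1" by (intro divide_left_mono) (auto simp: one_plus_square_pos)
  then show "\<bar>drift_test p z\<bar> \<le> norm p * norm z"
    using Cauchy_Schwarz_ineq2[of p z] eq by simp
  have "0 \<le> (norm z - 1/2)\<^sup>2" by simp
  then have "norm z \<le> 1 + (norm z)\<^sup>2" by (simp add: power2_eq_square algebra_simps)
  then have "norm p * norm z \<le> norm p * (1 + (norm z)\<^sup>2)" by (intro mult_left_mono) auto
  then show "\<bar>drift_test p z\<bar> \<le> norm p"
    using Cauchy_Schwarz_ineq2[of p z] one_plus_square_pos[of z] unfolding eq
    by (simp add: pos_divide_le_eq)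
qed

lemma square_ratio_le: "(norm z)\<^sup>2 / (1 + (norm z)\<^sup>2) \<le> norm z"
proof -
  have "0 \<le> (norm z - 1/2)\<^sup>2" by simp
  then have "norm z \<le> 1 + (norm z)\<^sup>2" by (simp add: power2_eq_square algebra_simps)
  then have "norm z * norm z \<le> norm z * (1 + (norm z)\<^sup>2)" by (intro mult_left_mono) auto
  then show ?thesis using one_plus_square_pos[of z] by (simp add: pos_divide_le_eq power2_eq_square)
qed

lemma quadratic_form_sum:
  "u \<bullet> (A *v u) = (\<Sum>i\<in>UNIV. \<Sum>j\<in>UNIV. (u $ i * u $ j) * A $ i $ j)" for u :: "real^'d::finite"
  by (simp add: inner_vec_def matrix_vector_mult_def sum_distrib_left mult_ac)

text \<open>By boundedness of \<open>f\<close> and of the test functions away from \<open>0\<close>, and by the third order Taylor formula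
  near \<open>0\<close>.\<close>

lemma taylor_remainder_bound:
  fixes f :: "real^'d::finite \<Rightarrow> real"
  assumes f: "C_b 3 f" "f 0 = 0"
  shows "\<exists>B\<ge>0. \<forall>z. \<bar>f z - drift_test (grad f 0) z
    - (1/2) * (\<Sum>i\<in>UNIV. \<Sum>j\<in>UNIV. hessian f 0 $ i $ j * diffusion_test i j z)\<bar> \<le> B * unit_weight z"
proof -
  let ?D = "grad f 0" and ?H = "hessian f 0"
  let ?q = "\<lambda>z. \<Sum>i\<in>UNIV. \<Sum>j\<in>UNIV. ?H $ i $ j * (z $ i * z $ j)"
  let ?qt = "\<lambda>z. \<Sum>i\<in>UNIV. \<Sum>j\<in>UNIV. ?H $ i $ j * diffusion_test i j z"
  obtain L where L: "0 \<le> L" "\<And>z. \<bar>f z - f 0 - ?D \<bullet> z - (1/2) * ?q z\<bar> \<le> L * norm z ^ 3"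
    using C_b_taylor_third_order[OF f(1)] by blast
  obtain Bf where Bf: "0 \<le> Bf" "\<And>z. \<bar>f z\<bar> \<le> Bf" using C_b_bound[OF f(1)] by blast
  define M where "M = (\<Sum>i\<in>UNIV. \<Sum>j\<in>UNIV. \<bar>?H $ i $ j\<bar>)"
  have M: "0 \<le> M" by (simp add: M_def sum_nonneg)
  define w where "w z = (norm z)\<^sup>2 / (1 + (norm z)\<^sup>2)" for z :: "real^'d"
  have w: "0 \<le> w z" "w z \<le> 1" "w z \<le> (norm z)\<^sup>2" for z
    using one_plus_square_pos[of z] by (auto simp: w_def divide_le_eq mult_le_cancel_left1)
  have qt: "\<bar>?qt z\<bar> \<le> M * w z" for z
  proof -
    have "\<bar>?qt z\<bar> \<le> (\<Sum>i\<in>UNIV. \<Sum>j\<in>UNIV. \<bar>?H $ i $ j * diffusion_test i j z\<bar>)"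
      by (intro order_trans[OF sum_abs] sum_mono sum_abs)
    also have "\<dots> \<le> (\<Sum>i\<in>UNIV. \<Sum>j\<in>UNIV. \<bar>?H $ i $ j\<bar> * w z)"
      unfolding abs_mult w_def by (intro sum_mono mult_left_mono abs_diffusion_test_le) auto
    finally show ?thesis by (simp add: M_def sum_distrib_right)
  qed
  have q_qt: "?q z = ?qt z * (1 + (norm z)\<^sup>2)" for z
  proof -
    have "diffusion_test i j z * (1 + (norm z)\<^sup>2) = z $ i * z $ j" for i j
      using one_plus_square_pos[of z] by (simp add: diffusion_test_def)
    then show ?thesis by (simp add: sum_distrib_right mult.assoc)
  qed
  have drift: "?D \<bullet> z - drift_test ?D z = drift_test ?D z * (norm z)\<^sup>2" for z
    using one_plus_square_pos[of z] by (simp add: drift_test_def field_simps)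
  define B where "B = L + Bf + norm ?D + M"
  have "\<bar>f z - drift_test ?D z - (1/2) * ?qt z\<bar> \<le> B * unit_weight z" for z
  proof (cases "norm z \<le> 1")
    case True
    have r3: "(norm z)\<^sup>2 * (norm z)\<^sup>2 \<le> norm z ^ 3"
      using power_decreasing[of 3 4 "norm z"] True by (simp add: eval_nat_numeral mult.assoc)
    have "\<bar>drift_test ?D z * (norm z)\<^sup>2\<bar> \<le> norm ?D * norm z * (norm z)\<^sup>2"
      unfolding abs_mult using abs_drift_test_le(1)[of ?D z] by (intro mult_mono) auto
    then have 1: "\<bar>drift_test ?D z * (norm z)\<^sup>2\<bar> \<le> norm ?D * norm z ^ 3"
      by (simp add: power2_eq_square power3_eq_cube mult.assoc)
    have "\<bar>?qt z\<bar> \<le> M * (norm z)\<^sup>2"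
      using qt[of z] mult_left_mono[OF w(3) M, of z] by linarith
    then have "\<bar>?qt z * (norm z)\<^sup>2\<bar> \<le> M * (norm z)\<^sup>2 * (norm z)\<^sup>2"
      unfolding abs_mult by (intro mult_mono) auto
    also have "\<dots> \<le> M * norm z ^ 3" using mult_left_mono[OF r3 M] by (simp add: mult.assoc)
    finally have 2: "\<bar>?qt z * (norm z)\<^sup>2\<bar> \<le> M * norm z ^ 3" .
    have "f z - drift_test ?D z - (1/2) * ?qt z = (f z - f 0 - ?D \<bullet> z - (1/2) * ?q z)
        + drift_test ?D z * (norm z)\<^sup>2 + (1/2) * (?qt z * (norm z)\<^sup>2)"
      unfolding q_qt using drift[of z] f(2) by (simp add: algebra_simps)
    then have "\<bar>f z - drift_test ?D z - (1/2) * ?qt z\<bar>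
        \<le> L * norm z ^ 3 + norm ?D * norm z ^ 3 + M * norm z ^ 3"
      using L(2)[of z] 1 2 by linarith
    also have "\<dots> \<le> B * norm z ^ 3" using Bf(1) by (simp add: B_def algebra_simps)
    finally show ?thesis using True by (simp add: unit_weight_small)
  next
    case False
    have "\<bar>?qt z\<bar> \<le> M" using qt[of z] mult_left_mono[OF w(2) M, of z] by simp
    then have "\<bar>f z - drift_test ?D z - (1/2) * ?qt z\<bar> \<le> Bf + norm ?D + M"
      using Bf(2)[of z] abs_drift_test_le(2)[of ?D z] M by linarith
    then show ?thesis using False L(1) by (simp add: unit_weight_large B_def)
  qed
  moreover have "0 \<le> B" using L Bf M by (simp add: B_def)
  ultimately show ?thesis by blast
qed

text \<open>A cone of pairs that is monotone and controls jumps, drift and diffusion. The bound for the jumps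
  does not depend on \<open>e\<close>; this is what forces the jump measure to have a first moment.\<close>

locale generator_cone =
  fixes C :: "((real^'d::finite \<Rightarrow> real) \<times> real) set" and Kj Kl Kq :: real
  assumes cone: "convex_cone_pairs C"
    and C_mono: "(g, c) \<in> C \<Longrightarrow> (\<And>z. f z \<le> g z) \<Longrightarrow> (f, c) \<in> C"
    and C_jump: "0 < e \<Longrightarrow> (jump_weight e, Kj) \<in> C"
    and C_drift: "((\<lambda>z. p \<bullet> z), Kl * norm p) \<in> C"
    and C_diffusion: "((\<lambda>z. (norm z)\<^sup>2 / (1 + (norm z)\<^sup>2)), Kq) \<in> C"
begin

abbreviation S :: "(real^'d \<Rightarrow> real) set" where
  "S \<equiv> two_sided_domain C"

lemma C_nonneg: "(g, c) \<in> C \<Longrightarrow> (\<And>z. 0 \<le> g z) \<Longrightarrow> 0 \<le> c"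
  by (rule convex_cone_pairs_zero[OF cone C_mono]) auto

lemma Kj_nonneg: "0 \<le> Kj"
  by (rule C_nonneg[OF C_jump[of 1]]) (auto simp: jump_weight_nonneg)

lemma C_zero: "((\<lambda>z. 0), 0) \<in> C"
  by (rule convex_cone_pairs_origin[OF cone]) (use C_jump[of 1] in auto)

lemma in_S_if_dominated:
  assumes "(g, c) \<in> C" "\<And>z. \<bar>f z\<bar> \<le> g z"
  shows "f \<in> S"
proof -
  have "(f, c) \<in> C" "((\<lambda>z. - f z), c) \<in> C"
    using assms(2) by (intro C_mono[OF assms(1)]; metis abs_le_D1 abs_le_D2)+
  then show ?thesis unfolding two_sided_domain_def by blast
qed

lemma in_S_if_unit_weight:
  assumes "0 \<le> B" "\<And>z. \<bar>f z\<bar> \<le> B * unit_weight z"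
  shows "f \<in> S"
proof (rule in_S_if_dominated)
  show "((\<lambda>z. B * jump_weight 1 z), B * Kj) \<in> C"
    by (rule convex_cone_pairs_scale[OF cone C_jump assms(1)]) simp
  show "\<bar>f z\<bar> \<le> B * jump_weight 1 z" for z
    using assms(2)[of z] mult_left_mono[OF unit_weight_le_jump_weight assms(1), of z] by linarith
qed

text \<open>The difference between \<open>drift_test p\<close> and the linear function of \<open>p\<close> is of third order at \<open>0\<close> and of
  linear growth, hence controlled by the jump bound.\<close>

lemma drift_test_in_C: "(drift_test p, (Kl + Kj) * norm p) \<in> C"
proof -
  have "((\<lambda>z. p \<bullet> z + norm p * jump_weight 1 z), Kl * norm p + norm p * Kj) \<in> C"
    by (intro convex_cone_pairs_add[OF cone] C_drift convex_cone_pairs_scale[OF cone] C_jump) auto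
  then have bound: "((\<lambda>z. p \<bullet> z + norm p * jump_weight 1 z), (Kl + Kj) * norm p) \<in> C"
    by (simp add: algebra_simps)
  show ?thesis
  proof (rule C_mono[OF bound])
  fix z :: "real^'d"
  have "\<bar>(p \<bullet> z) * ((norm z)\<^sup>2 / (1 + (norm z)\<^sup>2))\<bar> \<le> norm p * jump_weight 1 z"
  proof -
    have "norm z * ((norm z)\<^sup>2 / (1 + (norm z)\<^sup>2)) \<le> norm z * 1"
      using one_plus_square_pos[of z] by (intro mult_left_mono) (auto simp: divide_le_eq)
    moreover have "norm z * ((norm z)\<^sup>2 / (1 + (norm z)\<^sup>2)) \<le> norm z * (norm z)\<^sup>2"
      using one_plus_square_pos[of z] by (intro mult_left_mono) (auto simp: divide_le_eq mult_le_cancel_left1)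
    ultimately have le: "norm z * ((norm z)\<^sup>2 / (1 + (norm z)\<^sup>2)) \<le> jump_weight 1 z"
      by (simp add: jump_weight_def power2_eq_square power3_eq_cube mult.assoc)
    have "\<bar>(p \<bullet> z) * ((norm z)\<^sup>2 / (1 + (norm z)\<^sup>2))\<bar>
        = \<bar>p \<bullet> z\<bar> * ((norm z)\<^sup>2 / (1 + (norm z)\<^sup>2))"
      using one_plus_square_pos[of z] by (simp add: abs_mult)
    also have "\<dots> \<le> (norm p * norm z) * ((norm z)\<^sup>2 / (1 + (norm z)\<^sup>2))"
      using one_plus_square_pos[of z] by (intro mult_right_mono Cauchy_Schwarz_ineq2) auto
    also have "\<dots> \<le> norm p * jump_weight 1 z"
      using mult_left_mono[OF le, of "norm p"] by (simp add: mult.assoc)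
    finally show ?thesis .
  qed
  moreover have "drift_test p z = p \<bullet> z - (p \<bullet> z) * ((norm z)\<^sup>2 / (1 + (norm z)\<^sup>2))"
    using one_plus_square_pos[of z] by (simp add: drift_test_def field_simps)
  ultimately show "drift_test p z \<le> p \<bullet> z + norm p * jump_weight 1 z" by linarith
  qed
qed

lemma drift_test_in_S: "drift_test p \<in> S"
proof -
  have "(\<lambda>z. - drift_test p z) = drift_test (- p)" by (auto simp: drift_test_def)
  then show ?thesis
    using drift_test_in_C[of p] drift_test_in_C[of "- p"] unfolding two_sided_domain_def by auto
qed

lemma diffusion_test_in_S: "diffusion_test i j \<in> S"
  by (rule in_S_if_dominated[OF C_diffusion abs_diffusion_test_le])

end

locale dominated_functional = generator_cone C Kj Kl Kq
  for C :: "((real^'d::finite \<Rightarrow> real) \<times> real) set" and Kj Kl Kq :: real +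
  fixes F :: "(real^'d \<Rightarrow> real) \<Rightarrow> real"
  assumes F_add: "f \<in> S \<Longrightarrow> g \<in> S \<Longrightarrow> F (\<lambda>z. f z + g z) = F f + F g"
    and F_scale: "f \<in> S \<Longrightarrow> F (\<lambda>z. a * f z) = a * F f"
    and F_le: "f \<in> S \<Longrightarrow> (f, c) \<in> C \<Longrightarrow> F f \<le> c"
begin

lemma F_nonneg:
  assumes f: "f \<in> S" and "\<And>z. 0 \<le> f z"
  shows "0 \<le> F f"
proof -
  have "((\<lambda>z. - f z), 0) \<in> C" by (rule C_mono[OF C_zero]) (use assms(2) in simp)
  then have "F (\<lambda>z. - f z) \<le> 0" using F_le two_sided_domain_neg[OF f] by blast
  then show ?thesis using F_scale[OF f, of "-1"] by simp
qed

lemma F_diff: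
  assumes "f \<in> S" "g \<in> S"
  shows "F (\<lambda>z. f z - g z) = F f - F g"
  using F_add[OF assms(1) two_sided_domain_neg[OF assms(2)]] F_scale[OF assms(2), of "-1"] by simp

lemma S_diff: "f \<in> S \<Longrightarrow> g \<in> S \<Longrightarrow> (\<lambda>z. f z - g z) \<in> S"
  using two_sided_domain_add[OF cone _ two_sided_domain_neg, of f g] by simp

lemma F_mono:
  assumes "f \<in> S" "g \<in> S" "\<And>z. f z \<le> g z"
  shows "F f \<le> F g"
  using F_nonneg[OF S_diff[OF assms(2,1)]] F_diff[OF assms(2,1)] assms(3) by simp

lemma F_sum:
  assumes "finite I" "\<And>i. i \<in> I \<Longrightarrow> f i \<in> S"
  shows "(\<lambda>z. \<Sum>i\<in>I. a i * f i z) \<in> S" "F (\<lambda>z. \<Sum>i\<in>I. a i * f i z) = (\<Sum>i\<in>I. a i * F (f i))"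
proof -
  have zero: "(\<lambda>z. 0) \<in> S" by (rule in_S_if_dominated[OF C_zero]) simp
  have "(\<lambda>z. \<Sum>i\<in>I. a i * f i z) \<in> S \<and> F (\<lambda>z. \<Sum>i\<in>I. a i * f i z) = (\<Sum>i\<in>I. a i * F (f i))"
    using assms
  proof (induction rule: finite_induct)
    case empty
    then show ?case using zero F_scale[OF zero, of 0] by simp
  next
    case (insert i I)
    have "(\<lambda>z. a i * f i z) \<in> S" "F (\<lambda>z. a i * f i z) = a i * F (f i)"
      using insert.prems[of i] two_sided_domain_scale[OF cone] F_scale by auto
    then show ?case
      using insert F_add[of "\<lambda>z. a i * f i z" "\<lambda>z. \<Sum>i\<in>I. a i * f i z"]
        two_sided_domain_add[OF cone, of "\<lambda>z. a i * f i z" "\<lambda>z. \<Sum>i\<in>I. a i * f i z"] by simp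
  qed
  then show "(\<lambda>z. \<Sum>i\<in>I. a i * f i z) \<in> S" "F (\<lambda>z. \<Sum>i\<in>I. a i * f i z) = (\<Sum>i\<in>I. a i * F (f i))"
    by auto
qed

text \<open>Multiplication by \<open>unit_weight\<close> turns \<open>F\<close> into a functional of finite total mass, with little mass near \<open>0\<close>
  and near \<open>\<infinity>\<close>.\<close>

definition \<Phi> :: "(real^'d \<Rightarrow> real) \<Rightarrow> real" where
  "\<Phi> g = F (\<lambda>z. unit_weight z * g z)"

lemma weighted_in_S:
  assumes "bounded (range g)"
  shows "(\<lambda>z. unit_weight z * g z) \<in> S"
proof -
  obtain B where B: "\<And>z. \<bar>g z\<bar> \<le> B" using assms by (auto simp: bounded_iff)
  show ?thesis
  proof (rule in_S_if_unit_weight)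
    show "0 \<le> B" using B[of 0] by linarith
    show "\<bar>unit_weight z * g z\<bar> \<le> B * unit_weight z" for z
      using mult_left_mono[OF B[of z] unit_weight_nonneg[of z]] unit_weight_nonneg[of z]
      by (simp add: abs_mult mult.commute)
  qed
qed

lemma positive_functional_\<Phi>: "positive_functional \<Phi>"
proof
  fix f g :: "real^'d \<Rightarrow> real" assume "bounded (range f)" "bounded (range g)"
  then show "\<Phi> (\<lambda>x. f x + g x) = \<Phi> f + \<Phi> g"
    unfolding \<Phi>_def by (simp add: distrib_left F_add weighted_in_S)
next
  fix f :: "real^'d \<Rightarrow> real" and c :: real assume "bounded (range f)"
  then show "\<Phi> (\<lambda>x. c * f x) = c * \<Phi> f"
    unfolding \<Phi>_def using F_scale[OF weighted_in_S, of f c] by (simp add: mult.left_commute)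
next
  fix f :: "real^'d \<Rightarrow> real" assume "bounded (range f)" "\<And>x. 0 \<le> f x"
  then show "0 \<le> \<Phi> f"
    unfolding \<Phi>_def by (intro F_nonneg weighted_in_S) (auto simp: unit_weight_nonneg)
qed

text \<open>Near \<open>0\<close> the weight is at most \<open>e\<^sup>2\<close> times \<open>jump_weight e\<close>, and far out it is a small multiple of
  \<open>jump_weight 1\<close>; the functional is bounded on both, uniformly in \<open>e\<close>.\<close>

lemma \<Phi>_tight:
  assumes e: "0 < e"
  shows "\<exists>K. compact K \<and> K \<subseteq> punctured \<and> \<Phi> (indicator (- K)) \<le> e"
proof -
  \<comment> \<open>The shell \<open>1 / R \<le> norm z \<le> R\<close>: each of its two sides contributes at most \<open>Kj / R \<le> e / 2\<close>.\<close>
  define R where "R = max 1 (2 * Kj / e)"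
  have R: "1 \<le> R" "2 * Kj \<le> e * R" using e by (auto simp: R_def max_def field_simps)
  define K :: "(real^'d) set" where "K = cball 0 R - ball 0 (1 / R)"
  let ?h = "\<lambda>z :: real^'d. (1 / R) * jump_weight (1 / R) z + (1 / R) * jump_weight 1 z"
  have "compact K" unfolding K_def by (intro compact_diff) auto
  moreover have "K \<subseteq> punctured" using R by (auto simp: K_def punctured_def)
  moreover have "\<Phi> (indicator (- K)) \<le> e"
  proof -
    have h: "(?h, (1 / R) * Kj + (1 / R) * Kj) \<in> C"
      using R by (intro convex_cone_pairs_add[OF cone] convex_cone_pairs_scale[OF cone] C_jump) auto
    have le: "unit_weight z * indicator (- K) z \<le> ?h z" for z
    proof -
      have nn: "0 \<le> (1 / R) * jump_weight (1 / R) z" "0 \<le> (1 / R) * jump_weight 1 z"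
        using R jump_weight_nonneg[of _ z] by auto
      consider "norm z < 1 / R" | "norm z > R" | "z \<in> K"
        by (force simp: K_def)
      then show ?thesis
      proof cases
        case 1
        have z1: "norm z * R < 1" using 1 R by (simp add: field_simps)
        then have "norm z \<le> 1" using mult_left_mono[OF R(1), of "norm z"] by simp
        have "(norm z * R)\<^sup>2 \<le> 1" using z1 R by (intro power_le_one) auto
        then have "norm z ^ 3 * R\<^sup>2 \<le> norm z"
          using mult_left_mono[of "(norm z * R)\<^sup>2" 1 "norm z"]
          by (simp add: power2_eq_square power3_eq_cube mult_ac)
        then have "jump_weight (1 / R) z = norm z ^ 3 * R\<^sup>2"
          by (simp add: jump_weight_def power_divide)
        then have "(1 / R) * jump_weight (1 / R) z = norm z ^ 3 * R"
          using R by (simp add: power2_eq_square)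
        moreover have "norm z ^ 3 \<le> norm z ^ 3 * R" using R by (simp add: mult_le_cancel_left1)
        ultimately have "unit_weight z \<le> (1 / R) * jump_weight (1 / R) z"
          using \<open>norm z \<le> 1\<close> by (simp add: unit_weight_small)
        moreover have "unit_weight z * indicator (- K) z \<le> unit_weight z"
          using unit_weight_nonneg[of z] by (auto simp: indicator_def)
        ultimately show ?thesis using nn by linarith
      next
        case 2
        then have "1 \<le> norm z" using R by linarith
        then have "jump_weight 1 z = norm z"
          using power_increasing[of 1 3 "norm z"] by (simp add: jump_weight_def)
        moreover have "1 \<le> (1 / R) * norm z" using 2 R by (simp add: field_simps)
        ultimately have "1 \<le> (1 / R) * jump_weight 1 z" by simp
        moreover have "unit_weight z * indicator (- K) z \<le> 1"
          using \<open>1 \<le> norm z\<close> by (auto simp: indicator_def unit_weight_large)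
        ultimately show ?thesis using nn by linarith
      next
        case 3
        then show ?thesis using nn by simp
      qed
    qed
    have b: "bounded (range (indicator (- K) :: real^'d \<Rightarrow> real))"
      by (auto simp: bounded_iff indicator_def intro!: exI[of _ 1])
    have "\<Phi> (indicator (- K)) \<le> (1 / R) * Kj + (1 / R) * Kj"
      unfolding \<Phi>_def by (rule F_le[OF weighted_in_S[OF b] C_mono[OF h le]])
    also have "\<dots> \<le> e" using R by (simp add: field_simps)
    finally show ?thesis .
  qed
  ultimately show ?thesis by blast
qed

text \<open>The measure only has to represent \<open>F\<close> on functions of third order at \<open>0\<close>; on other functions \<open>F\<close> may
  have a part that is concentrated at the origin.\<close>

definition levy_measure :: "(real^'d) measure \<Rightarrow> bool" where
  "levy_measure v \<longleftrightarrow> sets v = sets (restrict_space borel punctured) \<and>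
     (\<forall>f B. continuous_on punctured f \<longrightarrow> (\<forall>z. 0 \<le> f z) \<longrightarrow> (\<forall>z. f z \<le> B * unit_weight z)
       \<longrightarrow> (\<integral>\<^sup>+z. ennreal (f z) \<partial>v) = ennreal (F f))"

lemma levy_measure_exists: "\<exists>v. levy_measure v"
proof -
  have ne: "(punctured :: (real^'d) set) \<noteq> {}"
    unfolding punctured_def by (metis DiffI UNIV_I axis_eq_0_iff empty_iff singletonD zero_neq_one)
  obtain N where N: "finite_measure N" "sets N = sets (restrict_space borel punctured)"
    "\<And>g. continuous_on punctured g \<Longrightarrow> bounded (range g) \<Longrightarrow> integral\<^sup>L N g = \<Phi> g"
    using tight_positive_functional_representation[OF positive_functional_\<Phi> ne \<Phi>_tight] by blast
  interpret N: finite_measure N by (rule N(1))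
  have space_N: "space N = punctured"
    using sets_eq_imp_space_eq[OF N(2)] by (simp add: space_restrict_space)
  have meas: "g \<in> borel_measurable N" if "continuous_on punctured g" for g :: "real^'d \<Rightarrow> real"
    using borel_measurable_continuous_on_restrict[OF that] measurable_cong_sets[OF N(2) refl] by blast
  have inv_cont: "continuous_on punctured (\<lambda>z :: real^'d. 1 / unit_weight z)"
    by (intro continuous_intros continuous_on_unit_weight)
       (auto simp: punctured_def dest!: unit_weight_pos)
  \<comment> \<open>The density undoes the multiplication by \<open>unit_weight\<close> in \<open>\<Phi>\<close>.\<close>
  define v where "v = density N (\<lambda>z. ennreal (1 / unit_weight z))"
  have "(\<integral>\<^sup>+z. ennreal (f z) \<partial>v) = ennreal (F f)"
    if f: "continuous_on punctured f" "\<And>z. 0 \<le> f z" "\<And>z. f z \<le> B * unit_weight z"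
    for f :: "real^'d \<Rightarrow> real" and B
  proof -
    let ?g = "\<lambda>z. f z / unit_weight z"
    have f0: "f 0 = 0" using f(2)[of 0] f(3)[of 0] by (simp add: unit_weight_0)
    have g_cont: "continuous_on punctured ?g"
      using continuous_on_mult[OF f(1) inv_cont] by simp
    have g_le: "?g z \<le> max B 0" for z
    proof (cases "z = 0")
      case False
      then show ?thesis using f(3)[of z] unit_weight_pos[of z] by (simp add: divide_le_eq le_max_iff_disj)
    qed (simp add: f0)
    have g_nonneg: "0 \<le> ?g z" for z by (simp add: f(2) unit_weight_nonneg)
    have g_abs: "norm (?g z) \<le> max B 0" for z
      unfolding real_norm_def abs_of_nonneg[OF g_nonneg] by (rule g_le)
    then have g_bdd: "bounded (range ?g)" unfolding bounded_iff by blast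
    have "(\<integral>\<^sup>+z. ennreal (f z) \<partial>v) = (\<integral>\<^sup>+z. ennreal (1 / unit_weight z) * ennreal (f z) \<partial>N)"
      unfolding v_def using meas[OF inv_cont] meas[OF f(1)] by (intro nn_integral_density) auto
    also have "\<dots> = (\<integral>\<^sup>+z. ennreal (?g z) \<partial>N)"
      using f(2) by (intro nn_integral_cong) (simp add: ennreal_mult'' flip: ennreal_mult'')
    also have "\<dots> = ennreal (integral\<^sup>L N ?g)"
    proof (rule nn_integral_eq_integral)
      show "integrable N ?g"
        by (intro N.integrable_const_bound[of _ "max B 0"] meas[OF g_cont] AE_I2 g_abs)
    qed (use g_nonneg in auto)
    also have "integral\<^sup>L N ?g = \<Phi> ?g" by (rule N(3)[OF g_cont g_bdd])
    also have "\<Phi> ?g = F f"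
    proof -
      have "unit_weight z * ?g z = f z" for z
        using unit_weight_pos[of z] f0 by (cases "z = 0") auto
      then show ?thesis unfolding \<Phi>_def by simp
    qed
    finally show ?thesis .
  qed
  moreover have "sets v = sets (restrict_space borel punctured)" by (simp add: v_def N(2))
  ultimately show ?thesis unfolding levy_measure_def by blast
qed


context
  fixes v assumes v: "levy_measure v"
begin

lemma sets_levy_measure: "sets v = sets (restrict_space borel punctured)"
  using v unfolding levy_measure_def by blast

lemma space_levy_measure: "space v = punctured"
  using sets_eq_imp_space_eq[OF sets_levy_measure] by (simp add: space_restrict_space)

lemma continuous_levy_measurable:
  fixes g :: "real^'d \<Rightarrow> real"
  assumes "continuous_on punctured g"
  shows "g \<in> borel_measurable v"
  using borel_measurable_continuous_on_restrict[OF assms]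
    measurable_cong_sets[OF sets_levy_measure refl] by blast

lemma nn_integral_levy:
  assumes "continuous_on punctured f" "\<And>z. 0 \<le> f z" "\<And>z. f z \<le> B * unit_weight z"
  shows "(\<integral>\<^sup>+z. ennreal (f z) \<partial>v) = ennreal (F f)"
  using v assms unfolding levy_measure_def by blast

lemma integral_levy:
  assumes cont: "continuous_on punctured f" and B: "0 \<le> B" and le: "\<And>z. \<bar>f z\<bar> \<le> B * unit_weight z"
  shows "integral\<^sup>L v f = F f"
proof -
  have part: "integrable v g \<and> integral\<^sup>L v g = F g"
    if g: "continuous_on punctured g" "\<And>z. 0 \<le> g z" "\<And>z. g z \<le> B * unit_weight z" for g
  proof -
    have S: "g \<in> S" using g by (intro in_S_if_unit_weight[OF B]) (simp add: abs_of_nonneg)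
    have nn: "(\<integral>\<^sup>+z. ennreal (g z) \<partial>v) = ennreal (F g)" by (rule nn_integral_levy[OF g])
    have int: "integrable v g"
      using g(2) by (intro integrableI_nn_integral_finite[OF continuous_levy_measurable[OF g(1)] _ nn]) auto
    have "ennreal (integral\<^sup>L v g) = ennreal (F g)"
      using nn_integral_eq_integral[OF int] g(2) nn by simp
    then show ?thesis using int g(2) F_nonneg[OF S g(2)] Bochner_Integration.integral_nonneg[of v g] by simp
  qed
  define fp where "fp z = max (f z) 0" for z
  define fm where "fm z = max (- f z) 0" for z
  have nonneg: "0 \<le> B * unit_weight z" for z
    by (rule mult_nonneg_nonneg[OF B unit_weight_nonneg])
  have fp: "continuous_on punctured fp" "\<And>z. 0 \<le> fp z" "\<And>z. fp z \<le> B * unit_weight z"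
    unfolding fp_def using le nonneg by (auto intro!: continuous_intros cont simp: abs_le_iff)
  have fm: "continuous_on punctured fm" "\<And>z. 0 \<le> fm z" "\<And>z. fm z \<le> B * unit_weight z"
    unfolding fm_def using le nonneg by (auto intro!: continuous_intros cont simp: abs_le_iff)
  have eq: "f = (\<lambda>z. fp z - fm z)" by (auto simp: fp_def fm_def)
  have S: "fp \<in> S" "fm \<in> S"
    using fp fm by (auto intro!: in_S_if_unit_weight[OF B] simp: abs_of_nonneg)
  have "integral\<^sup>L v f = integral\<^sup>L v fp - integral\<^sup>L v fm"
    unfolding eq using part[OF fp] part[OF fm] by simp
  also have "\<dots> = F fp - F fm" using part[OF fp] part[OF fm] by simp
  also have "\<dots> = F f" using F_diff[OF S] eq by simp
  finally show ?thesis .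
qed

text \<open>The truncations of \<open>g\<close> vanish to third order at \<open>0\<close>, are bounded, and converge to \<open>g\<close> off the origin;
  Fatou's lemma gives the claim.\<close>

lemma nn_integral_levy_le:
  fixes g :: "real^'d \<Rightarrow> real"
  assumes cont: "continuous_on punctured g" and nonneg: "\<And>z. 0 \<le> g z"
    and le: "\<And>m::real. 1 \<le> m \<Longrightarrow> F (\<lambda>z. min m (g z) * min 1 ((m * norm z) ^ 3)) \<le> c"
  shows "(\<integral>\<^sup>+z. ennreal (g z) \<partial>v) \<le> ennreal c"
proof -
  define h where "h m z = min m (g z) * min 1 ((m * norm z) ^ 3)" for m :: real and z
  have nn: "(\<integral>\<^sup>+z. ennreal (h m z) \<partial>v) = ennreal (F (h m))" if m: "1 \<le> m" for m
  proof (rule nn_integral_levy)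
    show "continuous_on punctured (h m)"
      unfolding h_def by (intro continuous_intros cont)
    show "0 \<le> h m z" for z unfolding h_def using nonneg m by simp
    \<comment> \<open>One factor \<open>m\<close> from the truncation of \<open>g\<close>, three from the cutoff at the origin.\<close>
    show "h m z \<le> m ^ 4 * unit_weight z" for z
    proof -
      have "min 1 ((m * norm z) ^ 3) \<le> m ^ 3 * unit_weight z"
        using one_le_power[OF m, of 3]
        by (cases "norm z \<le> 1") (auto simp: unit_weight_small unit_weight_large power_mult_distrib)
      then have "min m (g z) * min 1 ((m * norm z) ^ 3) \<le> m * (m ^ 3 * unit_weight z)"
        using m nonneg by (intro mult_mono) auto
      then show ?thesis by (simp add: h_def eval_nat_numeral mult.assoc)
    qed
  qed
  have meas: "(\<lambda>z. ennreal (h m z)) \<in> borel_measurable v" for m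
    unfolding h_def by (intro measurable_compose[OF _ measurable_ennreal] continuous_levy_measurable
        continuous_intros cont)
  have "(\<integral>\<^sup>+z. ennreal (g z) \<partial>v) = (\<integral>\<^sup>+z. liminf (\<lambda>n. ennreal (h (real (Suc n)) z)) \<partial>v)"
  proof (rule nn_integral_cong)
    fix z assume "z \<in> space v"
    then have z: "0 < norm z" by (simp add: space_levy_measure punctured_def)
    obtain N where N: "max (g z) (1 / norm z) < real N" using reals_Archimedean2 by blast
    have "\<forall>\<^sub>F n in sequentially. ennreal (h (real (Suc n)) z) = ennreal (g z)"
    proof (rule eventually_sequentiallyI[of N])
      fix n assume "N \<le> n"
      then have "g z \<le> real (Suc n)" "1 / norm z \<le> real (Suc n)" using N by auto
      then have "g z \<le> real (Suc n)" "1 \<le> (real (Suc n) * norm z) ^ 3"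
        using z by (auto simp: field_simps intro!: one_le_power)
      then show "ennreal (h (real (Suc n)) z) = ennreal (g z)" by (simp add: h_def)
    qed
    then have "(\<lambda>n. ennreal (h (real (Suc n)) z)) \<longlonglongrightarrow> ennreal (g z)" by (rule tendsto_eventually)
    then show "ennreal (g z) = liminf (\<lambda>n. ennreal (h (real (Suc n)) z))"
      by (simp add: lim_imp_Liminf)
  qed
  also have "\<dots> \<le> liminf (\<lambda>n. (\<integral>\<^sup>+z. ennreal (h (real (Suc n)) z) \<partial>v))"
    by (intro nn_integral_liminf meas)
  also have "\<dots> \<le> liminf (\<lambda>n :: nat. ennreal c)"
  proof (intro Liminf_mono always_eventually allI)
    fix n
    have "F (h (real (Suc n))) \<le> c" unfolding h_def by (rule le) simp
    then show "(\<integral>\<^sup>+z. ennreal (h (real (Suc n)) z) \<partial>v) \<le> ennreal c"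
      using nn[of "real (Suc n)"] by (simp add: ennreal_leI)
  qed
  also have "\<dots> = ennreal c" by (simp add: Liminf_const)
  finally show ?thesis .
qed

lemma levy_first_moment: "(\<integral>\<^sup>+z. ennreal (norm z) \<partial>v) \<le> ennreal Kj"
proof (rule nn_integral_levy_le)
  show "continuous_on punctured (norm :: real^'d \<Rightarrow> real)" by (intro continuous_intros)
  fix m :: real assume m: "1 \<le> m"
  let ?g = "\<lambda>z :: real^'d. min m (norm z) * min 1 ((m * norm z) ^ 3)"
  have le: "?g z \<le> jump_weight (1 / m) z" for z
  proof -
    have "?g z \<le> norm z * 1" using m by (intro mult_mono) auto
    moreover have "?g z \<le> norm z * (m * norm z)\<^sup>2"
    proof (intro mult_mono)
      show "min 1 ((m * norm z) ^ 3) \<le> (m * norm z)\<^sup>2"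
      proof (cases "m * norm z \<le> 1")
        case True
        then show ?thesis using m power_decreasing[of 2 3 "m * norm z"] by (simp add: min_def)
      next
        case False
        then have "1 \<le> (m * norm z)\<^sup>2" by (intro one_le_power) simp
        then show ?thesis by simp
      qed
    qed (use m in auto)
    moreover have "norm z * (m * norm z)\<^sup>2 = norm z ^ 3 / (1 / m)\<^sup>2"
      using m by (simp add: power2_eq_square power3_eq_cube field_simps)
    ultimately show ?thesis by (simp add: jump_weight_def)
  qed
  have nonneg: "0 \<le> ?g z" for z using m by simp
  have J: "(jump_weight (1 / m), Kj) \<in> C" using m by (intro C_jump) simp
  have "?g \<in> S" by (rule in_S_if_dominated[OF J]) (use le nonneg in \<open>simp add: abs_of_nonneg\<close>)
  then show "F ?g \<le> Kj" by (rule F_le[OF _ C_mono[OF J le]])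
qed simp

lemma integrable_levy_if_linear_growth:
  fixes f :: "real^'d \<Rightarrow> real"
  assumes "continuous_on punctured f" "0 \<le> L" "\<And>z. \<bar>f z\<bar> \<le> L * norm z"
  shows "integrable v f"
proof -
  have "integrable v (norm :: real^'d \<Rightarrow> real)"
  proof (rule integrableI_bounded)
    show "(norm :: real^'d \<Rightarrow> real) \<in> borel_measurable v"
      by (intro continuous_levy_measurable continuous_intros)
    show "(\<integral>\<^sup>+z. ennreal (norm (norm z)) \<partial>v) < \<infinity>"
      using le_less_trans[OF levy_first_moment ennreal_less_top] by simp
  qed
  then have "integrable v (\<lambda>z. L * norm z)" by simp
  then show ?thesis
  proof (rule Bochner_Integration.integrable_bound)
    show "f \<in> borel_measurable v" by (rule continuous_levy_measurable[OF assms(1)])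
    show "AE z in v. norm (f z) \<le> norm (L * norm z)" using assms(2,3) by simp
  qed
qed


lemma integral_levy_le:
  assumes cont: "continuous_on punctured g" and nonneg: "\<And>z. 0 \<le> g z" and gS: "g \<in> S"
  shows "integral\<^sup>L v g \<le> F g"
proof -
  have "(\<integral>\<^sup>+z. ennreal (g z) \<partial>v) \<le> ennreal (F g)"
  proof (rule nn_integral_levy_le[OF cont nonneg])
    fix m :: real assume m: "1 \<le> m"
    let ?g = "\<lambda>z. min m (g z) * min 1 ((m * norm z) ^ 3)"
    have le: "?g z \<le> g z" for z
      using mult_mono[of "min m (g z)" "g z" "min 1 ((m * norm z) ^ 3)" 1] nonneg[of z] m by simp
    have nn: "0 \<le> ?g z" for z using nonneg[of z] m by simp
    obtain c where c: "(g, c) \<in> C" using gS unfolding two_sided_domain_def by blast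
    have "?g \<in> S" by (rule in_S_if_dominated[OF c]) (use le nn in \<open>simp only: abs_of_nonneg\<close>)
    then show "F ?g \<le> F g" by (rule F_mono[OF _ gS le])
  qed
  then show ?thesis
    using F_nonneg[OF gS nonneg] nonneg
    by (intro integral_real_bounded) auto
qed

text \<open>The parts of \<open>F\<close> concentrated at the origin: what remains of \<open>F\<close> on the test functions after the
  integral against the measure is subtracted.\<close>

definition residual_drift :: "real^'d" where
  "residual_drift = (\<chi> i. F (drift_test (axis i 1)) - integral\<^sup>L v (drift_test (axis i 1)))"

definition residual_diffusion :: "real^'d^'d" where
  "residual_diffusion = (\<chi> i j. F (diffusion_test i j) - integral\<^sup>L v (diffusion_test i j))"

lemma integrable_drift_test: "integrable v (drift_test p)"
  by (rule integrable_levy_if_linear_growth[OF continuous_on_drift_test norm_ge_zero abs_drift_test_le(1)])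

lemma integrable_diffusion_test: "integrable v (diffusion_test i j)"
proof (rule integrable_levy_if_linear_growth[OF continuous_on_diffusion_test, of 1])
  show "\<bar>diffusion_test i j z\<bar> \<le> 1 * norm z" for z
    using abs_diffusion_test_le[of i j z] square_ratio_le[of z] by linarith
qed simp

lemma F_double_sum:
  fixes a :: "'d \<Rightarrow> 'd \<Rightarrow> real"
  shows "(\<lambda>z. \<Sum>i\<in>UNIV. \<Sum>j\<in>UNIV. a i j * diffusion_test i j z) \<in> S"
    "F (\<lambda>z. \<Sum>i\<in>UNIV. \<Sum>j\<in>UNIV. a i j * diffusion_test i j z)
       = (\<Sum>i\<in>UNIV. \<Sum>j\<in>UNIV. a i j * F (diffusion_test i j))"
  using F_sum[of "UNIV :: ('d \<times> 'd) set" "\<lambda>p. diffusion_test (fst p) (snd p)" "\<lambda>p. a (fst p) (snd p)"]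
  by (simp_all add: diffusion_test_in_S sum.cartesian_product case_prod_beta)

lemma integral_double_sum:
  fixes a :: "'d \<Rightarrow> 'd \<Rightarrow> real"
  shows "integrable v (\<lambda>z. \<Sum>i\<in>UNIV. \<Sum>j\<in>UNIV. a i j * diffusion_test i j z)"
    "integral\<^sup>L v (\<lambda>z. \<Sum>i\<in>UNIV. \<Sum>j\<in>UNIV. a i j * diffusion_test i j z)
       = (\<Sum>i\<in>UNIV. \<Sum>j\<in>UNIV. a i j * integral\<^sup>L v (diffusion_test i j))"
  by (simp_all add: integrable_diffusion_test Bochner_Integration.integral_sum)

lemma residual_diffusion_symmetric: "transpose residual_diffusion = residual_diffusion"
proof -
  have "diffusion_test i j = diffusion_test j i" for i j :: 'd
    by (auto simp: diffusion_test_def mult.commute)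
  then show ?thesis by (simp add: residual_diffusion_def transpose_def vec_eq_iff)
qed

text \<open>The quadratic form is \<open>F g - integral\<^sup>L v g\<close> for the nonnegative function
  \<open>g z = (u \<bullet> z)\<^sup>2 / (1 + (norm z)\<^sup>2)\<close>, and the integral never exceeds \<open>F\<close> on nonnegative
  continuous functions.\<close>

lemma residual_diffusion_psd: "0 \<le> u \<bullet> (residual_diffusion *v u)"
proof -
  define g where "g z = (\<Sum>i\<in>UNIV. \<Sum>j\<in>UNIV. (u $ i * u $ j) * diffusion_test i j z)" for z
  have square: "g z = (u \<bullet> z)\<^sup>2 / (1 + (norm z)\<^sup>2)" for z
    by (simp add: g_def diffusion_test_def inner_vec_def power2_eq_square sum_product
        sum_divide_distrib mult_ac)
  have "continuous_on punctured g"
    unfolding g_def by (intro continuous_intros continuous_on_diffusion_test)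
  moreover have "0 \<le> g z" for z
    unfolding square using one_plus_square_pos[of z] by simp
  moreover have "g \<in> S" unfolding g_def by (rule F_double_sum)
  ultimately have "integral\<^sup>L v g \<le> F g" by (rule integral_levy_le)
  moreover have "u \<bullet> (residual_diffusion *v u) = F g - integral\<^sup>L v g"
    unfolding g_def F_double_sum integral_double_sum quadratic_form_sum
    by (simp add: residual_diffusion_def right_diff_distrib sum_subtractf)
  ultimately show ?thesis by simp
qed

text \<open>Up to a remainder of third order at \<open>0\<close>, on which \<open>F\<close> is the integral against \<open>v\<close>, the function \<open>f\<close> is
  a combination of the test functions with the first and second derivatives at \<open>0\<close> as coefficients.\<close>

lemma F_levy_khintchine:
  assumes f: "C_b 3 f" "f 0 = 0"
  shows "f \<in> S"
    "F f = integral\<^sup>L v f + grad f 0 \<bullet> residual_drift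
       + 1/2 * (\<Sum>i\<in>UNIV. \<Sum>j\<in>UNIV. hessian f 0 $ i $ j * residual_diffusion $ i $ j)"
proof -
  let ?D = "grad f 0" and ?H = "hessian f 0"
  define T where "T z = (\<Sum>i\<in>UNIV. ?D $ i * drift_test (axis i 1) z)" for z
  define Q where "Q z = (\<Sum>i\<in>UNIV. \<Sum>j\<in>UNIV. ?H $ i $ j * diffusion_test i j z)" for z
  define R where "R z = f z - drift_test ?D z - (1/2) * Q z" for z
  have T: "T = drift_test ?D"
  proof
    fix z :: "real^'d"
    have "drift_test (axis i 1) z = z $ i / (1 + (norm z)\<^sup>2)" for i
      by (simp add: drift_test_def inner_axis')
    then show "T z = drift_test ?D z"
      by (simp add: T_def drift_test_def inner_vec_def sum_divide_distrib)
  qed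
  have f3: "C_b (Suc 2) f" using f(1) by (simp add: numeral_3_eq_3 numeral_2_eq_2)
  obtain Lf where Lf: "0 \<le> Lf" "\<And>x y. \<bar>f x - f y\<bar> \<le> Lf * norm (x - y)"
    using C_b_lipschitz_bound[OF f3] by blast
  have f_cont: "continuous_on A f" for A
    using C_b_differentiable[OF f3] by (meson differentiable_imp_continuous_on differentiable_on_def
        differentiable_at_withinI)
  obtain B where B: "0 \<le> B" "\<And>z. \<bar>R z\<bar> \<le> B * unit_weight z"
    using taylor_remainder_bound[OF f] unfolding R_def Q_def by blast
  have R_cont: "continuous_on punctured R"
    unfolding R_def Q_def
    by (intro continuous_intros f_cont continuous_on_drift_test continuous_on_diffusion_test)
  have RS: "R \<in> S" by (rule in_S_if_unit_weight[OF B])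
  have QS: "Q \<in> S" "F Q = (\<Sum>i\<in>UNIV. \<Sum>j\<in>UNIV. ?H $ i $ j * F (diffusion_test i j))"
    unfolding Q_def by (rule F_double_sum)+
  have TS: "T \<in> S" "F T = (\<Sum>i\<in>UNIV. ?D $ i * F (drift_test (axis i 1)))"
    unfolding T_def by (rule F_sum; simp add: drift_test_in_S)+
  have QS': "(\<lambda>z. (1/2) * Q z) \<in> S" "F (\<lambda>z. (1/2) * Q z) = (1/2) * F Q"
    by (rule two_sided_domain_scale[OF cone QS(1)], rule F_scale[OF QS(1)])
  have RQ: "(\<lambda>z. R z + (1/2) * Q z) \<in> S" "F (\<lambda>z. R z + (1/2) * Q z) = F R + (1/2) * F Q"
    by (rule two_sided_domain_add[OF cone RS QS'(1)]) (unfold F_add[OF RS QS'(1)] QS'(2), rule refl)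
  have eq: "f = (\<lambda>z. (R z + (1/2) * Q z) + T z)" by (auto simp: R_def T)
  show "f \<in> S" unfolding eq by (rule two_sided_domain_add[OF cone RQ(1) TS(1)])
  have F_f: "F f = F R + (1/2) * F Q + F T"
  proof -
    have "F f = F (\<lambda>z. (R z + (1/2) * Q z) + T z)" by (rule arg_cong[OF eq])
    also have "\<dots> = F R + (1/2) * F Q + F T" unfolding F_add[OF RQ(1) TS(1)] RQ(2) ..
    finally show ?thesis .
  qed
  have f_int: "integrable v f"
    by (rule integrable_levy_if_linear_growth[OF f_cont Lf(1)]) (use Lf(2)[of _ 0] f(2) in simp)
  have Q_int: "integrable v Q"
    "integral\<^sup>L v Q = (\<Sum>i\<in>UNIV. \<Sum>j\<in>UNIV. ?H $ i $ j * integral\<^sup>L v (diffusion_test i j))"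
    unfolding Q_def by (rule integral_double_sum)+
  have T_int: "integrable v T"
    "integral\<^sup>L v T = (\<Sum>i\<in>UNIV. ?D $ i * integral\<^sup>L v (drift_test (axis i 1)))"
    unfolding T_def by (simp_all add: integrable_drift_test)
  have "F R = integral\<^sup>L v R" by (rule integral_levy[OF R_cont B, symmetric])
  also have "\<dots> = integral\<^sup>L v (\<lambda>z. f z - T z - (1/2) * Q z)"
    by (rule arg_cong[of _ _ "integral\<^sup>L v"]) (auto simp: R_def T)
  also have "\<dots> = integral\<^sup>L v f - integral\<^sup>L v T - (1/2) * integral\<^sup>L v Q"
    using f_int Q_int(1) T_int(1) by simp
  finally have "F f = integral\<^sup>L v f + (F T - integral\<^sup>L v T) + 1/2 * (F Q - integral\<^sup>L v Q)"
    using F_f by (simp add: algebra_simps)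
  also have "F T - integral\<^sup>L v T = ?D \<bullet> residual_drift"
    unfolding TS(2) T_int(2) by (simp add: inner_vec_def residual_drift_def right_diff_distrib sum_subtractf)
  also have "F Q - integral\<^sup>L v Q
      = (\<Sum>i\<in>UNIV. \<Sum>j\<in>UNIV. ?H $ i $ j * residual_diffusion $ i $ j)"
    unfolding QS(2) Q_int(2) by (simp add: residual_diffusion_def right_diff_distrib sum_subtractf)
  finally show "F f = integral\<^sup>L v f + ?D \<bullet> residual_drift
       + 1/2 * (\<Sum>i\<in>UNIV. \<Sum>j\<in>UNIV. ?H $ i $ j * residual_diffusion $ i $ j)" .
qed

lemma norm_residual_drift_le: "norm residual_drift \<le> real CARD('d) * (Kl + 2 * Kj)"
proof -
  have "\<bar>residual_drift $ i\<bar> \<le> Kl + 2 * Kj" for i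
  proof -
    let ?T = "drift_test (axis i 1)"
    have "F ?T \<le> Kl + Kj" using F_le[OF drift_test_in_S drift_test_in_C, of "axis i 1"] by simp
    moreover have "- F ?T \<le> Kl + Kj"
    proof -
      have "F (drift_test (- axis i 1)) \<le> Kl + Kj"
        using F_le[OF drift_test_in_S drift_test_in_C, of "- axis i 1"] by simp
      moreover have "drift_test (- axis i 1) = (\<lambda>z. (-1) * ?T z)" by (auto simp: drift_test_def)
      ultimately show ?thesis using F_scale[OF drift_test_in_S, of "-1" "axis i 1"] by simp
    qed
    moreover have "\<bar>integral\<^sup>L v ?T\<bar> \<le> Kj"
    proof -
      have "ennreal (norm (integral\<^sup>L v ?T)) \<le> (\<integral>\<^sup>+z. ennreal (norm (?T z)) \<partial>v)"
        by (rule integral_norm_bound_ennreal[OF integrable_drift_test])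
      also have "\<dots> \<le> (\<integral>\<^sup>+z. ennreal (norm z) \<partial>v)"
        using abs_drift_test_le(1)[of "axis i 1"] by (intro nn_integral_mono ennreal_leI) simp
      also have "\<dots> \<le> ennreal Kj" by (rule levy_first_moment)
      finally show ?thesis using Kj_nonneg by simp
    qed
    ultimately show ?thesis by (simp add: residual_drift_def abs_le_iff)
  qed
  then have "(\<Sum>i\<in>UNIV. \<bar>residual_drift $ i\<bar>) \<le> (\<Sum>i\<in>(UNIV :: 'd set). Kl + 2 * Kj)"
    by (intro sum_mono)
  then show ?thesis using norm_le_l1_cart[of residual_drift] by simp
qed

lemma trace_residual_diffusion_le: "trace residual_diffusion \<le> real CARD('d) * Kq"
proof -
  have "residual_diffusion $ i $ i \<le> Kq" for i
  proof -
    have nonneg: "0 \<le> diffusion_test i i z" for z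
      using one_plus_square_pos[of z] by (simp add: diffusion_test_def)
    have "diffusion_test i i z \<le> (norm z)\<^sup>2 / (1 + (norm z)\<^sup>2)" for z
      using abs_diffusion_test_le[of i i z] by linarith
    then have "F (diffusion_test i i) \<le> Kq"
      by (rule F_le[OF diffusion_test_in_S C_mono[OF C_diffusion]])
    moreover have "0 \<le> integral\<^sup>L v (diffusion_test i i)"
      using nonneg by (intro Bochner_Integration.integral_nonneg)
    ultimately show ?thesis by (simp add: residual_diffusion_def)
  qed
  then have "trace residual_diffusion \<le> (\<Sum>i\<in>(UNIV :: 'd set). Kq)"
    unfolding trace_def by (intro sum_mono)
  then show ?thesis by simp
qed

end

theorem levy_khintchine_representation:
  obtains v q and Q :: "real^'d^'d" where
    "sets v = sets (restrict_space borel (UNIV - {0}))"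
    "(\<integral>\<^sup>+z. ennreal (norm z) \<partial>v) + ennreal (norm q) + ennreal (trace (Q ** transpose Q))
       \<le> ennreal Kj + ennreal (real CARD('d) * (Kl + 2 * Kj)) + ennreal (real CARD('d) * Kq)"
    "\<And>f. C_b 3 f \<Longrightarrow> f 0 = 0 \<Longrightarrow> f \<in> S \<and>
       F f = integral\<^sup>L v f + grad f 0 \<bullet> q + 1/2 * trace (hessian f 0 ** (Q ** transpose Q))"
proof -
  obtain v where v: "levy_measure v" using levy_measure_exists by blast
  obtain Q :: "real^'d^'d" where Q: "Q ** transpose Q = residual_diffusion v"
    using psd_factorization[OF residual_diffusion_symmetric[OF v] residual_diffusion_psd[OF v]] by blast
  show thesis
  proof (rule that[of v "residual_drift v" Q])
    show "sets v = sets (restrict_space borel (UNIV - {0}))"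
      using sets_levy_measure[OF v] by (simp add: punctured_def)
    show "(\<integral>\<^sup>+z. ennreal (norm z) \<partial>v) + ennreal (norm (residual_drift v))
        + ennreal (trace (Q ** transpose Q))
       \<le> ennreal Kj + ennreal (real CARD('d) * (Kl + 2 * Kj)) + ennreal (real CARD('d) * Kq)"
      unfolding Q by (intro add_mono levy_first_moment[OF v] ennreal_leI
          norm_residual_drift_le[OF v] trace_residual_diffusion_le[OF v])
    fix f :: "real^'d \<Rightarrow> real" assume f: "C_b 3 f" "f 0 = 0"
    have symm: "residual_diffusion v $ j $ i = residual_diffusion v $ i $ j" for i j
    proof -
      have "transpose (residual_diffusion v) $ i $ j = residual_diffusion v $ i $ j"
        by (simp only: residual_diffusion_symmetric[OF v])
      then show ?thesis by (simp add: transpose_def)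
    qed
    have "trace (hessian f 0 ** residual_diffusion v)
        = (\<Sum>i\<in>UNIV. \<Sum>j\<in>UNIV. hessian f 0 $ i $ j * residual_diffusion v $ j $ i)"
      by (simp add: trace_def matrix_matrix_mult_def)
    then have tr: "trace (hessian f 0 ** residual_diffusion v)
        = (\<Sum>i\<in>UNIV. \<Sum>j\<in>UNIV. hessian f 0 $ i $ j * residual_diffusion v $ i $ j)"
      by (simp only: symm)
    show "f \<in> S \<and> F f = integral\<^sup>L v f + grad f 0 \<bullet> residual_drift v
        + 1/2 * trace (hessian f 0 ** (Q ** transpose Q))"
      unfolding Q tr by (intro conjI F_levy_khintchine[OF v f])
  qed
qed

end

section \<open>The generator as a supremum\<close>

lemma eventually_at_right_0I:
  fixes T :: real
  assumes "0 < T" "\<And>t. 0 < t \<Longrightarrow> t \<le> T \<Longrightarrow> Q t"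
  shows "\<forall>\<^sub>F t in at_right 0. Q t"
  unfolding eventually_at_right_field using assms less_imp_le by blast

lemma eventually_at_right_0_pos: "\<forall>\<^sub>F t :: real in at_right 0. 0 < t"
  by (rule eventually_at_right_0I[of 1]) auto

lemma jump_weight_lipschitz:
  assumes e: "0 < e"
  shows "\<bar>jump_weight e x - jump_weight e y\<bar> \<le> 3 * norm (x - y)"
proof -
  define w where "w r = min r (r ^ 3 / e\<^sup>2)" for r :: real
  have small: "w r = r ^ 3 / e\<^sup>2" if "0 \<le> r" "r \<le> e" for r
  proof -
    have "r * r\<^sup>2 \<le> r * e\<^sup>2" using that by (intro mult_left_mono power_mono) auto
    then show ?thesis using e by (simp add: w_def min_def field_simps power2_eq_square power3_eq_cube)
  qed
  have large: "w r = r" if "e \<le> r" for r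
  proof -
    have "r * e\<^sup>2 \<le> r * r\<^sup>2" using that e by (intro mult_left_mono power_mono) auto
    then have "r \<le> r ^ 3 / e\<^sup>2" using e by (simp add: pos_le_divide_eq power2_eq_square power3_eq_cube)
    then show ?thesis by (simp add: w_def)
  qed
  have step_small: "0 \<le> w r - w s \<and> w r - w s \<le> 3 * (r - s)" if "0 \<le> s" "s \<le> r" "r \<le> e" for r s
  proof -
    have eq: "w r - w s = (r - s) * ((r * r + r * s + s * s) / e\<^sup>2)"
      using that by (simp add: small power3_eq_cube algebra_simps diff_divide_distrib add_divide_distrib)
    have "r * r + r * s + s * s \<le> e * e + e * e + e * e"
      using that by (intro add_mono mult_mono) auto
    then have "(r * r + r * s + s * s) / e\<^sup>2 \<le> 3" using e by (simp add: divide_le_eq power2_eq_square)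
    moreover have "0 \<le> (r * r + r * s + s * s) / e\<^sup>2" using that by simp
    ultimately show ?thesis
      unfolding eq using that mult_left_mono[of "(r * r + r * s + s * s) / e\<^sup>2" 3 "r - s"] by simp
  qed
  have step: "0 \<le> w r - w s \<and> w r - w s \<le> 3 * (r - s)" if "0 \<le> s" "s \<le> r" for r s
  proof -
    consider "r \<le> e" | "s \<le> e" "e \<le> r" | "e \<le> s" by linarith
    then show ?thesis
    proof cases
      case 1
      then show ?thesis using step_small that by blast
    next
      case 2
      have "0 \<le> w e - w s" "w e - w s \<le> 3 * (e - s)" using step_small[of s e] that 2 by auto
      moreover have "w r - w s = (r - e) + (w e - w s)" using 2 by (simp add: large)
      ultimately show ?thesis using 2 by auto
    next
      case 3
      then show ?thesis using that by (simp add: large)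
    qed
  qed
  have "\<bar>w (norm x) - w (norm y)\<bar> \<le> 3 * \<bar>norm x - norm y\<bar>"
    using step[of "norm x" "norm y"] step[of "norm y" "norm x"]
    by (cases "norm x \<le> norm y") (auto simp: abs_if)
  also have "\<dots> \<le> 3 * norm (x - y)" using norm_triangle_ineq3[of x y] by simp
  finally show ?thesis by (simp add: w_def jump_weight_def)
qed

lemma C_Lip_jump_weight: "0 < e \<Longrightarrow> C_Lip (jump_weight e)"
  by (rule C_LipI[OF jump_weight_lipschitz])

locale levy_semigroup = sublinear_convolution_semigroup P
  for P :: "real \<Rightarrow> (real^'d::finite \<Rightarrow> real) \<Rightarrow> real" +
  fixes Kj :: real
  assumes P_jump: "0 < e \<Longrightarrow> \<forall>\<^sub>F t in at_right 0. P t (jump_weight e) \<le> Kj * t"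
begin

text \<open>The cone of the functional that sends \<open>f\<close> to the least growth rate at time \<open>0\<close> of a Lipschitz majorant
  of \<open>f\<close>. Admitting all functions below a Lipschitz function provides the indicator functions that the
  construction of the measure needs.\<close>

definition growth_cone :: "((real^'d \<Rightarrow> real) \<times> real) set" where
  "growth_cone = {(f, c). \<exists>g. C_Lip g \<and> (\<forall>z. f z \<le> g z) \<and> (\<forall>\<^sub>F t in at_right 0. P t g \<le> c * t)}"

lemma growth_coneI:
  "C_Lip g \<Longrightarrow> (\<And>z. f z \<le> g z) \<Longrightarrow> \<forall>\<^sub>F t in at_right 0. P t g \<le> c * t \<Longrightarrow> (f, c) \<in> growth_cone"
  unfolding growth_cone_def by blast

lemma convex_growth_cone: "convex_cone_pairs growth_cone"
proof (rule convex_cone_pairsI)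
  fix f1 f2 c1 c2 assume "(f1, c1) \<in> growth_cone" "(f2, c2) \<in> growth_cone"
  then obtain g1 g2 where g: "C_Lip g1" "\<And>z. f1 z \<le> g1 z" "\<forall>\<^sub>F t in at_right 0. P t g1 \<le> c1 * t"
    "C_Lip g2" "\<And>z. f2 z \<le> g2 z" "\<forall>\<^sub>F t in at_right 0. P t g2 \<le> c2 * t"
    unfolding growth_cone_def by blast
  show "(\<lambda>z. f1 z + f2 z, c1 + c2) \<in> growth_cone"
  proof (rule growth_coneI[OF C_Lip_add[OF g(1,4)]])
    show "f1 z + f2 z \<le> g1 z + g2 z" for z by (intro add_mono g)
    show "\<forall>\<^sub>F t in at_right 0. P t (\<lambda>z. g1 z + g2 z) \<le> (c1 + c2) * t"
      using g(3,6) eventually_at_right_0_pos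
    proof eventually_elim
      case (elim t)
      then show ?case using P_add_le[OF elim(3) g(1,4)] by (simp add: distrib_right)
    qed
  qed
next
  fix f c a assume "(f, c) \<in> growth_cone" and a: "0 \<le> (a :: real)"
  then obtain g where g: "C_Lip g" "\<And>z. f z \<le> g z" "\<forall>\<^sub>F t in at_right 0. P t g \<le> c * t"
    unfolding growth_cone_def by blast
  show "(\<lambda>z. a * f z, a * c) \<in> growth_cone"
  proof (rule growth_coneI[OF C_Lip_scale[OF g(1)]])
    show "a * f z \<le> a * g z" for z by (intro mult_left_mono g a)
    show "\<forall>\<^sub>F t in at_right 0. P t (\<lambda>z. a * g z) \<le> a * c * t"
      using g(3) eventually_at_right_0_pos
    proof eventually_elim
      case (elim t)
      then show ?case using P_scale[OF elim(2) g(1) a] mult_left_mono[OF elim(1) a] by (simp add: mult.assoc)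
    qed
  qed
next
  fix c assume "(\<lambda>z. 0, c) \<in> growth_cone"
  then obtain g where g: "C_Lip g" "\<And>z. 0 \<le> g z" "\<forall>\<^sub>F t in at_right 0. P t g \<le> c * t"
    unfolding growth_cone_def by blast
  have "\<forall>\<^sub>F t :: real in at_right 0. 0 \<le> c"
    using g(3) eventually_at_right_0_pos
  proof eventually_elim
    case (elim t)
    then have "0 \<le> c * t" using P_nonneg[OF elim(2) g(1,2)] by linarith
    then show ?case using elim(2) by (simp add: zero_le_mult_iff)
  qed
  then show "0 \<le> c" by simp
qed

lemma generator_cone_growth_cone: "\<exists>Kl Kq. generator_cone growth_cone Kj Kl Kq"
proof -
  obtain Kl Tl where "0 \<le> Kl" and Kl: "0 < Tl" "\<And>p t. 0 < t \<Longrightarrow> t \<le> Tl \<Longrightarrow> \<bar>P t (\<lambda>y. p \<bullet> y)\<bar> \<le> Kl * norm p * t"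
    using P_inner_bound by blast
  obtain Kh Th where "0 \<le> Kh" and Kh: "0 < Th" "\<And>t. 0 < t \<Longrightarrow> t \<le> Th \<Longrightarrow> P t huber_excess \<le> Kh * t"
    using P_huber_excess_bound by blast
  have "generator_cone growth_cone Kj Kl (4 * Kh)"
  proof
    show "convex_cone_pairs growth_cone" by (rule convex_growth_cone)
    show "(f, c) \<in> growth_cone" if "(g, c) \<in> growth_cone" "\<And>z. f z \<le> g z" for f g c
      using that unfolding growth_cone_def by (blast intro: order_trans)
    show "(jump_weight e, Kj) \<in> growth_cone" if "0 < e" for e
      by (rule growth_coneI[OF C_Lip_jump_weight[OF that] order_refl P_jump[OF that]])
    show "(\<lambda>z. p \<bullet> z, Kl * norm p) \<in> growth_cone" for p
    proof (rule growth_coneI[OF C_Lip_inner order_refl])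
      show "\<forall>\<^sub>F t in at_right 0. P t (\<lambda>z. p \<bullet> z) \<le> Kl * norm p * t"
        using Kl(2) by (intro eventually_at_right_0I[OF Kl(1)]) (metis abs_le_D1)
    qed
    show "(\<lambda>z :: real^'d. (norm z)\<^sup>2 / (1 + (norm z)\<^sup>2), 4 * Kh) \<in> growth_cone"
    proof (rule growth_coneI[OF C_Lip_scale[OF C_Lip_huber_excess, of 4]])
      fix z :: "real^'d"
      let ?v = "(norm z)\<^sup>2 / (1 + (norm z)\<^sup>2)"
      have "?v \<le> 2 * 1 * norm z" using square_ratio_le[of z] norm_ge_zero[of z] by linarith
      moreover have "?v \<le> 1 * (norm z)\<^sup>2" using one_plus_square_pos[of z] by (simp add: pos_divide_le_eq mult_le_cancel_left1)
      ultimately have "?v \<le> 4 * 1 * huber_excess z"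
        by (intro le_huber_excess) simp_all
      then show "?v \<le> 4 * huber_excess z" by simp
    next
      show "\<forall>\<^sub>F t in at_right 0. P t (\<lambda>z. 4 * huber_excess z) \<le> 4 * Kh * t"
        using Kh(2) P_scale[OF _ C_Lip_huber_excess, of _ 4]
        by (intro eventually_at_right_0I[OF Kh(1)]) auto
    qed
  qed
  then show ?thesis by blast
qed

text \<open>The hypotheses of \<open>generator_exists\<close> are Taylor estimates. For \<open>f\<close> they use second derivatives; for the
  differences of translates, with a constant proportional to \<open>norm (x - y)\<close>, third derivatives.\<close>

lemma C_b_generator_exists:
  assumes f: "C_b 3 f" "f 0 = 0"
  shows "\<exists>l. ((\<lambda>t. P t f / t) \<longlongrightarrow> l) (at_right 0)"
proof -
  have f3: "C_b (Suc (Suc (Suc 0))) f" using f(1) by (simp add: numeral_3_eq_3)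
  obtain L0 where L0: "0 \<le> L0" "\<And>x y. \<bar>f x - f y\<bar> \<le> L0 * norm (x - y)"
    using C_b_lipschitz_bound[OF f3] by blast
  obtain L1 where L1: "0 \<le> L1" "\<And>x z. \<bar>f (x + z) - f x - grad f x \<bullet> z\<bar> \<le> L1 * (norm z)\<^sup>2"
    using C_b_first_order_remainder[OF f3] by blast
  obtain L2 where L2: "0 \<le> L2" "\<And>x y. norm (grad f x - grad f y) \<le> L2 * norm (x - y)"
    using C_b_grad_lipschitz[OF f3] by blast
  obtain L3 where L3: "0 \<le> L3"
    "\<And>x y w. \<bar>(f (x + w) - f x) - (f (y + w) - f y)\<bar> \<le> L3 * norm (x - y) * norm w"
    using C_b_second_difference[OF f3] by blast
  obtain L4 where L4: "0 \<le> L4"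
    "\<And>x y z. \<bar>(f (x + z) - f x) - (f (y + z) - f y) - (grad f x - grad f y) \<bullet> z\<bar>
       \<le> L4 * norm (x - y) * (norm z)\<^sup>2"
    using C_b_remainder_difference[OF f3] by blast
  define M where "M = norm (grad f 0) + L0 + L1 + L2 + L3 + L4"
  have M: "0 \<le> M" "norm (grad f 0) \<le> M" "L0 \<le> M" "L1 \<le> M" "L2 \<le> M" "L3 \<le> M" "L4 \<le> M"
    using L0(1) L1(1) L2(1) L3(1) L4(1) by (auto simp: M_def)
  have lip: "C_Lip f" by (rule C_b_imp_C_Lip[OF f3])
  show ?thesis
  proof (rule generator_exists[OF lip f(2) M(1)])
    show "first_order_bound M (grad f 0) f"
      unfolding first_order_bound_def
    proof (intro conjI allI lip M(2))
      fix z :: "real^'d"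
      show "\<bar>f z\<bar> \<le> M * norm z"
        using L0(2)[of z 0] f(2) mult_right_mono[OF M(3), of "norm z"] by simp
      show "\<bar>f z - grad f 0 \<bullet> z\<bar> \<le> M * (norm z)\<^sup>2"
        using L1(2)[of 0 z] f(2) mult_right_mono[OF M(4), of "(norm z)\<^sup>2"] by simp
    qed
    fix x y :: "real^'d"
    have "first_order_bound (M * norm (x - y)) (grad f x - grad f y)
        (\<lambda>z. (f (x + z) - f x) - (f (y + z) - f y))"
      unfolding first_order_bound_def
    proof (intro conjI allI)
      show "C_Lip (\<lambda>z. (f (x + z) - f x) - (f (y + z) - f y))"
        by (intro C_Lip_diff C_Lip_shift[OF lip] C_Lip_const)
      show "norm (grad f x - grad f y) \<le> M * norm (x - y)"
        using L2(2)[of x y] mult_right_mono[OF M(5), of "norm (x - y)"] by simp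
      fix z :: "real^'d"
      have "L3 * norm (x - y) * norm z \<le> M * norm (x - y) * norm z"
        by (intro mult_right_mono M) auto
      then show "\<bar>(f (x + z) - f x) - (f (y + z) - f y)\<bar> \<le> M * norm (x - y) * norm z"
        using L3(2)[of x z y] by linarith
      have "L4 * norm (x - y) * (norm z)\<^sup>2 \<le> M * norm (x - y) * (norm z)\<^sup>2"
        by (intro mult_right_mono M) auto
      then show "\<bar>(f (x + z) - f x) - (f (y + z) - f y) - (grad f x - grad f y) \<bullet> z\<bar>
          \<le> M * norm (x - y) * (norm z)\<^sup>2"
        using L4(2)[of x z y] by linarith
    qed
    then show "\<exists>p. first_order_bound (M * norm (x - y)) p (\<lambda>z. (f (x + z) - f x) - (f (y + z) - f y))"
      by blast
  qed
qed

definition generator :: "(real^'d \<Rightarrow> real) \<Rightarrow> real" where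
  "generator f = Lim (at_right 0) (\<lambda>t. P t f / t)"

lemma generator_tendsto:
  assumes "C_b 3 f" "f 0 = 0"
  shows "((\<lambda>t. P t f / t) \<longlongrightarrow> generator f) (at_right 0)"
proof -
  obtain l where l: "((\<lambda>t. P t f / t) \<longlongrightarrow> l) (at_right 0)" using C_b_generator_exists[OF assms] by blast
  have "generator f = l" unfolding generator_def by (rule tendsto_Lim[OF _ l]) simp
  with l show ?thesis by simp
qed

lemma in_growth_cone_above_generator:
  assumes f: "C_b 3 f" "f 0 = 0" and c: "generator f < c"
  shows "(f, c) \<in> growth_cone"
proof (rule growth_coneI)
  show "C_Lip f" using C_b_imp_C_Lip[of 2 f] f(1) by (simp add: numeral_3_eq_3 numeral_2_eq_2)
  show "\<forall>\<^sub>F t in at_right 0. P t f \<le> c * t"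
    using order_tendstoD(2)[OF generator_tendsto[OF f] c] eventually_at_right_0_pos
  proof eventually_elim
    case (elim t)
    then show ?case by (simp add: pos_divide_less_eq)
  qed
qed simp

lemma generator_le_growth_cone:
  assumes f: "C_b 3 f" "f 0 = 0" and c: "(f, c) \<in> growth_cone"
  shows "generator f \<le> c"
proof -
  obtain g where g: "C_Lip g" "\<And>z. f z \<le> g z" "\<forall>\<^sub>F t in at_right 0. P t g \<le> c * t"
    using c unfolding growth_cone_def by blast
  have lip: "C_Lip f" using C_b_imp_C_Lip[of 2 f] f(1) by (simp add: numeral_3_eq_3 numeral_2_eq_2)
  have "\<forall>\<^sub>F t in at_right 0. P t f / t \<le> c"
    using g(3) eventually_at_right_0_pos
  proof eventually_elim
    case (elim t)
    then show ?case using P_mono[OF elim(2) lip g(1,2)] by (simp add: pos_divide_le_eq)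
  qed
  then show ?thesis by (intro tendsto_upperbound[OF generator_tendsto[OF f]]) auto
qed

abbreviation levy_khintchine_value ::
    "(real^'d) measure \<times> (real^'d) \<times> (real^'d^'d) \<Rightarrow> (real^'d \<Rightarrow> real) \<Rightarrow> real" where
  "levy_khintchine_value u f \<equiv> (case u of (v, q, Q) \<Rightarrow>
     integral\<^sup>L v f + grad f 0 \<bullet> q + 1/2 * trace (hessian f 0 ** (Q ** transpose Q)))"

abbreviation levy_khintchine_size :: "(real^'d) measure \<times> (real^'d) \<times> (real^'d^'d) \<Rightarrow> ennreal" where
  "levy_khintchine_size u \<equiv> (case u of (v, q, Q) \<Rightarrow>
     (\<integral>\<^sup>+z. ennreal (norm z) \<partial>v) + ennreal (norm q) + ennreal (trace (Q ** transpose Q)))"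

text \<open>\<open>U\<close> consists of all triples of bounded size whose value is below the generator for every test function.
  For a given \<open>f0\<close> the Hahn-Banach theorem yields a linear functional below the generator that touches
  it at \<open>f0\<close>, and the triple of this functional belongs to \<open>U\<close>, so the supremum is attained. The bound on
  the size depends only on the constants of the cone.\<close>

theorem generator_representation:
  obtains U :: "((real^'d) measure \<times> (real^'d) \<times> (real^'d^'d)) set" where
    "U \<noteq> {}"
    "\<And>v q Q. (v, q, Q) \<in> U \<Longrightarrow> sets v = sets (restrict_space borel (UNIV - {0}))"
    "(SUP u\<in>U. levy_khintchine_size u) < \<infinity>"
    "\<And>f. C_b 3 f \<Longrightarrow> f 0 = 0 \<Longrightarrow> generator f = (SUP u\<in>U. levy_khintchine_value u f)"
proof -
  obtain Kl Kq where gc: "generator_cone growth_cone Kj Kl Kq"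
    using generator_cone_growth_cone by blast
  interpret generator_cone growth_cone Kj Kl Kq by (rule gc)
  define B where "B = ennreal Kj + ennreal (real CARD('d) * (Kl + 2 * Kj)) + ennreal (real CARD('d) * Kq)"
  define U where "U = {(v, q, Q). sets v = sets (restrict_space borel (UNIV - {0})) \<and>
      levy_khintchine_size (v, q, Q) \<le> B \<and>
      (\<forall>f. C_b 3 f \<longrightarrow> f 0 = 0 \<longrightarrow> levy_khintchine_value (v, q, Q) f \<le> generator f)}"
  have attained: "\<exists>u\<in>U. levy_khintchine_value u f0 = generator f0" if f0: "C_b 3 f0" "f0 0 = 0" for f0
  proof -
    have "growth_cone \<noteq> {}" using C_zero by blast
    then obtain F where F:
      "\<And>f g. f \<in> S \<Longrightarrow> g \<in> S \<Longrightarrow> F (\<lambda>x. f x + g x) = F f + F g"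
      "\<And>f a. f \<in> S \<Longrightarrow> F (\<lambda>x. a * f x) = a * F f"
      "\<And>f r. f \<in> S \<Longrightarrow> (f, r) \<in> growth_cone \<Longrightarrow> F f \<le> r"
      "f0 \<in> S \<Longrightarrow> generator f0 \<le> F f0"
      using hahn_banach_cone[OF convex_growth_cone _ generator_le_growth_cone[OF f0]] by blast
    interpret dominated_functional growth_cone Kj Kl Kq F
      by unfold_locales (fact F(1) F(2) F(3))+
    obtain v q and Q :: "real^'d^'d" where vqQ:
      "sets v = sets (restrict_space borel (UNIV - {0}))"
      "levy_khintchine_size (v, q, Q) \<le> B"
      "\<And>f. C_b 3 f \<Longrightarrow> f 0 = 0 \<Longrightarrow> f \<in> S \<and> F f = levy_khintchine_value (v, q, Q) f"
      using levy_khintchine_representation unfolding B_def prod.case by blast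
    have le: "F f \<le> generator f" if f: "C_b 3 f" "f 0 = 0" for f
    proof (rule dense_ge)
      fix c assume "generator f < c"
      then show "F f \<le> c" using F(3) vqQ(3)[OF f] in_growth_cone_above_generator[OF f] by blast
    qed
    have "(v, q, Q) \<in> U" unfolding U_def using vqQ le by force
    moreover have "levy_khintchine_value (v, q, Q) f0 = generator f0"
      using le[OF f0] F(4) vqQ(3)[OF f0] by force
    ultimately show ?thesis by blast
  qed
  show thesis
  proof (rule that[of U])
    have "partial_derivative i (\<lambda>x. 0 :: real) = (\<lambda>x. 0)" for i :: 'd
      by (auto simp: partial_derivative_def)
    then have "C_b k (\<lambda>x :: real^'d. 0)" for k by (induction k) auto
    from attained[OF this] show "U \<noteq> {}" by auto
    show "sets v = sets (restrict_space borel (UNIV - {0}))" if "(v, q, Q) \<in> U" for v q Q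
      using that unfolding U_def by blast
    have "(SUP u\<in>U. levy_khintchine_size u) \<le> B"
      unfolding U_def by (intro SUP_least) auto
    moreover have "B < \<infinity>" by (simp add: B_def)
    ultimately show "(SUP u\<in>U. levy_khintchine_size u) < \<infinity>" by (rule le_less_trans)
    fix f :: "real^'d \<Rightarrow> real" assume f: "C_b 3 f" "f 0 = 0"
    have "(SUP u\<in>U. levy_khintchine_value u f) = generator f"
    proof (rule cSup_eq_maximum)
      show "generator f \<in> (\<lambda>u. levy_khintchine_value u f) ` U" using attained[OF f] by force
      show "x \<le> generator f" if "x \<in> (\<lambda>u. levy_khintchine_value u f) ` U" for x
        using that f unfolding U_def by auto
    qed
    then show "generator f = (SUP u\<in>U. levy_khintchine_value u f)" by simp
  qed
qed

end

section \<open>From G-Levy processes to semigroups\<close>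

lemma fam_norm_Suc_0: "fam_norm (Suc 0) x = norm (x 0)"
  by (simp add: fam_norm_def L2_set_def lessThan_Suc)

lemma norm_le_fam_norm: "i < n \<Longrightarrow> norm (x i) \<le> fam_norm n x"
  unfolding fam_norm_def by (rule member_le_L2_set) auto

context sublinear_expectation_space
begin

lemma E_add_le:
  assumes X: "X \<in> H" and Y: "Y \<in> H"
  shows "E (\<lambda>\<omega>. X \<omega> + Y \<omega>) \<le> E X + E Y"
  using E_subadd[OF H_add[OF X Y] Y] by simp

lemma H_const: "(\<lambda>\<omega>. c) \<in> H"
proof -
  have "C_Lip_fam 0 (\<lambda>x :: nat \<Rightarrow> real. c)"
    unfolding C_Lip_fam_def by (intro exI[of _ 0]) simp
  then show ?thesis by (rule H_Lip[of 0 "\<lambda>i \<omega>. 0", rotated]) simp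
qed

text \<open>The closure property of \<open>H\<close> concerns finite families of real random variables; it is applied to the
  coordinates with respect to an enumerated basis.\<close>

lemma C_Lip_random_vector_in_H:
  fixes Y :: "'w \<Rightarrow> 'a::euclidean_space"
  assumes Y: "random_vector H Y" and f: "C_Lip f"
  shows "(\<lambda>\<omega>. f (Y \<omega>)) \<in> H"
proof -
  obtain b where b: "bij_betw b {..<DIM('a)} (Basis :: 'a set)"
    using ex_bij_betw_nat_finite[OF finite_Basis] unfolding atLeast0LessThan by blast
  obtain L where L: "0 \<le> L" "\<And>x y. \<bar>f x - f y\<bar> \<le> L * norm (x - y)"
    using C_LipD[OF f] by blast
  define \<phi> where "\<phi> x = f (\<Sum>i<DIM('a). x i *\<^sub>R b i)" for x :: "nat \<Rightarrow> real"
  have "C_Lip_fam (DIM('a)) \<phi>"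
    unfolding C_Lip_fam_def
  proof (intro exI allI)
    fix x y :: "nat \<Rightarrow> real"
    let ?N = "fam_norm (DIM('a)) (\<lambda>i. x i - y i)"
    have "norm (\<Sum>i<DIM('a). (x i - y i) *\<^sub>R b i) \<le> (\<Sum>i<DIM('a). norm ((x i - y i) *\<^sub>R b i))"
      by (rule norm_sum)
    also have "\<dots> \<le> (\<Sum>i<DIM('a). ?N)"
    proof (rule sum_mono)
      fix i assume i: "i \<in> {..<DIM('a)}"
      then have "b i \<in> Basis" using b by (auto simp: bij_betw_def)
      then show "norm ((x i - y i) *\<^sub>R b i) \<le> ?N"
        using norm_le_fam_norm[of i "DIM('a)" "\<lambda>i. x i - y i"] i by simp
    qed
    finally have le: "norm (\<Sum>i<DIM('a). (x i - y i) *\<^sub>R b i) \<le> DIM('a) * ?N" by simp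
    have "\<bar>\<phi> x - \<phi> y\<bar> \<le> L * norm (\<Sum>i<DIM('a). (x i - y i) *\<^sub>R b i)"
      using L(2)[of "\<Sum>i<DIM('a). x i *\<^sub>R b i" "\<Sum>i<DIM('a). y i *\<^sub>R b i"]
      by (simp add: \<phi>_def scaleR_left_diff_distrib sum_subtractf)
    also have "\<dots> \<le> (L * DIM('a)) * ?N" using mult_left_mono[OF le L(1)] by (simp add: mult.assoc)
    finally show "\<bar>\<phi> x - \<phi> y\<bar> \<le> (L * DIM('a)) * ?N" .
  qed
  moreover have "(\<lambda>\<omega>. Y \<omega> \<bullet> b i) \<in> H" if "i < DIM('a)" for i
    using Y b that unfolding random_vector_def bij_betw_def by blast
  ultimately have "(\<lambda>\<omega>. \<phi> (\<lambda>i. Y \<omega> \<bullet> b i)) \<in> H" by (rule H_Lip[rotated])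
  moreover have "\<phi> (\<lambda>i. Y \<omega> \<bullet> b i) = f (Y \<omega>)" for \<omega>
  proof -
    have "(\<Sum>i<DIM('a). (Y \<omega> \<bullet> b i) *\<^sub>R b i) = (\<Sum>u\<in>Basis. (Y \<omega> \<bullet> u) *\<^sub>R u)"
      using sum.reindex_bij_betw[OF b, of "\<lambda>u. (Y \<omega> \<bullet> u) *\<^sub>R u"] .
    then show ?thesis by (simp add: \<phi>_def euclidean_representation)
  qed
  ultimately show ?thesis by simp
qed

text \<open>Independence of the increment, applied to \<open>f (x + y)\<close>, and its stationarity.\<close>

lemma levy_process_markov:
  fixes X :: "real \<Rightarrow> 'w \<Rightarrow> 'a::euclidean_space"
  assumes X: "levy_process H E X" and t: "0 < t" and s: "0 < s" and f: "C_Lip f"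
  shows "E (\<lambda>\<omega>. f (X (t + s) \<omega>)) = E (\<lambda>\<omega>. E (\<lambda>\<omega>'. f (X t \<omega> + X s \<omega>')))"
proof -
  let ?Y = "\<lambda>\<omega>. X (t + s) \<omega> - X t \<omega>"
  let ?\<phi> = "\<lambda>(x :: nat \<Rightarrow> 'a) y. f (x 0 + y)"
  obtain L where L: "0 \<le> L" "\<And>x y. \<bar>f x - f y\<bar> \<le> L * norm (x - y)"
    using C_LipD[OF f] by blast
  have "C_Lip_fam_vec (Suc 0) ?\<phi>"
    unfolding C_Lip_fam_vec_def
  proof (intro exI allI)
    fix x x' :: "nat \<Rightarrow> 'a" and y y' :: 'a
    let ?p = "(fam_norm (Suc 0) (\<lambda>i. x i - x' i), y - y')"
    have "norm ((x 0 + y) - (x' 0 + y')) \<le> norm (x 0 - x' 0) + norm (y - y')"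
      using norm_triangle_ineq[of "x 0 - x' 0" "y - y'"] by (simp add: algebra_simps)
    also have "\<dots> \<le> 2 * norm ?p"
      using norm_fst_le[of "fst ?p" "snd ?p"] norm_snd_le[of "snd ?p" "fst ?p"] by (simp add: fam_norm_Suc_0)
    finally have "L * norm ((x 0 + y) - (x' 0 + y')) \<le> L * (2 * norm ?p)"
      using L(1) by (rule mult_left_mono)
    then show "\<bar>f (x 0 + y) - f (x' 0 + y')\<bar> \<le> (2 * L) * norm ?p"
      using L(2)[of "x 0 + y" "x' 0 + y'"] by simp
  qed
  moreover have "independent_from E ?Y (Suc 0) (\<lambda>i. X t)"
    using X t s unfolding levy_process_def
    by (auto dest!: spec[of _ t] spec[of _ s] spec[of _ "Suc 0"] spec[of _ "\<lambda>i. t"])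
  ultimately have "E (\<lambda>\<omega>. f (X t \<omega> + ?Y \<omega>)) = E (\<lambda>\<omega>. E (\<lambda>\<omega>'. f (X t \<omega> + ?Y \<omega>')))"
    unfolding independent_from_def by blast
  moreover have "E (\<lambda>\<omega>'. f (x + ?Y \<omega>')) = E (\<lambda>\<omega>'. f (x + X s \<omega>'))" for x
  proof -
    have "identically_distributed E ?Y E (\<lambda>\<omega>. X (0 + s) \<omega> - X 0 \<omega>)"
      using X t s unfolding levy_process_def by (metis less_imp_le order_refl)
    moreover have "X 0 \<omega> = 0" for \<omega> using X unfolding levy_process_def by blast
    ultimately show ?thesis
      using C_Lip_shift[OF f, of x] unfolding identically_distributed_def
      by (elim allE[of _ "\<lambda>y. f (x + y)"]) simp
  qed
  ultimately show ?thesis by simp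
qed

end

lemma locally_Lip_fam2_if_Lip:
  assumes "\<And>x' x'' y' y''. \<bar>\<psi> x' y' - \<psi> x'' y''\<bar>
      \<le> L * norm (fam_norm m (\<lambda>i. x' i - x'' i), fam_norm n (\<lambda>j. y' j - y'' j))"
  shows "locally_Lip_fam2 m n \<psi>"
proof -
  have "\<exists>r>0. \<exists>L. \<forall>x' x'' y' y''.
        fam_norm m (\<lambda>i. x' i - x i) < r \<longrightarrow> fam_norm m (\<lambda>i. x'' i - x i) < r \<longrightarrow>
        fam_norm n (\<lambda>j. y' j - y j) < r \<longrightarrow> fam_norm n (\<lambda>j. y'' j - y j) < r \<longrightarrow>
        \<bar>\<psi> x' y' - \<psi> x'' y''\<bar>
          \<le> L * norm (fam_norm m (\<lambda>i. x' i - x'' i), fam_norm n (\<lambda>j. y' j - y'' j))" for x y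
    by (rule exI[of _ 1], intro conjI zero_less_one, rule exI[of _ L], intro allI impI, rule assms)
  then show ?thesis unfolding locally_Lip_fam2_def by blast
qed

lemma integrability_convention_single_time:
  assumes I: "integrability_convention H' Xc Xd" and t: "0 \<le> t"
    and lip: "locally_Lip_fam2 (Suc 0) (Suc 0) \<psi>"
    and growth: "\<exists>K. \<forall>x y. \<bar>\<psi> x y\<bar> \<le> K * (1 + fam_norm (Suc 0) x ^ 3 + fam_norm (Suc 0) y)"
  shows "(\<lambda>\<omega>. \<psi> (\<lambda>i. Xc t \<omega>) (\<lambda>j. Xd t \<omega>)) \<in> H'"
proof -
  note at_time = I[unfolded integrability_convention_def, THEN spec, of "Suc 0", THEN spec, of "Suc 0",
      THEN spec, of "\<lambda>_. t", THEN spec, of "\<lambda>_. t", THEN spec, of \<psi>]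
  show ?thesis
    by (rule at_time[THEN mp, THEN mp, THEN mp, THEN mp]) (use t in simp, use t in simp, rule lip, rule growth)
qed

lemma integrable_C_Lip_sum:
  fixes Xc Xd :: "real \<Rightarrow> 'v \<Rightarrow> 'a::euclidean_space"
  assumes I: "integrability_convention H' Xc Xd" and f: "C_Lip f" and t: "0 \<le> t"
  shows "(\<lambda>\<omega>. f (Xc t \<omega> + Xd t \<omega>)) \<in> H'"
proof -
  obtain L where L: "0 \<le> L" "\<And>x y. \<bar>f x - f y\<bar> \<le> L * norm (x - y)"
    using C_LipD[OF f] by blast
  let ?\<psi> = "\<lambda>(x :: nat \<Rightarrow> 'a) (y :: nat \<Rightarrow> 'a). f (x 0 + y 0)"
  have "locally_Lip_fam2 (Suc 0) (Suc 0) ?\<psi>"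
  proof (rule locally_Lip_fam2_if_Lip, unfold fam_norm_Suc_0)
    fix x' x'' y' y'' :: "nat \<Rightarrow> 'a"
    let ?p = "(norm (x' 0 - x'' 0), norm (y' 0 - y'' 0))"
    have "norm ((x' 0 + y' 0) - (x'' 0 + y'' 0)) \<le> norm (x' 0 - x'' 0) + norm (y' 0 - y'' 0)"
      using norm_triangle_ineq[of "x' 0 - x'' 0" "y' 0 - y'' 0"] by (simp add: algebra_simps)
    also have "\<dots> \<le> 2 * norm ?p"
      using norm_fst_le[of "fst ?p" "snd ?p"] norm_snd_le[of "snd ?p" "fst ?p"] by simp
    finally have "L * norm ((x' 0 + y' 0) - (x'' 0 + y'' 0)) \<le> L * (2 * norm ?p)"
      using L(1) by (rule mult_left_mono)
    then show "\<bar>f (x' 0 + y' 0) - f (x'' 0 + y'' 0)\<bar> \<le> 2 * L * norm ?p"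
      using L(2)[of "x' 0 + y' 0" "x'' 0 + y'' 0"] by simp
  qed
  moreover have "\<exists>K. \<forall>x y. \<bar>?\<psi> x y\<bar> \<le> K * (1 + fam_norm (Suc 0) x ^ 3 + fam_norm (Suc 0) y)"
    unfolding fam_norm_Suc_0
  proof (intro exI[of _ "\<bar>f 0\<bar> + L"] allI)
    fix x y :: "nat \<Rightarrow> 'a"
    have "norm (x 0) \<le> 1 + norm (x 0) ^ 3"
    proof (cases "norm (x 0) \<le> 1")
      case True
      have "0 \<le> norm (x 0) ^ 3" by simp
      with True show ?thesis by linarith
    next
      case False
      then show ?thesis using power_increasing[of 1 3 "norm (x 0)"] by simp
    qed
    then have "norm (x 0 + y 0) \<le> 1 + norm (x 0) ^ 3 + norm (y 0)"
      using norm_triangle_ineq[of "x 0" "y 0"] by linarith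
    then have "L * norm (x 0 + y 0) \<le> L * (1 + norm (x 0) ^ 3 + norm (y 0))"
      using L(1) by (rule mult_left_mono)
    moreover have "\<bar>f 0\<bar> * 1 \<le> \<bar>f 0\<bar> * (1 + norm (x 0) ^ 3 + norm (y 0))"
      by (intro mult_left_mono) auto
    moreover have "\<bar>f (x 0 + y 0)\<bar> \<le> \<bar>f 0\<bar> + L * norm (x 0 + y 0)"
      using L(2)[of "x 0 + y 0" 0] by simp
    ultimately show "\<bar>f (x 0 + y 0)\<bar> \<le> (\<bar>f 0\<bar> + L) * (1 + norm (x 0) ^ 3 + norm (y 0))"
      unfolding distrib_right[of "\<bar>f 0\<bar>" L] by linarith
  qed
  ultimately show ?thesis
    using integrability_convention_single_time[OF I t, of ?\<psi>] by simp
qed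

lemma integrable_norm_cube:
  fixes Xc Xd :: "real \<Rightarrow> 'v \<Rightarrow> 'a::euclidean_space"
  assumes I: "integrability_convention H' Xc Xd" and t: "0 \<le> t"
  shows "(\<lambda>\<omega>. norm (Xc t \<omega>) ^ 3) \<in> H'"
proof -
  let ?\<psi> = "\<lambda>(x :: nat \<Rightarrow> 'a) (y :: nat \<Rightarrow> 'a). norm (x 0) ^ 3"
  have cube: "\<bar>a ^ 3 - b ^ 3\<bar> \<le> 3 * R\<^sup>2 * \<bar>a - b\<bar>" if "0 \<le> a" "a \<le> R" "0 \<le> b" "b \<le> R" for a b R :: real
  proof -
    have "a ^ 3 - b ^ 3 = (a - b) * (a * a + a * b + b * b)"
      by (simp add: power3_eq_cube algebra_simps)
    then have eq: "\<bar>a ^ 3 - b ^ 3\<bar> = \<bar>a - b\<bar> * \<bar>a * a + a * b + b * b\<bar>"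
      by (simp add: abs_mult)
    have "\<bar>a * a + a * b + b * b\<bar> \<le> R * R + R * R + R * R"
    proof -
      have "a * a + a * b + b * b \<le> R * R + R * R + R * R" using that by (intro add_mono mult_mono) auto
      moreover have "0 \<le> a * a + a * b + b * b" using that by simp
      ultimately show ?thesis by simp
    qed
    then have "\<bar>a - b\<bar> * \<bar>a * a + a * b + b * b\<bar> \<le> \<bar>a - b\<bar> * (R * R + R * R + R * R)"
      by (intro mult_left_mono) auto
    also have "\<dots> = 3 * R\<^sup>2 * \<bar>a - b\<bar>" by (simp add: power2_eq_square)
    finally show ?thesis unfolding eq .
  qed
  have "locally_Lip_fam2 (Suc 0) (Suc 0) ?\<psi>"
    unfolding locally_Lip_fam2_def fam_norm_Suc_0
  proof (intro allI)
    fix x y :: "nat \<Rightarrow> 'a"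
    define R where "R = norm (x 0) + 1"
    show "\<exists>r>0. \<exists>L. \<forall>x' x'' y' y''. norm (x' 0 - x 0) < r \<longrightarrow> norm (x'' 0 - x 0) < r \<longrightarrow>
        norm (y' 0 - y 0) < r \<longrightarrow> norm (y'' 0 - y 0) < r \<longrightarrow>
        \<bar>norm (x' 0) ^ 3 - norm (x'' 0) ^ 3\<bar> \<le> L * norm (norm (x' 0 - x'' 0), norm (y' 0 - y'' 0))"
    proof (rule exI[of _ "1 :: real"], intro conjI zero_less_one,
        rule exI[of _ "3 * R\<^sup>2"], intro allI impI)
      fix x' x'' y' y'' :: "nat \<Rightarrow> 'a"
      assume "norm (x' 0 - x 0) < 1" "norm (x'' 0 - x 0) < 1"
      then have "norm (x' 0) \<le> R" "norm (x'' 0) \<le> R"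
        using norm_triangle_ineq2[of "x' 0" "x 0"] norm_triangle_ineq2[of "x'' 0" "x 0"]
        by (auto simp: R_def)
      then have "\<bar>norm (x' 0) ^ 3 - norm (x'' 0) ^ 3\<bar> \<le> 3 * R\<^sup>2 * \<bar>norm (x' 0) - norm (x'' 0)\<bar>"
        by (intro cube) auto
      also have "\<dots> \<le> 3 * R\<^sup>2 * norm (norm (x' 0 - x'' 0), norm (y' 0 - y'' 0))"
      proof (intro mult_left_mono)
        show "\<bar>norm (x' 0) - norm (x'' 0)\<bar> \<le> norm (norm (x' 0 - x'' 0), norm (y' 0 - y'' 0))"
          using norm_triangle_ineq3[of "x' 0" "x'' 0"]
            norm_fst_le[of "norm (x' 0 - x'' 0)" "norm (y' 0 - y'' 0)"] by simp
      qed simp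
      finally show "\<bar>norm (x' 0) ^ 3 - norm (x'' 0) ^ 3\<bar>
          \<le> 3 * R\<^sup>2 * norm (norm (x' 0 - x'' 0), norm (y' 0 - y'' 0))" .
    qed
  qed
  moreover have "\<exists>K. \<forall>x y. \<bar>?\<psi> x y\<bar> \<le> K * (1 + fam_norm (Suc 0) x ^ 3 + fam_norm (Suc 0) y)"
    unfolding fam_norm_Suc_0 by (intro exI[of _ 1]) auto
  ultimately show ?thesis
    using integrability_convention_single_time[OF I t, of ?\<psi>] by simp
qed

lemma integrable_norm_jump_part:
  fixes Xc Xd :: "real \<Rightarrow> 'v \<Rightarrow> 'a::euclidean_space"
  assumes I: "integrability_convention H' Xc Xd" and t: "0 \<le> t"
  shows "(\<lambda>\<omega>. norm (Xd t \<omega>)) \<in> H'"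
proof -
  let ?\<psi> = "\<lambda>(x :: nat \<Rightarrow> 'a) (y :: nat \<Rightarrow> 'a). norm (y 0)"
  have "locally_Lip_fam2 (Suc 0) (Suc 0) ?\<psi>"
  proof (rule locally_Lip_fam2_if_Lip, unfold fam_norm_Suc_0)
    fix x' x'' y' y'' :: "nat \<Rightarrow> 'a"
    show "\<bar>norm (y' 0) - norm (y'' 0)\<bar> \<le> 1 * norm (norm (x' 0 - x'' 0), norm (y' 0 - y'' 0))"
      using norm_triangle_ineq3[of "y' 0" "y'' 0"]
        norm_snd_le[of "norm (y' 0 - y'' 0)" "norm (x' 0 - x'' 0)"] by simp
  qed
  moreover have "\<exists>K. \<forall>x y. \<bar>?\<psi> x y\<bar> \<le> K * (1 + fam_norm (Suc 0) x ^ 3 + fam_norm (Suc 0) y)"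
    unfolding fam_norm_Suc_0 by (intro exI[of _ 1]) auto
  ultimately show ?thesis
    using integrability_convention_single_time[OF I t, of ?\<psi>] by simp
qed

text \<open>The continuous part enters through its third moment and the jump part through its first moment, as
  \<open>f (Xc t + Xd t) \<le> f (Xc t) + L * norm (Xd t)\<close>; here \<open>m t\<close> is the third moment of the continuous part
  divided by \<open>t\<close>.\<close>

lemma G_levy_marginal_bound:
  fixes X :: "real \<Rightarrow> 'w \<Rightarrow> 'a::euclidean_space"
  assumes G: "G_levy_process TYPE('v) H E X"
  obtains m C where "(m \<longlongrightarrow> 0) (at_right 0)"
    "\<And>f L a b t. 0 \<le> t \<Longrightarrow> 0 \<le> L \<Longrightarrow> (\<And>x y. \<bar>f x - f y\<bar> \<le> L * norm (x - y)) \<Longrightarrow>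
       0 \<le> b \<Longrightarrow> (\<And>z. f z \<le> a + b * norm z ^ 3) \<Longrightarrow>
       E (\<lambda>\<omega>. f (X t \<omega>)) \<le> a + b * (m t * t) + L * (C * t)"
proof -
  obtain H' :: "('v \<Rightarrow> real) set" and E' and Xc Xd :: "real \<Rightarrow> 'v \<Rightarrow> 'a" and C where
    E': "sublinear_expectation_space H' E'" and I: "integrability_convention H' Xc Xd"
    and same: "same_fin_dim_distributions E X E' (\<lambda>t \<omega>. Xc t \<omega> + Xd t \<omega>)"
    and cube: "((\<lambda>t. E' (\<lambda>\<omega>. norm (Xc t \<omega>) ^ 3) / t) \<longlongrightarrow> 0) (at_right 0)"
    and C: "\<And>t. 0 \<le> t \<Longrightarrow> E' (\<lambda>\<omega>. norm (Xd t \<omega>)) \<le> C * t"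
    and levy': "levy_process H' E' (\<lambda>t \<omega>. (Xc t \<omega>, Xd t \<omega>))"
    using G unfolding G_levy_process_def by blast
  interpret E': sublinear_expectation_space H' E' by (rule E')
  let ?m = "\<lambda>t. E' (\<lambda>\<omega>. norm (Xc t \<omega>) ^ 3) / t"
  show thesis
  proof (rule that[of ?m C, OF cube])
    fix f :: "'a \<Rightarrow> real" and L a b t :: real
    assume t: "0 \<le> t" and L: "0 \<le> L" "\<And>x y. \<bar>f x - f y\<bar> \<le> L * norm (x - y)"
      and b: "0 \<le> b" and le: "\<And>z. f z \<le> a + b * norm z ^ 3"
    have lip: "C_Lip f" by (rule C_LipI[OF L(2)])
    let ?c = "\<lambda>\<omega>. norm (Xc t \<omega>) ^ 3" and ?d = "\<lambda>\<omega>. norm (Xd t \<omega>)"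
    have H: "?c \<in> H'" "?d \<in> H'" "(\<lambda>\<omega>. f (Xc t \<omega> + Xd t \<omega>)) \<in> H'"
      using integrable_norm_cube[OF I t] integrable_norm_jump_part[OF I t]
        integrable_C_Lip_sum[OF I lip t] by blast+
    have "C_Lip_fam (Suc 0) (\<lambda>x. f (x 0))"
      unfolding C_Lip_fam_def fam_norm_Suc_0 using L(2) by blast
    then have "E (\<lambda>\<omega>. f (X t \<omega>)) = E' (\<lambda>\<omega>. f (Xc t \<omega> + Xd t \<omega>))"
      using same[unfolded same_fin_dim_distributions_def, THEN spec, of "Suc 0",
          THEN spec, of "\<lambda>_. t", THEN spec, of "\<lambda>x. f (x 0)"] t by simp
    also have "\<dots> \<le> E' (\<lambda>\<omega>. (a + b * ?c \<omega>) + L * ?d \<omega>)"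
    proof (rule E'.E_mono)
      show "(\<lambda>\<omega>. (a + b * ?c \<omega>) + L * ?d \<omega>) \<in> H'"
        by (intro E'.H_add E'.H_scale E'.H_const H)
      show "f (Xc t \<omega> + Xd t \<omega>) \<le> (a + b * ?c \<omega>) + L * ?d \<omega>" for \<omega>
        using L(2)[of "Xc t \<omega> + Xd t \<omega>" "Xc t \<omega>"] le[of "Xc t \<omega>"] by simp
    qed (rule H)
    also have "\<dots> \<le> E' (\<lambda>\<omega>. a + b * ?c \<omega>) + E' (\<lambda>\<omega>. L * ?d \<omega>)"
      by (intro E'.E_add_le E'.H_add E'.H_scale E'.H_const H)
    also have "\<dots> \<le> (E' (\<lambda>\<omega>. a) + E' (\<lambda>\<omega>. b * ?c \<omega>)) + E' (\<lambda>\<omega>. L * ?d \<omega>)"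
      by (intro add_right_mono E'.E_add_le E'.H_scale E'.H_const H)
    also have "\<dots> = a + b * E' ?c + L * E' ?d"
      using E'.E_const[of a] E'.E_pos_homogeneous[OF H(1) b] E'.E_pos_homogeneous[OF H(2) L(1)] by simp
    also have "\<dots> \<le> a + b * E' ?c + L * (C * t)"
      by (intro add_left_mono mult_left_mono C t L)
    also have "E' ?c = ?m t * t"
    proof (cases "t = 0")
      case True
      have "Xc 0 \<omega> = 0" for \<omega> using levy' unfolding levy_process_def by (simp add: prod_eq_iff)
      then show ?thesis using True E'.E_const[of 0] by simp
    qed simp
    finally show "E (\<lambda>\<omega>. f (X t \<omega>)) \<le> a + b * (?m t * t) + L * (C * t)" .
  qed
qed

text \<open>The marginal bound is used twice: for \<open>norm\<close>, with \<open>norm z \<le> e + norm z ^ 3 / e\<^sup>2\<close>, it shows that the first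
  moment tends to \<open>0\<close>, and for \<open>jump_weight e\<close> it gives a growth rate that does not depend on \<open>e\<close>.\<close>

lemma G_levy_semigroup:
  fixes X :: "real \<Rightarrow> 'w \<Rightarrow> real^'d::finite"
  assumes space: "sublinear_expectation_space H E" and G: "G_levy_process TYPE('v) H E X"
  shows "\<exists>Kj. levy_semigroup (\<lambda>t f. E (\<lambda>\<omega>. f (X t \<omega>))) Kj"
proof -
  interpret sublinear_expectation_space H E by (rule space)
  have levy: "levy_process H E X" using G unfolding G_levy_process_def by blast
  have X_H: "random_vector H (X t)" if "0 < t" for t
    using levy that unfolding levy_process_def cadlag_process_def by simp
  note in_H = C_Lip_random_vector_in_H[OF X_H]
  obtain m C where m: "(m \<longlongrightarrow> 0) (at_right 0)" and bound:
    "\<And>f L a b t. 0 \<le> t \<Longrightarrow> 0 \<le> L \<Longrightarrow> (\<And>x y. \<bar>f x - f y\<bar> \<le> L * norm (x - y)) \<Longrightarrow>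
       0 \<le> b \<Longrightarrow> (\<And>z. f z \<le> a + b * norm z ^ 3) \<Longrightarrow>
       E (\<lambda>\<omega>. f (X t \<omega>)) \<le> a + b * (m t * t) + L * (C * t)"
    using G_levy_marginal_bound[OF G] by blast
  have "levy_semigroup (\<lambda>t f. E (\<lambda>\<omega>. f (X t \<omega>))) (3 * C + 1)"
  proof
    fix t :: real and f g :: "real^'d \<Rightarrow> real" assume t: "0 < t" and f: "C_Lip f" and g: "C_Lip g"
    show "E (\<lambda>\<omega>. f (X t \<omega>)) \<le> E (\<lambda>\<omega>. g (X t \<omega>))" if "\<And>x. f x \<le> g x"
      by (rule E_mono[OF in_H[OF t g] in_H[OF t f]]) (rule that)
    show "E (\<lambda>\<omega>. f (X t \<omega>) + g (X t \<omega>)) \<le> E (\<lambda>\<omega>. f (X t \<omega>)) + E (\<lambda>\<omega>. g (X t \<omega>))"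
      by (rule E_add_le[OF in_H[OF t f] in_H[OF t g]])
  next
    fix t c :: real
    show "E (\<lambda>\<omega>. c) = c" by (rule E_const)
  next
    fix t c :: real and f :: "real^'d \<Rightarrow> real" assume "0 < t" "C_Lip f" "0 \<le> c"
    then show "E (\<lambda>\<omega>. c * f (X t \<omega>)) = c * E (\<lambda>\<omega>. f (X t \<omega>))"
      by (intro E_pos_homogeneous in_H)
  next
    fix t s :: real and f :: "real^'d \<Rightarrow> real" assume "0 < t" "0 < s" "C_Lip f"
    then show "E (\<lambda>\<omega>. f (X (t + s) \<omega>)) = E (\<lambda>\<omega>. E (\<lambda>\<omega>'. f (X t \<omega> + X s \<omega>')))"
      by (rule levy_process_markov[OF levy])
  next
    show "((\<lambda>t. E (\<lambda>\<omega>. norm (X t \<omega>))) \<longlongrightarrow> 0) (at_right 0)"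
    proof (rule order_tendstoI)
      fix a :: real assume a: "a < 0"
      show "\<forall>\<^sub>F t in at_right 0. a < E (\<lambda>\<omega>. norm (X t \<omega>))"
        using eventually_at_right_0_pos
      proof eventually_elim
        case (elim t)
        have "E (\<lambda>\<omega>. 0) \<le> E (\<lambda>\<omega>. norm (X t \<omega>))"
          by (rule E_mono[OF in_H[OF elim C_Lip_norm] H_const]) simp
        then show ?case using a E_const[of 0] by linarith
      qed
    next
      fix a :: real assume a: "0 < a"
      define e where "e = a / 2"
      have e: "0 < e" "e < a" using a by (auto simp: e_def)
      have "((\<lambda>t. e + 1 / e\<^sup>2 * (m t * t) + 1 * (C * t)) \<longlongrightarrow> e + 1 / e\<^sup>2 * (0 * 0) + 1 * (C * 0)) (at_right 0)"
        by (intro tendsto_intros m)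
      then have "\<forall>\<^sub>F t in at_right 0. e + 1 / e\<^sup>2 * (m t * t) + 1 * (C * t) < a"
        by (rule order_tendstoD(2)) (use e in simp)
      then show "\<forall>\<^sub>F t in at_right 0. E (\<lambda>\<omega>. norm (X t \<omega>)) < a"
        using eventually_at_right_0_pos
      proof eventually_elim
        case (elim t)
        have "norm z \<le> e + 1 / e\<^sup>2 * norm z ^ 3" for z :: "real^'d"
        proof (cases "norm z \<le> e")
          case True
          have "0 \<le> 1 / e\<^sup>2 * norm z ^ 3" by simp
          with True show ?thesis by linarith
        next
          case False
          have "norm z * e\<^sup>2 \<le> norm z * (norm z)\<^sup>2"
            using False e by (intro mult_left_mono power_mono) auto
          then have "norm z \<le> 1 / e\<^sup>2 * norm z ^ 3"
            using e by (simp add: pos_le_divide_eq power2_eq_square power3_eq_cube)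
          then show ?thesis using e by linarith
        qed
        then have "E (\<lambda>\<omega>. norm (X t \<omega>)) \<le> e + 1 / e\<^sup>2 * (m t * t) + 1 * (C * t)"
          using elim(2) by (intro bound) (auto simp: norm_triangle_ineq3)
        then show ?case using elim(1) by linarith
      qed
    qed
  next
    fix e :: real assume e: "0 < e"
    have "\<forall>\<^sub>F t in at_right 0. m t < e\<^sup>2"
      by (rule order_tendstoD(2)[OF m]) (use e in simp)
    then show "\<forall>\<^sub>F t in at_right 0. E (\<lambda>\<omega>. jump_weight e (X t \<omega>)) \<le> (3 * C + 1) * t"
      using eventually_at_right_0_pos
    proof eventually_elim
      case (elim t)
      have "E (\<lambda>\<omega>. jump_weight e (X t \<omega>)) \<le> 0 + 1 / e\<^sup>2 * (m t * t) + 3 * (C * t)"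
        using elim(2) by (intro bound jump_weight_lipschitz[OF e]) (auto simp: jump_weight_def)
      moreover have "1 / e\<^sup>2 * (m t * t) \<le> t"
      proof -
        have "m t * t \<le> e\<^sup>2 * t" using elim by (intro mult_right_mono) auto
        then show ?thesis using e by (simp add: divide_le_eq mult.commute)
      qed
      ultimately show ?case by (simp add: distrib_right)
    qed
  qed
  then show ?thesis by blast
qed

theorem theorem35:
  fixes H :: "('w \<Rightarrow> real) set"
    and E :: "('w \<Rightarrow> real) \<Rightarrow> real"
    and X :: "real \<Rightarrow> 'w \<Rightarrow> real^'d::finite"
  assumes "sublinear_expectation_space H E"
    and "G_levy_process TYPE('v) H E X"
  shows "\<exists>U :: ((real^'d) measure \<times> (real^'d) \<times> (real^'d^'d)) set.
    U \<noteq> {} \<and>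
    (\<forall>(v, q, Q)\<in>U. sets v = sets (restrict_space borel (UNIV - {0}))) \<and>
    (SUP (v, q, Q)\<in>U. (\<integral>\<^sup>+z. ennreal (norm z) \<partial>v) + ennreal (norm q)
                        + ennreal (trace (Q ** transpose Q))) < \<infinity> \<and>
    (\<forall>f. C_b 3 f \<and> f 0 = 0 \<longrightarrow>
       ((\<lambda>\<delta>. E (\<lambda>\<omega>. f (X \<delta> \<omega>)) / \<delta>) \<longlongrightarrow> G_X E X f) (at_right 0) \<and>
       G_X E X f = (SUP (v, q, Q)\<in>U. (\<integral>z. f z \<partial>v) + grad f 0 \<bullet> q
                                     + 1/2 * trace (hessian f 0 ** (Q ** transpose Q))))"
proof -
  obtain Kj where "levy_semigroup (\<lambda>t f. E (\<lambda>\<omega>. f (X t \<omega>))) Kj"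
    using G_levy_semigroup[OF assms] by blast
  then interpret levy_semigroup "\<lambda>t f. E (\<lambda>\<omega>. f (X t \<omega>))" Kj .
  have gen: "generator f = G_X E X f" for f by (simp add: generator_def G_X_def)
  obtain U :: "((real^'d) measure \<times> (real^'d) \<times> (real^'d^'d)) set" where U:
    "U \<noteq> {}"
    "\<And>v q Q. (v, q, Q) \<in> U \<Longrightarrow> sets v = sets (restrict_space borel (UNIV - {0}))"
    "(SUP u\<in>U. levy_khintchine_size u) < \<infinity>"
    "\<And>f. C_b 3 f \<Longrightarrow> f 0 = 0 \<Longrightarrow> generator f = (SUP u\<in>U. levy_khintchine_value u f)"
    using generator_representation by blast
  show ?thesis
  proof (intro exI[of _ U] conjI allI impI)
    fix f :: "real^'d \<Rightarrow> real" assume f: "C_b 3 f \<and> f 0 = 0"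
    show "((\<lambda>\<delta>. E (\<lambda>\<omega>. f (X \<delta> \<omega>)) / \<delta>) \<longlongrightarrow> G_X E X f) (at_right 0)"
      using generator_tendsto[of f] f unfolding gen by blast
    show "G_X E X f = (SUP (v, q, Q)\<in>U. (\<integral>z. f z \<partial>v) + grad f 0 \<bullet> q
        + 1/2 * trace (hessian f 0 ** (Q ** transpose Q)))"
      using U(4)[of f] f unfolding gen by blast
  qed (use U(1-3) in auto)
qed

end
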